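(* Let $N\ge2$. For all $u\in C_c^\infty(\mathbb{H}^N\setminus\{x_0\})$, $$\begin{aligned}\int_{\mathbb{H}^N}|\Delta_{r,\mathbb{H}^N}u|^2\,dv_{\mathbb{H}^N}={}&\left(\frac N2\right)^2\int_{\mathbb{H}^N}\frac{|\nabla_{r,\mathbb{H}^N}u|^2}{r^2}\,dv_{\mathbb{H}^N}+\frac{N(N-1)}{2}\int_{\mathbb{H}^N}\frac{r\coth r-1}{r^2}|\nabla_{r,\mathbb{H}^N}u|^2\,dv_{\mathbb{H}^N}\\&+\int_{\mathbb{H}^N}\frac{r^N}{(\sinh r)^{2(N-1)}}\left|\nabla_{r,\mathbb{H}^N}\left(\frac{(\sinh r)^{N-1}u_r}{r^{N/2}}\right)\right|^2dv_{\mathbb{H}^N}.\end{aligned}$$ Moreover, if $N\ge5$, for all $u\in C_c^\infty(\mathbb{H}^N\setminus\{x_0\})$, $$\begin{aligned}\int_{\mathbb{H}^N}|\Delta_{\mathbb{H}^N}u|^2\,dv_{\mathbb{H}^N}\ge{}&\left(\frac N2\right)^2\int_{\mathbb{H}^N}\frac{|\nabla_{\mathbb{H}^N}u|^2}{r^2}\,dv_{\mathbb{H}^N}+\frac{N(N-1)}{2}\int_{\mathbb{H}^N}\frac{r\coth r-1}{r^2}|\nabla_{\mathbb{H}^N}u|^2\,dv_{\mathbb{H}^N}\\&+\int_{\mathbb{H}^N}\frac{r^N}{(\sinh r)^{2(N-1)}}\left|\nabla_{\mathbb{H}^N}\left(\frac{(\sinh r)^{N-1}u_r}{r^{N/2}}\right)\right|^2dv_{\mathbb{H}^N},\end{aligned}$$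 and the constant $\left(\frac N2\right)^2$ on the right-hand side of both relations is sharp, i.e. it is the largest constant $C$ such that $\int_{\mathbb{H}^N}|\Delta_{r,\mathbb{H}^N}u|^2dv_{\mathbb{H}^N}\ge C\int_{\mathbb{H}^N}\frac{|\nabla_{r,\mathbb{H}^N}u|^2}{r^2}dv_{\mathbb{H}^N}$, respectively $\int_{\mathbb{H}^N}|\Delta_{\mathbb{H}^N}u|^2dv_{\mathbb{H}^N}\ge C\int_{\mathbb{H}^N}\frac{|\nabla_{\mathbb{H}^N}u|^2}{r^2}dv_{\mathbb{H}^N}$, holds for all $u\in C_c^\infty(\mathbb{H}^N\setminus\{x_0\})$.
   Context: $\mathbb{H}^N$ is the $N$-dimensional hyperbolic space (constant curvature $-1$) with Riemannian volume $dv_{\mathbb{H}^N}$, Laplace-Beltrami operator $\Delta_{\mathbb{H}^N}$ and Riemannian gradient $\nabla_{\mathbb{H}^N}$; $x_0\in\mathbb{H}^N$ is a fixed pole, $r=d(x,x_0)$ is the geodesic distance, and $(r,\Theta)\in(0,\infty)\times\mathbb{S}^{N-1}$ are polar coordinates about $x_0$, in which $dv_{\mathbb{H}^N}=(\sinh r)^{N-1}\,dr\,d\Theta$ and $|\nabla_{\mathbb{H}^N}u|^2=u_r^2+\frac{1}{\sinh^2 r}|\nabla_{\mathbb{S}^{N-1}}u|^2$. Functions are real-valued (not necessarily radial) and $u_r=\frac{\partial u}{\partial r}$. The radial gradient is $\nabla_{r,\mathbb{H}^N}u=(u_r,0)$, so $|\nabla_{r,\mathbb{H}^N}u|^2=u_r^2$;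 the radial Laplacian is $\Delta_{r,\mathbb{H}^N}u=u_{rr}+(N-1)\coth r\,u_r$. *)

theory Defs
  imports "HOL-Analysis.Analysis"
begin

text \<open>
  Hyperbolic space of dimension \<open>CARD('n)\<close> is the hyperboloid
  \<open>{(x, t). t\<^sup>2 - |x|\<^sup>2 = 1, t > 0}\<close> in Minkowski space, with the Riemannian metric induced by the
  Lorentz form. The projection \<open>(x, t) \<mapsto> x\<close> is a global chart onto the whole of \<open>real ^ 'n\<close>; points
  are identified with their image in it, and the pole may be any point.
\<close>

definition lorentz :: "(real ^ 'n) \<times> real \<Rightarrow> (real ^ 'n) \<times> real \<Rightarrow> real" where
  "lorentz p q = fst p \<bullet> fst q - snd p * snd q"

definition hyp_emb :: "real ^ 'n \<Rightarrow> (real ^ 'n) \<times> real" where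
  "hyp_emb x = (x, sqrt (1 + (norm x)\<^sup>2))"

definition hyp_metric :: "real ^ 'n \<Rightarrow> real ^ 'n \<Rightarrow> real ^ 'n \<Rightarrow> real" where
  "hyp_metric x v w =
     lorentz (frechet_derivative hyp_emb (at x) v) (frechet_derivative hyp_emb (at x) w)"

text \<open>The geodesic distance of the hyperboloid model.\<close>

definition hyp_dist :: "real ^ 'n \<Rightarrow> real ^ 'n \<Rightarrow> real" where
  "hyp_dist x y = arcosh (- lorentz (hyp_emb x) (hyp_emb y))"

definition hyp_density :: "real ^ 'n \<Rightarrow> real" where
  "hyp_density x = sqrt (det (\<chi> i j. hyp_metric x (axis i 1) (axis j 1)))"

definition hyp_volume :: "(real ^ 'n) measure" where
  "hyp_volume = density lborel (\<lambda>x. ennreal (hyp_density x))"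

definition hyp_grad :: "(real ^ 'n \<Rightarrow> real) \<Rightarrow> real ^ 'n \<Rightarrow> real ^ 'n" where
  "hyp_grad u x = (THE w. \<forall>v. hyp_metric x w v = frechet_derivative u (at x) v)"

definition hyp_grad_sq :: "(real ^ 'n \<Rightarrow> real) \<Rightarrow> real ^ 'n \<Rightarrow> real" where
  "hyp_grad_sq u x = hyp_metric x (hyp_grad u x) (hyp_grad u x)"

definition hyp_div :: "(real ^ 'n \<Rightarrow> real ^ 'n) \<Rightarrow> real ^ 'n \<Rightarrow> real" where
  "hyp_div F x =
     (\<Sum>i\<in>UNIV. frechet_derivative (\<lambda>y. hyp_density y * F y $ i) (at x) (axis i 1)) / hyp_density x"

definition hyp_laplacian :: "(real ^ 'n \<Rightarrow> real) \<Rightarrow> real ^ 'n \<Rightarrow> real" where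
  "hyp_laplacian u x = hyp_div (hyp_grad u) x"

text \<open>
  The unit speed geodesic from \<open>x0\<close> (at time \<open>0\<close>) through \<open>x \<noteq> x0\<close> (at time \<open>r = hyp_dist x0 x\<close>).
  On the hyperboloid it is \<open>t \<mapsto> (sinh (r - t) p0 + sinh t p) / sinh r\<close>, which is linear in the
  ambient points \<open>p0\<close>, \<open>p\<close>, so that the same formula holds in the chart. In polar coordinates about
  \<open>x0\<close> it is the ray \<open>t \<mapsto> (t, \<Theta>)\<close>.
\<close>

definition hyp_geodesic :: "real ^ 'n \<Rightarrow> real ^ 'n \<Rightarrow> real \<Rightarrow> real ^ 'n" where
  "hyp_geodesic x0 x t =
     (sinh (hyp_dist x0 x - t) / sinh (hyp_dist x0 x)) *\<^sub>R x0 + (sinh t / sinh (hyp_dist x0 x)) *\<^sub>R x"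

text \<open>
  \<open>radial_deriv x0 u\<close> is \<open>u\<^sub>r\<close>. At the pole itself it takes a dummy value, irrelevant for
  functions vanishing near \<open>x0\<close> and for integrals.
\<close>

definition radial_deriv :: "real ^ 'n \<Rightarrow> (real ^ 'n \<Rightarrow> real) \<Rightarrow> real ^ 'n \<Rightarrow> real" where
  "radial_deriv x0 u x = deriv (\<lambda>t. u (hyp_geodesic x0 x t)) (hyp_dist x0 x)"

definition radial_grad_sq :: "real ^ 'n \<Rightarrow> (real ^ 'n \<Rightarrow> real) \<Rightarrow> real ^ 'n \<Rightarrow> real" where
  "radial_grad_sq x0 u x = (radial_deriv x0 u x)\<^sup>2"

definition coth :: "real \<Rightarrow> real" where
  "coth r = cosh r / sinh r"

definition radial_laplacian :: "real ^ 'n \<Rightarrow> (real ^ 'n \<Rightarrow> real) \<Rightarrow> real ^ 'n \<Rightarrow> real" where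
  "radial_laplacian x0 u x =
     radial_deriv x0 (radial_deriv x0 u) x +
     (real CARD('n) - 1) * coth (hyp_dist x0 x) * radial_deriv x0 u x"

primrec Ck :: "nat \<Rightarrow> (real ^ 'n \<Rightarrow> real) \<Rightarrow> bool" where
  "Ck 0 u \<longleftrightarrow> continuous_on UNIV u"
| "Ck (Suc k) u \<longleftrightarrow>
     (\<forall>x. u differentiable (at x)) \<and> (\<forall>v. Ck k (\<lambda>x. frechet_derivative u (at x) v))"

text \<open>\<open>C\<^sub>c\<^sup>\<infinity>\<close> on the complement of \<open>x0\<close>; the functions are extended by \<open>0\<close> to \<open>x0\<close>.\<close>

definition test_functions :: "real ^ 'n \<Rightarrow> (real ^ 'n \<Rightarrow> real) set" where
  "test_functions x0 =
     {u. (\<forall>k. Ck k u) \<and> compact (closure {x. u x \<noteq> 0}) \<and> x0 \<notin> closure {x. u x \<noteq> 0}}"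

definition is_largest :: "real \<Rightarrow> (real \<Rightarrow> bool) \<Rightarrow> bool" where
  "is_largest C P \<longleftrightarrow> P C \<and> (\<forall>D. P D \<longrightarrow> D \<le> C)"

end

theory Submission
  imports Defs
begin

text \<open>
  A boost moves the pole to \<open>0\<close>, where the chart makes \<open>sinh r\<close> the Euclidean norm, \<open>\<partial>\<^sub>r\<close> a
  multiple of the Euler field, and the generators \<open>x\<^sub>i \<partial>\<^sub>j - x\<^sub>j \<partial>\<^sub>i\<close> of rotations commute with
  \<open>\<partial>\<^sub>r\<close>. Every integration by parts then follows from the vanishing of the integral of a directional
  derivative, and no integration in polar coordinates is needed. With \<open>f = u\<^sub>r\<close> the difference of the
  two sides of the radial identity is the divergence of \<open>N f\<^sup>2 / (2 r) \<partial>\<^sub>r\<close>.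

  For the full Laplacian, the cross term of \<open>\<Delta>\<^sub>r u\<close> with the spherical Laplacian splits over the
  rotations into integrals of \<open>w = (x\<^sub>i \<partial>\<^sub>j - x\<^sub>j \<partial>\<^sub>i) u\<close>, and the square of the spherical Laplacian
  is bounded below by \<open>N - 1\<close> times the spherical Dirichlet energy, by a Bochner argument instead of
  spherical harmonics. What remains is a one-dimensional inequality along rays for each \<open>w\<close>, which
  is proved by completing a square and for which \<open>N \<ge> 5\<close> is exactly the condition at the pole.
  The constant is attained asymptotically by radial functions concentrating at the pole.
\<close>

section \<open>Functions of class C k on open sets\<close>

text \<open>Test functions vanish near the pole, so they absorb every weight that is smooth off the
  pole and no boundary term appears there; this is why smoothness is developed on open sets. In the
  full inequality the spherical parts of the three integrals on the right have to be paid for by the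
  angular part of the Laplacian. Collected for one rotation derivative \<open>w\<close>, they leave
  near the pole the Euclidean form
  \<open>r^-2 w_r^2 + (N - 1 + 2 (N - 4) - N^2 / 4) r^-4 w^2\<close>: here \<open>N - 1\<close> is
  the first nonzero eigenvalue of the sphere, \<open>2 (N - 4)\<close> comes from integrating the
  cross term by parts, and \<open>N^2 / 4\<close> is the constant of the theorem. The Hardy
  inequality with weight \<open>r^-2\<close> adds \<open>(N - 4)^2 / 4\<close>, with critical power
  \<open>r^((4 - N) / 2)\<close>, and the sum is exactly \<open>N - 5\<close>. The supersolution is
  chosen to have this power at the pole.\<close>

abbreviation D :: "(real ^ 'n \<Rightarrow> real) \<Rightarrow> real ^ 'n \<Rightarrow> real ^ 'n \<Rightarrow> real" where
  "D f x \<equiv> frechet_derivative f (at x)"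

abbreviation pd :: "'n \<Rightarrow> (real ^ 'n \<Rightarrow> real) \<Rightarrow> real ^ 'n \<Rightarrow> real" where
  "pd i f x \<equiv> frechet_derivative f (at x) (axis i 1)"

text \<open>The weights are smooth only off the pole, so \<open>Ck\<close> is localised. For open
  \<open>S\<close> the derivative \<open>frechet_derivative f (at x)\<close> at a point of
  \<open>S\<close> sees nothing outside \<open>S\<close>.\<close>

primrec Ck_on :: "(real ^ 'n) set \<Rightarrow> nat \<Rightarrow> (real ^ 'n \<Rightarrow> real) \<Rightarrow> bool" where
  "Ck_on S 0 u \<longleftrightarrow> continuous_on S u"
| "Ck_on S (Suc k) u \<longleftrightarrow>
     (\<forall>x\<in>S. u differentiable (at x)) \<and> (\<forall>v. Ck_on S k (\<lambda>x. D u x v))"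

definition smooth_on :: "(real ^ 'n) set \<Rightarrow> (real ^ 'n \<Rightarrow> real) \<Rightarrow> bool" where
  "smooth_on S u \<longleftrightarrow> (\<forall>k. Ck_on S k u)"

lemma Ck_eq_Ck_on: "Ck k u \<longleftrightarrow> Ck_on UNIV k u"
  by (induction k arbitrary: u) auto

text \<open>\<open>frechet_derivative\<close> chooses among all derivatives, so two functions with
  the same set of derivatives at \<open>x\<close> get the same choice, differentiable or
  not.\<close>

lemma frechet_derivative_cong_open:
  assumes "open S" "x \<in> S" "\<And>y. y \<in> S \<Longrightarrow> f y = g y"
  shows "frechet_derivative f (at x) = frechet_derivative g (at x)"
    "f differentiable (at x) \<longleftrightarrow> g differentiable (at x)"
proof -
  have *: "(f has_derivative d) (at x) \<longleftrightarrow> (g has_derivative d) (at x)" for d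
    using has_derivative_transform_within_open[OF _ assms(1,2), of f d UNIV g]
      has_derivative_transform_within_open[OF _ assms(1,2), of g d UNIV f] assms(3) by auto
  show "frechet_derivative f (at x) = frechet_derivative g (at x)"
    unfolding frechet_derivative_def * ..
  show "f differentiable (at x) \<longleftrightarrow> g differentiable (at x)"
    unfolding differentiable_def * ..
qed

lemma Ck_on_cong:
  assumes "open S" "\<And>x. x \<in> S \<Longrightarrow> f x = g x"
  shows "Ck_on S k f \<longleftrightarrow> Ck_on S k g"
  using assms(2)
proof (induction k arbitrary: f g)
  case 0
  then show ?case by (simp cong: continuous_on_cong)
next
  case (Suc k)
  have "Ck_on S k (\<lambda>x. D f x v) \<longleftrightarrow> Ck_on S k (\<lambda>x. D g x v)" for v
    by (rule Suc.IH) (use frechet_derivative_cong_open(1)[OF assms(1)] Suc.prems in metis)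
  moreover have "\<forall>x\<in>S. f differentiable at x \<longleftrightarrow> g differentiable at x"
    using frechet_derivative_cong_open(2)[OF assms(1)] Suc.prems by metis
  ultimately show ?case by auto
qed

lemma smooth_on_cong:
  assumes "open S" "\<And>x. x \<in> S \<Longrightarrow> f x = g x"
  shows "smooth_on S f \<longleftrightarrow> smooth_on S g"
  unfolding smooth_on_def using Ck_on_cong[OF assms] by auto

text \<open>Replaces the chosen derivative by an explicit formula \<open>F\<close>; the inductions
  for products, powers and compositions run on that formula.\<close>

lemma Ck_on_SucI:
  assumes "open S" and d: "\<And>x. x \<in> S \<Longrightarrow> (f has_derivative F x) (at x)"
    and "\<And>v. Ck_on S k (\<lambda>x. F x v)"
  shows "Ck_on S (Suc k) f"
proof -
  have "D f x v = F x v" if "x \<in> S" for x v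
    using frechet_derivative_at[OF d[OF that]] by simp
  then have "Ck_on S k (\<lambda>x. D f x v) \<longleftrightarrow> Ck_on S k (\<lambda>x. F x v)" for v
    by (intro Ck_on_cong assms(1)) auto
  then show ?thesis using assms(3) d by (auto simp: differentiable_def)
qed

lemma Ck_on_SucD:
  "Ck_on S (Suc k) f \<Longrightarrow> x \<in> S \<Longrightarrow> (f has_derivative D f x) (at x)"
  by (auto simp: frechet_derivative_works[symmetric])

lemma Ck_on_Suc_le: "Ck_on S (Suc k) f \<Longrightarrow> Ck_on S k f"
proof (induction k arbitrary: f)
  case 0
  then show ?case
    by (auto intro!: continuous_at_imp_continuous_on differentiable_imp_continuous_within)
next
  case (Suc k)
  then show ?case by fastforce
qed

lemma Ck_on_le:
  assumes "Ck_on S k f" "j \<le> k"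
  shows "Ck_on S j f"
  using assms(2,1) by (induction rule: dec_induct) (blast intro: Ck_on_Suc_le)+

lemma Ck_on_subset: "Ck_on S k f \<Longrightarrow> T \<subseteq> S \<Longrightarrow> Ck_on T k f"
  by (induction k arbitrary: f) (auto intro: continuous_on_subset)

lemma Ck_on_const: "Ck_on S k (\<lambda>x. c)"
proof (induction k arbitrary: c)
  case (Suc k)
  then show ?case by simp
qed auto

lemma Ck_on_bounded_linear:
  assumes "bounded_linear f" "open S"
  shows "Ck_on S k f"
proof (cases k)
  case 0
  then show ?thesis using assms by (simp add: linear_continuous_on)
next
  case (Suc j)
  show ?thesis unfolding Suc
    by (rule Ck_on_SucI[OF assms(2), where F = "\<lambda>x. f"])
      (auto intro: bounded_linear_imp_has_derivative assms Ck_on_const)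
qed

lemma Ck_on_add:
  assumes "open S" "Ck_on S k f" "Ck_on S k g"
  shows "Ck_on S k (\<lambda>x. f x + g x)"
  using assms(2,3)
proof (induction k arbitrary: f g)
  case 0
  then show ?case by (simp add: continuous_on_add)
next
  case (Suc k)
  show ?case
    by (rule Ck_on_SucI[OF assms(1), where F = "\<lambda>x v. D f x v + D g x v"])
      (use Suc Ck_on_SucD in \<open>auto intro!: has_derivative_add simp: frechet_derivative_works[symmetric]\<close>)
qed

lemma Ck_on_mult:
  assumes "open S" "Ck_on S k f" "Ck_on S k g"
  shows "Ck_on S k (\<lambda>x. f x * g x)"
  using assms(2,3)
proof (induction k arbitrary: f g)
  case 0
  then show ?case by (simp add: continuous_on_mult)
next
  case (Suc k)
  show ?case
  proof (rule Ck_on_SucI[OF assms(1), where F = "\<lambda>x v. f x * D g x v + D f x v * g x"])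
    show "((\<lambda>x. f x * g x) has_derivative (\<lambda>v. f x * D g x v + D f x v * g x)) (at x)" if "x \<in> S" for x
      using has_derivative_mult[OF Ck_on_SucD[OF Suc.prems(1) that] Ck_on_SucD[OF Suc.prems(2) that]] .
    show "Ck_on S k (\<lambda>x. f x * D g x v + D f x v * g x)" for v
      using Suc.prems Ck_on_Suc_le[OF Suc.prems(1)] Ck_on_Suc_le[OF Suc.prems(2)]
      by (intro Ck_on_add Suc.IH assms(1)) auto
  qed
qed

lemma Ck_on_sum:
  assumes "open S" "\<And>i. i \<in> I \<Longrightarrow> Ck_on S k (f i)"
  shows "Ck_on S k (\<lambda>x. \<Sum>i\<in>I. f i x)"
  using assms(2)
  by (induction I rule: infinite_finite_induct) (auto intro: Ck_on_const Ck_on_add[OF assms(1)])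

text \<open>Differentiation lowers the exponent, hence \<open>a\<close> is generalised in the
  induction. Inverses and square roots are instances.\<close>

lemma Ck_on_powr:
  assumes "open S" "Ck_on S k f" "\<And>x. x \<in> S \<Longrightarrow> f x > 0"
  shows "Ck_on S k (\<lambda>x. f x powr a)"
  using assms(2)
proof (induction k arbitrary: a)
  case 0
  then show ?case using assms(3) by (force intro!: continuous_on_powr continuous_on_const)
next
  case (Suc k)
  show ?case
  proof (rule Ck_on_SucI[OF assms(1), where F = "\<lambda>x v. a * f x powr (a - 1) * D f x v"])
    show "((\<lambda>x. f x powr a) has_derivative (\<lambda>v. a * f x powr (a - 1) * D f x v)) (at x)" if "x \<in> S" for x
      using DERIV_compose_FDERIV[OF has_real_derivative_powr[OF assms(3)[OF that], of a]
          Ck_on_SucD[OF Suc.prems that]] by (simp add: mult.commute)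
    show "Ck_on S k (\<lambda>x. a * f x powr (a - 1) * D f x v)" for v
      using Suc.prems Ck_on_Suc_le[OF Suc.prems(1)]
      by (intro Ck_on_mult Suc.IH Ck_on_const assms(1)) auto
  qed
qed

lemma Ck_on_inverse:
  assumes "open S" "Ck_on S k f" "\<And>x. x \<in> S \<Longrightarrow> f x > 0"
  shows "Ck_on S k (\<lambda>x. inverse (f x))"
  using Ck_on_powr[OF assms, of "-1"] assms(3)
  by (subst Ck_on_cong[OF assms(1), of _ "\<lambda>x. f x powr -1"]) (auto simp: powr_minus less_imp_le)

lemma Ck_on_ln:
  assumes "open S" "Ck_on S k f" "\<And>x. x \<in> S \<Longrightarrow> f x > 0"
  shows "Ck_on S k (\<lambda>x. ln (f x))"
proof (cases k)
  case 0
  then show ?thesis using assms by (auto intro!: continuous_on_ln simp: less_imp_neq[symmetric])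
next
  case (Suc j)
  show ?thesis unfolding Suc
  proof (rule Ck_on_SucI[OF assms(1), where F = "\<lambda>x v. inverse (f x) * D f x v"])
    show "((\<lambda>x. ln (f x)) has_derivative (\<lambda>v. inverse (f x) * D f x v)) (at x)" if "x \<in> S" for x
      using DERIV_compose_FDERIV[OF DERIV_ln[OF assms(3)[OF that]]
          Ck_on_SucD[OF assms(2)[unfolded Suc] that]] by (simp add: mult.commute)
    show "Ck_on S j (\<lambda>x. inverse (f x) * D f x v)" for v
      using Ck_on_Suc_le[OF assms(2)[unfolded Suc]] assms Suc
      by (intro Ck_on_mult Ck_on_inverse) auto
  qed
qed

lemma frechet_derivative_componentwise:
  fixes f :: "real ^ 'n \<Rightarrow> real"
  assumes "f differentiable (at x)"
  shows "D f x v = (\<Sum>i\<in>UNIV. v $ i * pd i f x)"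
proof -
  have l: "linear (D f x)"
    using linear_frechet_derivative[OF assms] .
  have "D f x v = D f x (\<Sum>i\<in>UNIV. v $ i *\<^sub>R axis i 1)"
    using basis_expansion[of v] by (simp add: scalar_mult_eq_scaleR)
  then show ?thesis
    by (simp add: linear_sum[OF l] linear_cmul[OF l])
qed

lemma Ck_on_compose:
  fixes g :: "real ^ 'n \<Rightarrow> real ^ 'n"
  assumes "open S" "Ck_on T k u" "\<And>i. Ck_on S k (\<lambda>x. g x $ i)" "g ` S \<subseteq> T"
  shows "Ck_on S k (\<lambda>x. u (g x))"
  using assms(2,3)
proof (induction k arbitrary: u)
  case 0
  then have "continuous_on S g"
    using continuous_on_vec_lambda[of S "\<lambda>i x. g x $ i"] by simp
  with 0 show ?case using continuous_on_compose2[of T u S g] assms(4) by auto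
next
  case (Suc k)
  let ?F = "\<lambda>x v. \<Sum>i\<in>UNIV. D (\<lambda>x. g x $ i) x v * pd i u (g x)"
  show ?case
  proof (rule Ck_on_SucI[OF assms(1), where F = ?F])
    fix x assume x: "x \<in> S"
    have dg: "(g has_derivative (\<lambda>v. \<chi> i. D (\<lambda>x. g x $ i) x v)) (at x)"
      unfolding has_derivative_componentwise_within[of g] Basis_vec_def
      using Ck_on_SucD[OF Suc.prems(2) x] by (auto simp: inner_axis)
    have du: "(u has_derivative D u (g x)) (at (g x))"
      using Ck_on_SucD[OF Suc.prems(1)] x assms(4) by auto
    have "((\<lambda>x. u (g x)) has_derivative (\<lambda>v. D u (g x) (\<chi> i. D (\<lambda>x. g x $ i) x v))) (at x)"
      using diff_chain_at[OF dg du] by (simp add: o_def)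
    also have "(\<lambda>v. D u (g x) (\<chi> i. D (\<lambda>x. g x $ i) x v)) = ?F x"
      using du by (subst frechet_derivative_componentwise) (auto simp: differentiable_def)
    finally show "((\<lambda>x. u (g x)) has_derivative ?F x) (at x)" .
  next
    fix v
    have 1: "Ck_on S k (\<lambda>x. D (\<lambda>x. g x $ i) x v)" for i
      using Suc.prems(2)[of i] by simp
    have 2: "Ck_on T k (\<lambda>x. pd i u x)" for i
      using Suc.prems(1) by simp
    show "Ck_on S k (\<lambda>x. ?F x v)"
      by (intro Ck_on_sum Ck_on_mult assms(1) 1 Suc.IH[OF 2] Ck_on_Suc_le[OF Suc.prems(2)])
  qed
qed

lemma smooth_on_imp_Ck_on: "smooth_on S f \<Longrightarrow> Ck_on S k f"
  by (simp add: smooth_on_def)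

lemma smooth_on_differentiable: "smooth_on S f \<Longrightarrow> x \<in> S \<Longrightarrow> f differentiable (at x)"
  using smooth_on_imp_Ck_on[of S f "Suc 0"] by simp

lemma smooth_on_D: "smooth_on S f \<Longrightarrow> smooth_on S (\<lambda>x. D f x v)"
  using smooth_on_imp_Ck_on[of S f "Suc k" for k] by (simp add: smooth_on_def)

lemma smooth_on_continuous: "smooth_on S f \<Longrightarrow> continuous_on S f"
  using smooth_on_imp_Ck_on[of S f 0] by simp

lemma smooth_on_subset: "smooth_on S f \<Longrightarrow> T \<subseteq> S \<Longrightarrow> smooth_on T f"
  unfolding smooth_on_def using Ck_on_subset by blast

lemma smooth_on_const [intro]: "smooth_on S (\<lambda>x. c)"
  by (simp add: smooth_on_def Ck_on_const)

lemma smooth_on_component [intro]: "open S \<Longrightarrow> smooth_on S (\<lambda>x. x $ i)"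
  by (simp add: smooth_on_def Ck_on_bounded_linear bounded_linear_vec_nth)

lemma smooth_on_inner [intro]: "open S \<Longrightarrow> smooth_on S (\<lambda>x. x \<bullet> a)"
  by (simp add: smooth_on_def Ck_on_bounded_linear bounded_linear_inner_left)

lemma smooth_on_add [intro]:
  "open S \<Longrightarrow> smooth_on S f \<Longrightarrow> smooth_on S g \<Longrightarrow> smooth_on S (\<lambda>x. f x + g x)"
  by (simp add: smooth_on_def Ck_on_add)

lemma smooth_on_mult [intro]:
  "open S \<Longrightarrow> smooth_on S f \<Longrightarrow> smooth_on S g \<Longrightarrow> smooth_on S (\<lambda>x. f x * g x)"
  by (simp add: smooth_on_def Ck_on_mult)

lemma smooth_on_uminus [intro]: "open S \<Longrightarrow> smooth_on S f \<Longrightarrow> smooth_on S (\<lambda>x. - f x)"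
  using smooth_on_mult[of S "\<lambda>x. -1" f] by auto

lemma smooth_on_diff [intro]:
  "open S \<Longrightarrow> smooth_on S f \<Longrightarrow> smooth_on S g \<Longrightarrow> smooth_on S (\<lambda>x. f x - g x)"
  using smooth_on_add[of S f "\<lambda>x. - g x"] by auto

lemma smooth_on_power [intro]: "open S \<Longrightarrow> smooth_on S f \<Longrightarrow> smooth_on S (\<lambda>x. f x ^ m)"
  by (induction m) auto

lemma smooth_on_sum [intro]:
  "open S \<Longrightarrow> (\<And>i. i \<in> I \<Longrightarrow> smooth_on S (f i)) \<Longrightarrow> smooth_on S (\<lambda>x. \<Sum>i\<in>I. f i x)"
  by (simp add: smooth_on_def Ck_on_sum)

lemma smooth_on_powr [intro]:
  "open S \<Longrightarrow> smooth_on S f \<Longrightarrow> (\<And>x. x \<in> S \<Longrightarrow> f x > 0) \<Longrightarrow> smooth_on S (\<lambda>x. f x powr a)"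
  by (simp add: smooth_on_def Ck_on_powr)

lemma smooth_on_ln [intro]:
  "open S \<Longrightarrow> smooth_on S f \<Longrightarrow> (\<And>x. x \<in> S \<Longrightarrow> f x > 0) \<Longrightarrow> smooth_on S (\<lambda>x. ln (f x))"
  by (simp add: smooth_on_def Ck_on_ln)

lemma smooth_on_divide [intro]:
  "open S \<Longrightarrow> smooth_on S f \<Longrightarrow> smooth_on S g \<Longrightarrow> (\<And>x. x \<in> S \<Longrightarrow> g x > 0) \<Longrightarrow>
    smooth_on S (\<lambda>x. f x / g x)"
  by (simp add: smooth_on_def divide_inverse Ck_on_mult Ck_on_inverse)

lemma smooth_on_sqrt [intro]:
  assumes "open S" "smooth_on S f" "\<And>x. x \<in> S \<Longrightarrow> f x > 0"
  shows "smooth_on S (\<lambda>x. sqrt (f x))"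
proof -
  have "smooth_on S (\<lambda>x. f x powr (1/2))" using assms by auto
  then show ?thesis
    using smooth_on_cong[OF assms(1), of "\<lambda>x. f x powr (1/2)" "\<lambda>x. sqrt (f x)"]
      powr_half_sqrt less_imp_le[OF assms(3)] by blast
qed

lemma smooth_on_compose:
  fixes g :: "real ^ 'n \<Rightarrow> real ^ 'n"
  assumes "open S" "smooth_on T u" "\<And>i. smooth_on S (\<lambda>x. g x $ i)" "g ` S \<subseteq> T"
  shows "smooth_on S (\<lambda>x. u (g x))"
  using Ck_on_compose[OF assms(1) _ _ assms(4)] assms(2,3) unfolding smooth_on_def by simp

lemma smooth_on_D_field [intro]:
  assumes "open S" "smooth_on S f" "\<And>i. smooth_on S (\<lambda>x. a x $ i)"
  shows "smooth_on S (\<lambda>x. D f x (a x))"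
proof -
  have "smooth_on S (\<lambda>x. \<Sum>i\<in>UNIV. a x $ i * pd i f x)"
    by (intro smooth_on_sum smooth_on_mult assms smooth_on_D)
  then show ?thesis
    using frechet_derivative_componentwise smooth_on_differentiable[OF assms(2)]
    by (subst smooth_on_cong[OF assms(1)]) auto
qed

text \<open>Derivatives are taken at points, so only the continuity at the end of the recursion uses
  that both sets are open. It joins the complement of the pole with a ball on which the function
  vanishes.\<close>

lemma smooth_on_glue:
  assumes "open S" "open T" "smooth_on S u" "smooth_on T u"
  shows "smooth_on (S \<union> T) u"
proof -
  have "Ck_on S k u \<Longrightarrow> Ck_on T k u \<Longrightarrow> Ck_on (S \<union> T) k u" for k
    by (induction k arbitrary: u) (auto intro: continuous_on_open_Un assms)
  then show ?thesis using assms unfolding smooth_on_def by blast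
qed

section \<open>Integration of compactly supported functions\<close>

definition bounded_supp :: "(real ^ 'n \<Rightarrow> real) \<Rightarrow> bool" where
  "bounded_supp f \<longleftrightarrow> (\<exists>b. \<forall>x. norm x > b \<longrightarrow> f x = 0)"

lemma bounded_supp_mono: "bounded_supp f \<Longrightarrow> (\<And>x. f x = 0 \<Longrightarrow> g x = 0) \<Longrightarrow> bounded_supp g"
  unfolding bounded_supp_def by metis

lemma bounded_supp_bound:
  assumes "bounded_supp f"
  obtains b where "b > 0" "\<And>x. norm x > b \<Longrightarrow> f x = 0"
proof -
  obtain b where "\<And>x. norm x > b \<Longrightarrow> f x = 0"
    using assms unfolding bounded_supp_def by auto
  then show thesis using that[of "max b 1"] by auto
qed

lemma D_eq_0_open:
  assumes "open S" "x \<in> S" "\<And>y. y \<in> S \<Longrightarrow> f y = 0"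
  shows "D f x v = 0"
  using frechet_derivative_cong_open(1)[OF assms(1,2), of f "\<lambda>y. 0"] assms(3) by simp

lemma D_bounded_supp:
  assumes "\<And>x. norm x > b \<Longrightarrow> f x = 0" "norm x > b"
  shows "D f x v = 0"
proof (rule D_eq_0_open)
  show "open {x :: real ^ 'n. norm x > b}"
    by (intro open_Collect_less continuous_intros)
qed (use assms in auto)

lemma bounded_supp_D: "bounded_supp f \<Longrightarrow> bounded_supp (\<lambda>x. D f x (v x))"
  using D_bounded_supp unfolding bounded_supp_def by metis

lemma integrable_continuous_supp:
  fixes f :: "real ^ 'n \<Rightarrow> real"
  assumes "continuous_on UNIV f" "bounded_supp f"
  shows "integrable lborel f"
proof -
  obtain b where b: "\<And>x. norm x > b \<Longrightarrow> f x = 0"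
    using assms(2) unfolding bounded_supp_def by auto
  have "integrable lborel (\<lambda>x. indicator (cball 0 b) x *\<^sub>R f x)"
    by (intro borel_integrable_compact continuous_on_subset[OF assms(1)]) auto
  moreover have "(\<lambda>x. indicator (cball 0 b) x *\<^sub>R f x) = f"
    using b by (auto simp: indicator_def fun_eq_iff not_le)
  ultimately show ?thesis by simp
qed

lemma DERIV_along_line:
  fixes f :: "real ^ 'n \<Rightarrow> real"
  assumes "f differentiable (at (x + t *\<^sub>R v))"
  shows "((\<lambda>t. f (x + t *\<^sub>R v)) has_real_derivative D f (x + t *\<^sub>R v) v) (at t)"
proof -
  have 1: "((\<lambda>t. x + t *\<^sub>R v) has_derivative (\<lambda>h. h *\<^sub>R v)) (at t)"
    by (auto intro!: derivative_eq_intros)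
  have 2: "(f has_derivative D f (x + t *\<^sub>R v)) (at (x + t *\<^sub>R v))"
    using assms by (simp add: frechet_derivative_works[symmetric])
  have "((\<lambda>t. f (x + t *\<^sub>R v)) has_derivative (\<lambda>h. D f (x + t *\<^sub>R v) (h *\<^sub>R v))) (at t)"
    using diff_chain_at[OF 1 2] by (simp add: o_def)
  then show ?thesis
    using linear_cmul[OF linear_frechet_derivative[OF assms]]
    by (simp add: has_field_derivative_def mult_commute_abs)
qed

text \<open>Translation invariance makes the integrals of all difference quotients vanish, and
  dominated convergence passes to the derivative. All integrations by parts rest on this.\<close>

theorem integral_directional_derivative:
  fixes f :: "real ^ 'n \<Rightarrow> real"
  assumes f: "Ck_on UNIV 1 f" and supp: "bounded_supp f"
  shows "(\<integral>x. D f x v \<partial>lborel) = 0"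
proof -
  have diff: "f differentiable (at x)" for x
    using f by simp
  have contD: "continuous_on UNIV (\<lambda>x. D f x v)" using f by simp
  have cont: "continuous_on UNIV f"
    using Ck_on_Suc_le[of UNIV 0 f] f by simp
  obtain b where b: "b > 0" "\<And>x. norm x > b \<Longrightarrow> f x = 0"
    using bounded_supp_bound[OF supp] by blast
  \<comment> \<open>Since the steps \<open>h n\<close> are at most 1, all difference quotients
    vanish outside this enlarged ball.\<close>
  let ?B = "cball (0 :: real ^ 'n) (b + norm v)"
  obtain K where K: "\<And>x. \<bar>D f x v\<bar> \<le> K"
  proof -
    have "compact ((\<lambda>x. D f x v) ` cball 0 b)"
      by (intro compact_continuous_image continuous_on_subset[OF contD]) auto
    then have "bounded ((\<lambda>x. D f x v) ` cball 0 b)" by (rule compact_imp_bounded)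
    then obtain K where "\<forall>x\<in>cball 0 b. \<bar>D f x v\<bar> \<le> K"
      by (auto simp: bounded_iff)
    then have "\<bar>D f x v\<bar> \<le> max K 0" for x
      using D_bounded_supp[where x = x and v = v, OF b(2)] by (cases "norm x \<le> b") (auto simp: le_max_iff_disj)
    then show thesis by (rule that)
  qed
  have K0: "K \<ge> 0" using K[of 0] by simp
  define h where "h n = 1 / real (Suc n)" for n
  have h: "h n > 0" "h n \<le> 1" for n unfolding h_def by auto
  have h0: "h \<longlonglongrightarrow> 0"
    unfolding h_def using LIMSEQ_inverse_real_of_nat by (simp add: inverse_eq_divide)
  define s where "s n x = (f (x + h n *\<^sub>R v) - f x) / h n" for n x
  have int: "integrable lborel (\<lambda>x. f (x + w))" for w
  proof -
    have "integrable lborel f" by (rule integrable_continuous_supp[OF cont supp])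
    then have "integrable (distr lborel borel ((+) w)) f"
      by (simp add: lborel_distr_plus)
    then show ?thesis
      by (subst (asm) integrable_distr_eq) (use cont in \<open>auto simp: add.commute intro: borel_measurable_continuous_onI\<close>)
  qed
  have shift: "(\<integral>x. f (x + w) \<partial>lborel) = (\<integral>x. f x \<partial>lborel)" for w
  proof -
    have "(\<integral>x. f x \<partial>lborel) = (\<integral>x. f x \<partial>distr lborel borel ((+) w))"
      by (simp add: lborel_distr_plus)
    also have "\<dots> = (\<integral>x. f (x + w) \<partial>lborel)"
      by (subst integral_distr) (use cont in \<open>auto simp: add.commute intro: borel_measurable_continuous_onI\<close>)
    finally show ?thesis by simp
  qed
  have s0: "(\<integral>x. s n x \<partial>lborel) = 0" for n
    unfolding s_def using int[of 0] int[of "h n *\<^sub>R v"] shift[of "h n *\<^sub>R v"] by simp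
  have "(\<lambda>n. \<integral>x. s n x \<partial>lborel) \<longlonglongrightarrow> (\<integral>x. D f x v \<partial>lborel)"
  proof (rule integral_dominated_convergence[where w = "\<lambda>x. indicator ?B x *\<^sub>R K"])
    show "(\<lambda>x. D f x v) \<in> borel_measurable lborel"
      using contD by (simp add: borel_measurable_continuous_onI)
    show "s i \<in> borel_measurable lborel" for i
      unfolding s_def using int[of 0] int[of "h i *\<^sub>R v"] by (auto dest!: borel_measurable_integrable)
    show "integrable lborel (\<lambda>x. indicator ?B x *\<^sub>R K)"
      by (intro borel_integrable_compact) auto
    show "AE x in lborel. (\<lambda>i. s i x) \<longlonglongrightarrow> D f x v"
    proof (rule AE_I2)
      fix x
      have "((\<lambda>t. f (x + t *\<^sub>R v)) has_real_derivative D f (x + 0 *\<^sub>R v) v) (at 0)"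
        by (rule DERIV_along_line) (use diff in auto)
      then have "((\<lambda>t. (f (x + t *\<^sub>R v) - f x) / t) \<longlongrightarrow> D f x v) (at 0)"
        by (simp add: has_field_derivative_iff)
      moreover have "filterlim h (at 0) sequentially"
        using h0 h(1) by (auto simp: filterlim_at less_imp_neq[THEN not_sym] intro!: always_eventually)
      ultimately show "(\<lambda>i. s i x) \<longlonglongrightarrow> D f x v"
        unfolding s_def by (rule filterlim_compose)
    qed
    show "AE x in lborel. norm (s i x) \<le> indicator ?B x *\<^sub>R K" for i
    proof (rule AE_I2)
      fix x
      show "norm (s i x) \<le> indicator ?B x *\<^sub>R K"
      proof (cases "x \<in> ?B")
        case True
        \<comment> \<open>The mean value theorem makes the quotient a value of the derivative, which
          is bounded by \<open>K\<close>.\<close>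
        obtain z where "f (x + h i *\<^sub>R v) - f (x + 0 *\<^sub>R v) = (h i - 0) * D f (x + z *\<^sub>R v) v"
          using MVT2[of 0 "h i" "\<lambda>t. f (x + t *\<^sub>R v)" "\<lambda>t. D f (x + t *\<^sub>R v) v"] h(1)[of i]
            DERIV_along_line diff by blast
        then have "s i x = D f (x + z *\<^sub>R v) v"
          using h(1)[of i] by (simp add: s_def)
        then show ?thesis using K True by simp
      next
        case False
        have "norm (h i *\<^sub>R v) \<le> norm v"
          using h[of i] by (simp add: mult_left_le_one_le)
        moreover have "norm x \<le> norm (x + h i *\<^sub>R v) + norm (h i *\<^sub>R v)"
          using norm_triangle_ineq4[of "x + h i *\<^sub>R v" "h i *\<^sub>R v"] by simp
        ultimately have "norm (x + h i *\<^sub>R v) > b" "norm x > b"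
          using False norm_ge_zero[of v] by (auto simp del: norm_ge_zero)
        then have "f (x + h i *\<^sub>R v) = 0" "f x = 0" by (auto intro: b(2))
        then show ?thesis using K0 by (simp add: s_def)
      qed
    qed
  qed
  then show ?thesis by (simp add: s0 LIMSEQ_const_iff)
qed

text \<open>Takes the place of a change of variables: two integrands are joined by a homotopy in
  \<open>\<theta>\<close> whose velocity has integral zero. The common bound \<open>b\<close> on the
  supports reduces differentiation under the integral to a fixed box.\<close>

lemma integral_parameter_constant:
  fixes F F' :: "real \<Rightarrow> real ^ 'n \<Rightarrow> real"
  assumes der: "\<And>\<theta> x. \<theta> \<in> {0..1} \<Longrightarrow>
      ((\<lambda>\<theta>. F \<theta> x) has_real_derivative F' \<theta> x) (at \<theta> within {0..1})"
    and cont: "\<And>\<theta>. \<theta> \<in> {0..1} \<Longrightarrow> continuous_on UNIV (F \<theta>)"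
    and cont': "continuous_on ({0..1} \<times> UNIV) (\<lambda>(\<theta>, x). F' \<theta> x)"
    and supp: "\<And>\<theta> x. \<theta> \<in> {0..1} \<Longrightarrow> norm x > b \<Longrightarrow> F \<theta> x = 0"
    and supp': "\<And>\<theta> x. \<theta> \<in> {0..1} \<Longrightarrow> norm x > b \<Longrightarrow> F' \<theta> x = 0"
    and zero: "\<And>\<theta>. \<theta> \<in> {0..1} \<Longrightarrow> (\<integral>x. F' \<theta> x \<partial>lborel) = 0"
  shows "(\<integral>x. F 1 x \<partial>lborel) = (\<integral>x. F 0 x \<partial>lborel)"
proof -
  obtain c where c: "cball (0 :: real ^ 'n) b \<subseteq> cbox (-c) c"
    using bounded_subset_cbox_symmetric[OF bounded_cball] by blast
  have eq: "integral (cbox (-c) c) g = (\<integral>x. g x \<partial>lborel)"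
    if "continuous_on UNIV g" "\<And>x. norm x > b \<Longrightarrow> g x = 0" for g :: "real ^ 'n \<Rightarrow> real"
  proof -
    have "(\<integral>x. g x \<partial>lborel) = integral UNIV g"
      using that by (intro integral_lborel[symmetric] integrable_continuous_supp)
        (auto simp: bounded_supp_def)
    also have "g = (\<lambda>x. if x \<in> cbox (-c) c then g x else 0)"
      using that(2) c by (auto simp: fun_eq_iff subset_iff) (metis not_le)
    then have "integral UNIV g = integral (cbox (-c) c) g"
      by (metis Henstock_Kurzweil_Integration.integral_restrict_UNIV)
    finally show ?thesis by simp
  qed
  have contF': "continuous_on UNIV (F' \<theta>)" if "\<theta> \<in> {0..1}" for \<theta>
  proof -
    have "continuous_on UNIV (\<lambda>x. (\<lambda>(\<theta>, x). F' \<theta> x) (\<theta>, x))"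
      by (rule continuous_on_compose2[OF cont'])
        (use that in \<open>auto intro!: continuous_on_Pair continuous_on_const continuous_on_id\<close>)
    then show ?thesis by simp
  qed
  have "((\<lambda>\<theta>. integral (cbox (-c) c) (F \<theta>)) has_real_derivative 0) (at \<theta> within {0..1})"
    if "\<theta> \<in> {0..1}" for \<theta>
  proof -
    have "((\<lambda>\<theta>. integral (cbox (-c) c) (F \<theta>)) has_real_derivative integral (cbox (-c) c) (F' \<theta>))
        (at \<theta> within {0..1})"
    proof (rule leibniz_rule_field_derivative[OF _ _ _ that])
      show "F \<theta> integrable_on cbox (-c) c" if "\<theta> \<in> {0..1}" for \<theta>
        by (intro integrable_continuous continuous_on_subset[OF cont[OF that]]) auto
      show "continuous_on ({0..1} \<times> cbox (-c) c) (\<lambda>(\<theta>, x). F' \<theta> x)"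
        by (rule continuous_on_subset[OF cont']) auto
    qed (use der in auto)
    also have "integral (cbox (-c) c) (F' \<theta>) = 0"
      using eq[OF contF'[OF that] supp'[OF that]] zero[OF that] by simp
    finally show ?thesis .
  qed
  then obtain k where "\<And>\<theta>. \<theta> \<in> {0..1} \<Longrightarrow> integral (cbox (-c) c) (F \<theta>) = k"
    using has_field_derivative_zero_constant[OF convex_real_interval(5)] by metis
  then have "integral (cbox (-c) c) (F 1) = integral (cbox (-c) c) (F 0)" by simp
  then show ?thesis
    using eq[OF cont[of 1] supp[of 1]] eq[OF cont[of 0] supp[of 0]] by simp
qed

text \<open>The integral of the \<open>a\<close>-derivative over a segment in direction
  \<open>a\<close>, shifted by \<open>s\<close> in direction \<open>b\<close>, is differentiated in
  \<open>s\<close> in two ways: under the integral sign, and after the fundamental theorem of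
  calculus. Differentiating the result in the length \<open>\<tau>\<close> of the segment gives the
  two mixed derivatives.\<close>

theorem second_derivative_symmetric:
  fixes f :: "real ^ 'n \<Rightarrow> real"
  assumes f: "Ck_on UNIV 2 f"
  shows "D (\<lambda>y. D f y a) x b = D (\<lambda>y. D f y b) x a"
proof -
  have f': "Ck_on UNIV (Suc (Suc 0)) f" using f by (simp only: numeral_2_eq_2)
  have diff: "f differentiable (at x)" "(\<lambda>y. D f y v) differentiable (at x)" for x v
    using f' by auto
  have c2: "continuous_on UNIV (\<lambda>y. D (\<lambda>y. D f y v) y w)" for v w
    using f' by auto
  have c1: "continuous_on UNIV (\<lambda>y. D f y v)" for v
    using Ck_on_le[OF f', of 1] by simp
  let ?G = "\<lambda>s t. D f (x + t *\<^sub>R a + s *\<^sub>R b) a"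
  let ?Q = "\<lambda>t. D (\<lambda>y. D f y a) (x + t *\<^sub>R a) b"
  have ftc: "integral (cbox 0 \<tau>) (?G s) = f (x + \<tau> *\<^sub>R a + s *\<^sub>R b) - f (x + s *\<^sub>R b)"
    if "\<tau> \<ge> 0" for s \<tau>
  proof -
    have "(?G s has_integral f ((x + s *\<^sub>R b) + \<tau> *\<^sub>R a) - f ((x + s *\<^sub>R b) + 0 *\<^sub>R a)) {0..\<tau>}"
    proof (rule fundamental_theorem_of_calculus[OF that])
      fix t
      show "((\<lambda>t. f (x + s *\<^sub>R b + t *\<^sub>R a)) has_vector_derivative ?G s t) (at t within {0..\<tau>})"
        using DERIV_along_line[of f "x + s *\<^sub>R b" t a] diff
        by (auto simp: has_real_derivative_iff_has_vector_derivative add_ac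
            intro: has_vector_derivative_at_within)
    qed
    then show ?thesis by (auto simp: add_ac)
  qed
  have P: "D f (x + \<tau> *\<^sub>R a) b - D f x b = integral {0..\<tau>} ?Q" if "\<tau> \<ge> 0" for \<tau>
  proof -
    have "((\<lambda>s. integral (cbox 0 \<tau>) (?G s)) has_real_derivative
        integral (cbox 0 \<tau>) (\<lambda>t. D (\<lambda>y. D f y a) (x + t *\<^sub>R a + 0 *\<^sub>R b) b)) (at 0 within UNIV)"
    proof (rule leibniz_rule_field_derivative[where
          fx = "\<lambda>s t. D (\<lambda>y. D f y a) (x + t *\<^sub>R a + s *\<^sub>R b) b"])
      show "((\<lambda>s. ?G s t) has_real_derivative D (\<lambda>y. D f y a) (x + t *\<^sub>R a + s *\<^sub>R b) b)
          (at s within UNIV)" for s t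
        using DERIV_along_line[of "\<lambda>y. D f y a" "x + t *\<^sub>R a" s b] diff by auto
      show "?G s integrable_on cbox 0 \<tau>" for s
        by (intro integrable_continuous continuous_on_compose2[OF c1]) (auto intro!: continuous_intros)
      show "continuous_on (UNIV \<times> cbox 0 \<tau>) (\<lambda>(s, t). D (\<lambda>y. D f y a) (x + t *\<^sub>R a + s *\<^sub>R b) b)"
        unfolding split_beta
        by (intro continuous_on_compose2[OF c2]) (auto intro!: continuous_intros)
    qed auto
    moreover have "((\<lambda>s. integral (cbox 0 \<tau>) (?G s)) has_real_derivative
        D f (x + \<tau> *\<^sub>R a) b - D f x b) (at 0)"
      unfolding ftc[OF that]
      using DERIV_along_line[of f "x + \<tau> *\<^sub>R a" 0 b] DERIV_along_line[of f x 0 b] diff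
      by (auto intro!: derivative_eq_intros)
    ultimately show ?thesis using DERIV_unique by fastforce
  qed
  \<comment> \<open>\<open>P\<close> holds for \<open>\<tau> \<ge> 0\<close> only, so the two
    derivatives are compared one-sidedly at 0.\<close>
  have "((\<lambda>\<tau>. integral {0..\<tau>} ?Q) has_real_derivative ?Q 0) (at 0 within {0..1})"
    by (intro integral_has_real_derivative continuous_on_compose2[OF c2]) (auto intro!: continuous_intros)
  moreover have "((\<lambda>\<tau>. integral {0..\<tau>} ?Q) has_real_derivative D (\<lambda>y. D f y b) x a) (at 0 within {0..1})"
  proof -
    have "((\<lambda>\<tau>. D f (x + \<tau> *\<^sub>R a) b - D f x b) has_real_derivative D (\<lambda>y. D f y b) x a) (at 0)"
      using DERIV_along_line[of "\<lambda>y. D f y b" x 0 a] diff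
      by (auto intro!: derivative_eq_intros)
    then have "((\<lambda>\<tau>. D f (x + \<tau> *\<^sub>R a) b - D f x b) has_real_derivative D (\<lambda>y. D f y b) x a) (at 0 within {0..1})"
      by (rule has_field_derivative_at_within)
    then show ?thesis
      using P by (subst has_field_derivative_cong_eventually[where g = "\<lambda>\<tau>. D f (x + \<tau> *\<^sub>R a) b - D f x b"])
        (auto simp: eventually_at_filter)
  qed
  ultimately show ?thesis
    using vector_derivative_unique_within_closed_interval[of 0 1 0]
    by (auto simp: has_real_derivative_iff_has_vector_derivative)
qed

section \<open>Test functions\<close>

text \<open>In finite dimension a closed support is compact as soon as it is bounded, and a point
  outside a closure has a ball around it that misses the set.\<close>

lemma test_functions_iff:
  "u \<in> test_functions p \<longleftrightarrow>
     smooth_on UNIV u \<and> bounded_supp u \<and> (\<exists>a>0. \<forall>x. dist x p < a \<longrightarrow> u x = 0)"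
proof -
  have "(\<forall>x\<in>{x. u x \<noteq> 0}. norm x \<le> b) \<longleftrightarrow> (\<forall>x. norm x > b \<longrightarrow> u x = 0)" for b
    by (metis (mono_tags) mem_Collect_eq not_le)
  then have "compact (closure {x. u x \<noteq> 0}) \<longleftrightarrow> bounded_supp u"
    unfolding compact_closure bounded_iff bounded_supp_def by simp
  moreover have "p \<notin> closure {x. u x \<noteq> 0} \<longleftrightarrow> (\<exists>a>0. \<forall>x. dist x p < a \<longrightarrow> u x = 0)"
    unfolding closure_approachable by auto
  ultimately show ?thesis
    unfolding test_functions_def smooth_on_def Ck_eq_Ck_on by simp
qed

lemma test_functionsI:
  assumes "smooth_on UNIV u" "v \<in> test_functions p" "\<And>x. v x = 0 \<Longrightarrow> u x = 0"
  shows "u \<in> test_functions p"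
  using assms unfolding test_functions_iff by (metis bounded_supp_mono)

lemma test_functions_smooth: "u \<in> test_functions p \<Longrightarrow> smooth_on UNIV u"
  and test_functions_bounded_supp: "u \<in> test_functions p \<Longrightarrow> bounded_supp u"
  by (auto simp: test_functions_iff)

lemma test_functions_add [intro]:
  assumes "u \<in> test_functions p" "v \<in> test_functions p"
  shows "(\<lambda>x. u x + v x) \<in> test_functions p"
proof -
  obtain a a' where a: "a > 0" "\<And>x. dist x p < a \<Longrightarrow> u x = 0" "a' > 0" "\<And>x. dist x p < a' \<Longrightarrow> v x = 0"
    using assms unfolding test_functions_iff by metis
  obtain b b' where b: "\<And>x. norm x > b \<Longrightarrow> u x = 0" "\<And>x. norm x > b' \<Longrightarrow> v x = 0"
    using assms unfolding test_functions_iff bounded_supp_def by metis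
  have "bounded_supp (\<lambda>x. u x + v x)"
    unfolding bounded_supp_def by (rule exI[of _ "max b b'"]) (use b in auto)
  moreover have "\<exists>a>0. \<forall>x. dist x p < a \<longrightarrow> u x + v x = 0"
    by (rule exI[of _ "min a a'"]) (use a in auto)
  ultimately show ?thesis
    using assms unfolding test_functions_iff by auto
qed

text \<open>The first factor may be singular at \<open>p\<close>.\<close>

lemma test_functions_weight:
  assumes "smooth_on (- {p}) w" "u \<in> test_functions p"
  shows "(\<lambda>x. w x * u x) \<in> test_functions p"
proof (rule test_functionsI[OF _ assms(2)])
  obtain a where a: "a > 0" "\<And>x. dist x p < a \<Longrightarrow> u x = 0"
    using assms(2) unfolding test_functions_iff by metis
  have 1: "smooth_on (- {p}) (\<lambda>x. w x * u x)"
    using assms smooth_on_subset[OF test_functions_smooth] by (intro smooth_on_mult) auto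
  have "smooth_on (ball p a) (\<lambda>x. w x * u x) \<longleftrightarrow> smooth_on (ball p a) (\<lambda>x. 0)"
    by (rule smooth_on_cong) (use a in \<open>auto simp: dist_commute\<close>)
  then have 2: "smooth_on (ball p a) (\<lambda>x. w x * u x)" by auto
  have "- {p} \<union> ball p a = UNIV" using a by auto
  then show "smooth_on UNIV (\<lambda>x. w x * u x)"
    using smooth_on_glue[OF _ _ 1 2] by auto
qed auto

lemma test_functions_mult [intro]:
  "u \<in> test_functions p \<Longrightarrow> v \<in> test_functions p \<Longrightarrow> (\<lambda>x. u x * v x) \<in> test_functions p"
  by (intro test_functions_weight smooth_on_subset[OF test_functions_smooth]) auto

lemma test_functions_cmult [intro]: "u \<in> test_functions p \<Longrightarrow> (\<lambda>x. c * u x) \<in> test_functions p"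
  by (intro test_functions_weight) auto

lemma test_functions_uminus [intro]: "u \<in> test_functions p \<Longrightarrow> (\<lambda>x. - u x) \<in> test_functions p"
  using test_functions_cmult[of u p "-1"] by simp

lemma test_functions_diff [intro]:
  "u \<in> test_functions p \<Longrightarrow> v \<in> test_functions p \<Longrightarrow> (\<lambda>x. u x - v x) \<in> test_functions p"
  using test_functions_add[of u p "\<lambda>x. - v x"] by auto

lemma test_functions_0 [intro]: "(\<lambda>x. 0) \<in> test_functions p"
  by (auto simp: test_functions_iff bounded_supp_def intro: exI[of _ 1])

lemma test_functions_sum [intro]:
  "(\<And>i. i \<in> I \<Longrightarrow> u i \<in> test_functions p) \<Longrightarrow> (\<lambda>x. \<Sum>i\<in>I. u i x) \<in> test_functions p"
  by (induction I rule: infinite_finite_induct) auto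

lemma test_functions_power2 [intro]: "u \<in> test_functions p \<Longrightarrow> (\<lambda>x. (u x)\<^sup>2) \<in> test_functions p"
  unfolding power2_eq_square by auto

lemma test_functions_D [intro]:
  assumes "u \<in> test_functions p" "\<And>i. smooth_on UNIV (\<lambda>x. v x $ i)"
  shows "(\<lambda>x. D u x (v x)) \<in> test_functions p"
proof -
  obtain a where a: "a > 0" "\<And>x. dist x p < a \<Longrightarrow> u x = 0"
    using assms(1) unfolding test_functions_iff by metis
  have "D u x (v x) = 0" if "dist x p < a" for x
    by (rule D_eq_0_open[of "ball p a"]) (use a that in \<open>auto simp: dist_commute\<close>)
  then show ?thesis
    using assms a(1) smooth_on_D_field[OF open_UNIV, of u v] bounded_supp_D
    unfolding test_functions_iff by blast
qed

lemma test_functions_integrable: "u \<in> test_functions p \<Longrightarrow> integrable lborel u"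
  by (intro integrable_continuous_supp smooth_on_continuous test_functions_smooth test_functions_bounded_supp)

section \<open>The hyperboloid in the projection chart\<close>

text \<open>Time coordinate of the hyperboloid point above \<open>x\<close>; it is the hyperbolic
  cosine of the distance from \<open>0\<close>.\<close>

abbreviation ht :: "real ^ 'n \<Rightarrow> real" where
  "ht x \<equiv> sqrt (1 + (norm x)\<^sup>2)"

lemma ht_ge_1: "ht x \<ge> 1" and ht_pos: "ht x > 0" and ht_nz: "ht x \<noteq> 0"
proof -
  show "ht x \<ge> 1" by simp
  then show "ht x > 0" by linarith
  then show "ht x \<noteq> 0" by simp
qed

lemma ht_square: "(ht x)\<^sup>2 = 1 + x \<bullet> x"
  by (simp add: power2_norm_eq_inner add_nonneg_nonneg)

lemma has_derivative_ht: "(ht has_derivative (\<lambda>v. (x \<bullet> v) / ht x)) (at x)"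
proof -
  have 1: "((\<lambda>x. 1 + x \<bullet> x) has_derivative (\<lambda>v. 0 + (x \<bullet> v + v \<bullet> x))) (at x)"
    by (intro has_derivative_add has_derivative_const has_derivative_inner has_derivative_ident)
  have "1 + x \<bullet> x > 0" by (simp add: add_pos_nonneg)
  from DERIV_compose_FDERIV[OF DERIV_real_sqrt[OF this] 1]
  have "((\<lambda>x. sqrt (1 + x \<bullet> x)) has_derivative (\<lambda>v. (x \<bullet> v + v \<bullet> x) * (inverse (sqrt (1 + x \<bullet> x)) / 2))) (at x)"
    by simp
  moreover have "(x \<bullet> v + v \<bullet> x) * (inverse (sqrt (1 + x \<bullet> x)) / 2) = (x \<bullet> v) / ht x" for v
    unfolding inner_commute[of v x] power2_norm_eq_inner by (simp add: field_simps)
  ultimately show ?thesis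
    by (simp add: power2_norm_eq_inner)
qed

lemma smooth_on_inner_self: "open S \<Longrightarrow> smooth_on S (\<lambda>x. x \<bullet> x)"
  unfolding inner_vec_def inner_real_def by (intro smooth_on_sum smooth_on_mult smooth_on_component)

lemma smooth_on_ht [intro]: "open S \<Longrightarrow> smooth_on S ht"
  unfolding power2_norm_eq_inner
  by (intro smooth_on_sqrt smooth_on_add smooth_on_const smooth_on_inner_self) (auto simp: add_pos_nonneg)

lemma continuous_on_ht: "continuous_on S ht"
  by (intro continuous_intros)

lemma has_derivative_hyp_emb: "(hyp_emb has_derivative (\<lambda>v. (v, (x \<bullet> v) / ht x))) (at x)"
  unfolding hyp_emb_def [abs_def]
  by (intro has_derivative_Pair has_derivative_ident has_derivative_ht)

lemma hyp_metric_lorentz: "hyp_metric x v w = lorentz (v, (x \<bullet> v) / ht x) (w, (x \<bullet> w) / ht x)"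
  unfolding hyp_metric_def frechet_derivative_at[OF has_derivative_hyp_emb, symmetric] ..

lemma hyp_metric_eq: "hyp_metric x v w = v \<bullet> w - (x \<bullet> v) * (x \<bullet> w) / (ht x)\<^sup>2"
  by (simp add: hyp_metric_lorentz lorentz_def power2_eq_square)

text \<open>An orthogonal matrix sending a coordinate axis to the direction of \<open>a\<close>
  makes the matrix diagonal, with the single entry \<open>1 - c |a|^2\<close> besides ones.\<close>

lemma det_identity_plus_rank_one:
  fixes a :: "real ^ 'n"
  shows "det (\<chi> i j. (if i = j then 1 else 0) - c * a $ i * a $ j) = 1 - c * (a \<bullet> a)"
proof (cases "a = 0")
  case True
  have "(\<chi> i j. if i = j then 1 else 0) = (mat 1 :: real ^ 'n ^ 'n)"
    by (simp add: mat_def)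
  then show ?thesis using True by simp
next
  case False
  fix k :: 'n
  define s where "s = norm a"
  have s: "s > 0" "s\<^sup>2 = a \<bullet> a" using False by (simp_all add: s_def power2_norm_eq_inner)
  have "norm (a /\<^sub>R s) = 1" using s by (simp add: s_def)
  then obtain A :: "real ^ 'n ^ 'n" where A: "orthogonal_matrix A" "A *v axis k 1 = a /\<^sub>R s"
    by (rule orthogonal_matrix_exists_basis)
  have AAt: "A ** transpose A = mat 1" using A(1) by (simp add: orthogonal_matrix_def)
  have ai: "a $ i = s * A $ i $ k" for i
  proof -
    have "(A *v axis k 1) $ i = A $ i $ k" by (simp add: matrix_vector_mult_basis column_def)
    moreover have "s * (A *v axis k 1) $ i = a $ i" unfolding A(2) using s by simp
    ultimately show ?thesis by simp
  qed
  define G :: "real ^ 'n ^ 'n" where "G = (\<chi> i j. if i = j then (if i = k then 1 - c * s\<^sup>2 else 1) else 0)"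
  have delta: "(\<Sum>l\<in>UNIV. A $ i $ l * A $ j $ l) = (if i = j then 1 else 0)" for i j
    using AAt by (simp add: matrix_matrix_mult_def transpose_def mat_def vec_eq_iff)
  have "(A ** G ** transpose A) $ i $ j = (if i = j then 1 else 0) - c * a $ i * a $ j" for i j
  proof -
    have "(A ** G) $ i $ l = A $ i $ l * (if l = k then 1 - c * s\<^sup>2 else 1)" for l
      by (simp add: matrix_matrix_mult_def G_def if_distrib sum.delta' cong: if_cong)
    then have "(A ** G ** transpose A) $ i $ j =
        (\<Sum>l\<in>UNIV. A $ i $ l * A $ j $ l - (if l = k then c * s\<^sup>2 * A $ i $ l * A $ j $ l else 0))"
      by (simp add: matrix_matrix_mult_def[of "A ** G"] transpose_def) (rule sum.cong, auto simp: algebra_simps)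
    then show ?thesis
      by (simp add: sum_subtractf delta sum.delta' ai power2_eq_square)
  qed
  then have "(\<chi> i j. (if i = j then 1 else 0) - c * a $ i * a $ j) = A ** G ** transpose A"
    by (simp add: vec_eq_iff)
  moreover have "det (A ** G ** transpose A) = det (A ** transpose A) * det G"
    by (simp add: det_mul)
  moreover have "det G = 1 - c * s\<^sup>2"
    by (subst det_diagonal) (auto simp: G_def prod.If_cases)
  ultimately show ?thesis using s AAt by simp
qed

text \<open>The Gram matrix is the identity minus \<open>x x^T / ht^2\<close>, of determinant
  \<open>1 - |x|^2 / ht^2 = 1 / ht^2\<close>.\<close>

lemma hyp_density_eq: "hyp_density x = 1 / ht x"
proof -
  have "hyp_metric x (axis i 1) (axis j 1) = (if i = j then 1 else 0) - inverse ((ht x)\<^sup>2) * x $ i * x $ j" for i j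
    unfolding hyp_metric_eq inner_axis_axis by (simp add: inner_axis divide_inverse mult_ac)
  then have "hyp_density x = sqrt (1 - inverse ((ht x)\<^sup>2) * (x \<bullet> x))"
    unfolding hyp_density_def by (simp add: det_identity_plus_rank_one del: real_sqrt_pow2_iff real_sqrt_pow2)
  also have "1 - inverse ((ht x)\<^sup>2) * (x \<bullet> x) = (1 / ht x)\<^sup>2"
  proof -
    have *: "1 - inverse T * (T - 1) = 1 / T" if "T \<noteq> 0" for T :: real
      using that by (simp add: field_simps)
    have "(ht x)\<^sup>2 \<noteq> 0" using ht_nz[of x] by simp
    moreover have "x \<bullet> x = (ht x)\<^sup>2 - 1" using ht_square[of x] by simp
    ultimately show ?thesis unfolding power_divide using *[of "(ht x)\<^sup>2"] by (simp only: power_one not_False_eq_True simp_thms)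
  qed
  also have "sqrt ((1 / ht x)\<^sup>2) = 1 / ht x"
    using ht_pos[of x] by (simp only: real_sqrt_abs abs_of_pos divide_pos_pos zero_less_one)
  finally show ?thesis .
qed

lemma hyp_integral_eq:
  assumes "f \<in> borel_measurable borel"
  shows "(\<integral>x. f x \<partial>hyp_volume) = (\<integral>x. f x / ht x \<partial>lborel)"
proof -
  have "(\<lambda>x :: real ^ 'n. 1 / ht x) \<in> borel_measurable borel"
    by (intro borel_measurable_continuous_onI continuous_intros) (use ht_nz in auto)
  then show ?thesis
    unfolding hyp_volume_def hyp_density_eq
    using assms by (subst integral_density) (auto simp: less_imp_le[OF ht_pos])
qed

lemma hyp_integral_test:
  assumes "f \<in> test_functions p"
  shows "(\<integral>x. f x \<partial>hyp_volume) = (\<integral>x. f x / ht x \<partial>lborel)"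
  using smooth_on_continuous[OF test_functions_smooth[OF assms]]
  by (intro hyp_integral_eq borel_measurable_continuous_onI)

lemma test_functions_div_ht [intro]:
  assumes "f \<in> test_functions p"
  shows "(\<lambda>x. f x / ht x) \<in> test_functions p"
proof -
  have "smooth_on (-{p}) (\<lambda>x. 1 / ht x)" by (intro smooth_on_divide) (auto simp: add_pos_nonneg)
  then show ?thesis using test_functions_weight[of p "\<lambda>x. 1 / ht x" f] assms by simp
qed

lemma hyp_integrable_test:
  assumes "f \<in> test_functions p"
  shows "integrable hyp_volume f"
proof -
  have "(\<lambda>x :: real ^ 'n. 1 / ht x) \<in> borel_measurable borel"
    by (intro borel_measurable_continuous_onI continuous_intros) (use ht_nz in auto)
  moreover have "f \<in> borel_measurable borel"
    using smooth_on_continuous[OF test_functions_smooth[OF assms]] by (rule borel_measurable_continuous_onI)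
  ultimately show ?thesis
    unfolding hyp_volume_def hyp_density_eq
    using test_functions_integrable[OF test_functions_div_ht[OF assms]]
    by (subst integrable_density) (auto simp: less_imp_le[OF ht_pos])
qed

section \<open>Gradient and Laplacian in the chart\<close>

definition grad :: "(real ^ 'n \<Rightarrow> real) \<Rightarrow> real ^ 'n \<Rightarrow> real ^ 'n" where
  "grad u x = (\<chi> i. pd i u x)"

lemma D_eq_inner_grad: "u differentiable (at x) \<Longrightarrow> D u x v = grad u x \<bullet> v"
  by (subst frechet_derivative_componentwise) (simp_all add: grad_def inner_vec_def mult.commute)

text \<open>The inverse of the metric matrix \<open>I - x x^T / ht^2\<close> is
  \<open>I + x x^T\<close>, because \<open>ht^2 = 1 + |x|^2\<close>.\<close>

lemma hyp_grad_eq: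
  assumes "u differentiable (at x)"
  shows "hyp_grad u x = grad u x + (x \<bullet> grad u x) *\<^sub>R x"
  unfolding hyp_grad_def
proof (rule the_equality)
  have t: "(ht x)\<^sup>2 \<noteq> 0" using ht_nz by simp
  have "(x \<bullet> (grad u x + (x \<bullet> grad u x) *\<^sub>R x)) = (ht x)\<^sup>2 * (x \<bullet> grad u x)"
    unfolding ht_square by (simp add: inner_add_right algebra_simps)
  then show "\<forall>v. hyp_metric x (grad u x + (x \<bullet> grad u x) *\<^sub>R x) v = D u x v"
    using t by (simp add: hyp_metric_eq D_eq_inner_grad[OF assms] inner_add_left)
next
  fix w assume w: "\<forall>v. hyp_metric x w v = D u x v"
  have t: "(ht x)\<^sup>2 \<noteq> 0" using ht_nz by simp
  have "(w - ((x \<bullet> w) / (ht x)\<^sup>2) *\<^sub>R x - grad u x) \<bullet> v = 0" for v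
    using w[rule_format, of v] by (simp add: hyp_metric_eq D_eq_inner_grad[OF assms] inner_diff_left)
  then have "w - ((x \<bullet> w) / (ht x)\<^sup>2) *\<^sub>R x - grad u x = 0"
    by (metis inner_eq_zero_iff)
  then have g: "grad u x = w - ((x \<bullet> w) / (ht x)\<^sup>2) *\<^sub>R x" by simp
  have "x \<bullet> grad u x = (x \<bullet> w) * (1 - (x \<bullet> x) / (ht x)\<^sup>2)"
    unfolding g by (simp add: inner_diff_right algebra_simps)
  also have "1 - (x \<bullet> x) / (ht x)\<^sup>2 = 1 / (ht x)\<^sup>2"
    using t ht_square[of x] by (simp add: field_simps)
  finally show "w = grad u x + (x \<bullet> grad u x) *\<^sub>R x"
    by (simp add: g)
qed

lemma hyp_metric_grad:
  assumes "u differentiable (at x)"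
  shows "hyp_metric x (hyp_grad u x) v = D u x v"
proof -
  have t: "(ht x)\<^sup>2 \<noteq> 0" using ht_nz by simp
  have "(x \<bullet> (grad u x + (x \<bullet> grad u x) *\<^sub>R x)) = (ht x)\<^sup>2 * (x \<bullet> grad u x)"
    unfolding ht_square by (simp add: inner_add_right algebra_simps)
  then show ?thesis
    using t by (simp add: hyp_metric_eq D_eq_inner_grad[OF assms] inner_add_left hyp_grad_eq[OF assms])
qed

text \<open>Nondegeneracy of the metric: pairing the difference \<open>d\<close> with
  \<open>x\<close> shows that \<open>x \<bullet> d\<close> equals itself times the factor
  \<open>|x|^2 / ht^2\<close>, which differs from 1. So \<open>x \<bullet> d\<close> vanishes, and
  then \<open>d\<close> does.\<close>

lemma hyp_grad_unique:
  assumes "u differentiable (at x)" "\<And>v. hyp_metric x w v = D u x v"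
  shows "hyp_grad u x = w"
proof -
  have "hyp_metric x (hyp_grad u x - w) v = 0" for v
    using hyp_metric_grad[OF assms(1), of v] assms(2)[of v]
    by (simp add: hyp_metric_eq algebra_simps diff_divide_distrib)
  moreover define d where "d = hyp_grad u x - w"
  ultimately have d: "d \<bullet> v = (x \<bullet> d) * (x \<bullet> v) / (ht x)\<^sup>2" for v
    by (simp add: hyp_metric_eq)
  have t: "(ht x)\<^sup>2 > 0" using ht_pos by simp
  have "x \<bullet> d = (x \<bullet> d) * ((x \<bullet> x) / (ht x)\<^sup>2)" using d[of x] by (simp add: inner_commute)
  moreover have "(x \<bullet> x) / (ht x)\<^sup>2 \<noteq> 1" using t unfolding ht_square by simp
  ultimately have "x \<bullet> d = 0" by (metis mult_cancel_left2)
  then have "d \<bullet> d = 0" using d[of d] by simp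
  then show ?thesis by (simp add: d_def)
qed

lemma hyp_grad_component:
  "u differentiable (at x) \<Longrightarrow> hyp_grad u x $ i = pd i u x + x $ i * D u x x"
  using D_eq_inner_grad[of u x x] by (simp add: hyp_grad_eq inner_commute) (simp add: grad_def)

lemma test_functions_hyp_grad:
  assumes "u \<in> test_functions p"
  shows "(\<lambda>x. hyp_grad u x $ i) \<in> test_functions p"
proof -
  have "smooth_on UNIV (\<lambda>x. x $ j)" for j :: 'a by auto
  then have "(\<lambda>x. pd i u x + x $ i * D u x x) \<in> test_functions p"
    by (intro test_functions_add test_functions_D assms test_functions_weight) auto
  moreover have "u differentiable (at x)" for x
    using smooth_on_differentiable[OF test_functions_smooth[OF assms]] by simp
  ultimately show ?thesis by (simp add: hyp_grad_component)
qed

lemma test_functions_hyp_laplacian: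
  assumes "u \<in> test_functions p"
  shows "hyp_laplacian u \<in> test_functions p"
proof -
  have "smooth_on UNIV ht" by auto
  then have "(\<lambda>x. ht x * (\<Sum>i\<in>UNIV. pd i (\<lambda>y. hyp_grad u y $ i / ht y) x)) \<in> test_functions p"
    using smooth_on_subset[of UNIV ht "- {p}"]
    by (intro test_functions_weight test_functions_sum test_functions_D test_functions_div_ht test_functions_hyp_grad assms) auto
  then show ?thesis
    unfolding hyp_laplacian_def hyp_div_def hyp_density_eq by (simp add: mult.commute)
qed

lemma D_mult:
  "f differentiable (at x) \<Longrightarrow> g differentiable (at x) \<Longrightarrow>
    D (\<lambda>y. f y * g y) x v = f x * D g x v + D f x v * g x"
  using frechet_derivative_at[OF has_derivative_mult[of f "D f x" x UNIV g "D g x"]]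
  by (auto simp: frechet_derivative_works dest!: fun_cong[of _ _ v])

text \<open>The density cancels in \<open>hyp_div\<close>, so both integrands together form a sum of
  coordinate derivatives. Only first derivatives remain on the right, and these are easy to
  transport by boosts and to write in polar form.\<close>

theorem hyp_laplacian_weak:
  assumes u: "u \<in> test_functions p" and \<phi>: "\<phi> \<in> test_functions p"
  shows "(\<integral>x. hyp_laplacian u x * \<phi> x \<partial>hyp_volume) = - (\<integral>x. D \<phi> x (hyp_grad u x) \<partial>hyp_volume)"
proof -
  define F where "F i x = hyp_grad u x $ i / ht x" for i x
  have F: "F i \<in> test_functions p" for i
    unfolding F_def by (intro test_functions_div_ht test_functions_hyp_grad u)
  have diff: "f differentiable (at x)" if "f \<in> test_functions p" for f x
    using smooth_on_differentiable[OF test_functions_smooth[OF that]] by simp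
  have g: "(\<lambda>x. D \<phi> x (hyp_grad u x)) \<in> test_functions p"
    using test_functions_hyp_grad[OF u] by (intro test_functions_D \<phi>) (auto dest: test_functions_smooth)
  have "(\<integral>x. hyp_laplacian u x * \<phi> x \<partial>hyp_volume) + (\<integral>x. D \<phi> x (hyp_grad u x) \<partial>hyp_volume)
      = (\<integral>x. hyp_laplacian u x * \<phi> x / ht x + D \<phi> x (hyp_grad u x) / ht x \<partial>lborel)"
    using hyp_integral_test[OF test_functions_mult[OF test_functions_hyp_laplacian[OF u] \<phi>]] hyp_integral_test[OF g]
      test_functions_integrable[OF test_functions_div_ht[OF test_functions_mult[OF test_functions_hyp_laplacian[OF u] \<phi>]]]
      test_functions_integrable[OF test_functions_div_ht[OF g]]
    by simp
  also have "(\<lambda>x. hyp_laplacian u x * \<phi> x / ht x + D \<phi> x (hyp_grad u x) / ht x) =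
      (\<lambda>x. \<Sum>i\<in>UNIV. pd i (\<lambda>y. F i y * \<phi> y) x)"
  proof
    fix x
    have "hyp_laplacian u x / ht x = (\<Sum>i\<in>UNIV. pd i (F i) x)"
      unfolding hyp_laplacian_def hyp_div_def hyp_density_eq F_def
      using ht_nz[of x] by simp
    then have 1: "hyp_laplacian u x * \<phi> x / ht x = (\<Sum>i\<in>UNIV. pd i (F i) x) * \<phi> x"
      by (metis times_divide_eq_left)
    have 2: "D \<phi> x (hyp_grad u x) / ht x = (\<Sum>i\<in>UNIV. F i x * pd i \<phi> x)"
      by (subst frechet_derivative_componentwise[OF diff[OF \<phi>]]) (simp add: F_def sum_divide_distrib)
    have 3: "(\<Sum>i\<in>UNIV. pd i (\<lambda>y. F i y * \<phi> y) x) =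
        (\<Sum>i\<in>UNIV. F i x * pd i \<phi> x + pd i (F i) x * \<phi> x)"
      by (intro sum.cong refl D_mult diff F \<phi>)
    show "hyp_laplacian u x * \<phi> x / ht x + D \<phi> x (hyp_grad u x) / ht x =
        (\<Sum>i\<in>UNIV. pd i (\<lambda>y. F i y * \<phi> y) x)"
      unfolding 1 2 3 by (simp add: sum.distrib sum_distrib_right)
  qed
  also have "(\<integral>x. (\<Sum>i\<in>UNIV. pd i (\<lambda>y. F i y * \<phi> y) x) \<partial>lborel) =
      (\<Sum>i\<in>UNIV. \<integral>x. pd i (\<lambda>y. F i y * \<phi> y) x \<partial>lborel)"
    by (intro Bochner_Integration.integral_sum test_functions_integrable[of _ p] test_functions_D test_functions_mult F \<phi>) auto
  also have "\<dots> = 0"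
    using F \<phi> test_functions_mult[of _ p \<phi>]
    by (intro sum.neutral ballI integral_directional_derivative test_functions_bounded_supp[of _ p]
        smooth_on_imp_Ck_on test_functions_smooth[of _ p]) auto
  finally show ?thesis by simp
qed

section \<open>Boosts\<close>

text \<open>Spatial part of the pure Lorentz boost that carries the base point of the hyperboloid to
  the point above \<open>p\<close>; the inverse is the boost by \<open>- p\<close>. The quotient by
  \<open>1 + ht p\<close> equals \<open>(ht p - 1) / |p|^2\<close> and stays regular at
  \<open>p = 0\<close>.\<close>

definition boost :: "real ^ 'n \<Rightarrow> real ^ 'n \<Rightarrow> real ^ 'n" where
  "boost p y = y + (ht y + (y \<bullet> p) / (1 + ht p)) *\<^sub>R p"

lemma one_plus_ht: "1 + ht p > 0" "1 + ht p \<noteq> 0"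
  using ht_ge_1[of p] by linarith+

lemma ht_minus: "ht (- p) = ht p"
  by simp

lemma ht_mult_plus_inner_pos: "ht p * ht y + p \<bullet> y > 0"
proof -
  have "\<bar>p \<bullet> y\<bar> \<le> norm p * norm y" by (rule Cauchy_Schwarz_ineq2)
  also have "norm p * norm y < ht p * ht y"
    by (intro mult_strict_mono real_less_rsqrt) (use ht_pos in auto)
  finally show ?thesis by linarith
qed

text \<open>Both sides have the same square, by invariance of the Lorentz form, and
  \<open>ht_mult_plus_inner_pos\<close> fixes the sign.\<close>

lemma ht_boost: "ht (boost p y) = ht p * ht y + p \<bullet> y"
proof -
  define a b d where "a = ht p" and "b = ht y" and "d = (y \<bullet> p) / (1 + ht p)"
  have c: "y \<bullet> p = d * (1 + a)" using one_plus_ht[of p] by (simp add: d_def a_def)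
  have P: "p \<bullet> p = a\<^sup>2 - 1" and Y: "y \<bullet> y = b\<^sup>2 - 1"
    using ht_square[of p] ht_square[of y] by (simp_all add: a_def b_def)
  have z: "boost p y = y + (b + d) *\<^sub>R p" by (simp add: boost_def b_def d_def)
  have "1 + boost p y \<bullet> boost p y = 1 + y \<bullet> y + 2 * (b + d) * (y \<bullet> p) + (b + d)\<^sup>2 * (p \<bullet> p)"
    unfolding z by (simp add: inner_add_left inner_add_right inner_commute[of p y] power2_eq_square algebra_simps)
  also have "\<dots> = (a * b + y \<bullet> p)\<^sup>2"
    unfolding P Y c by (simp add: power2_eq_square algebra_simps)
  finally have "(ht (boost p y))\<^sup>2 = (a * b + y \<bullet> p)\<^sup>2" unfolding ht_square .
  then show ?thesis
    using ht_mult_plus_inner_pos[of p y] ht_pos[of "boost p y"]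
    by (simp only: power2_eq_iff_nonneg less_imp_le a_def b_def inner_commute)
qed

lemma boost_minus_boost: "boost (- p) (boost p y) = y"
proof -
  define a b d where "a = ht p" and "b = ht y" and "d = (y \<bullet> p) / (1 + ht p)"
  have a1: "1 + a \<noteq> 0" using one_plus_ht by (simp add: a_def)
  have c: "y \<bullet> p = d * (1 + a)" using one_plus_ht[of p] by (simp add: d_def a_def)
  have P: "p \<bullet> p = a\<^sup>2 - 1" using ht_square[of p] by (simp add: a_def)
  have z: "boost p y = y + (b + d) *\<^sub>R p" by (simp add: boost_def b_def d_def)
  have "boost p y \<bullet> p = (d + (b + d) * (a - 1)) * (1 + a)"
    unfolding z by (simp add: inner_add_left P c power2_eq_square algebra_simps)
  then have "(boost p y \<bullet> p) / (1 + a) = d + (b + d) * (a - 1)" using a1 by simp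
  moreover have "ht (boost p y) = a * b + d * (1 + a)"
    unfolding ht_boost a_def[symmetric] b_def[symmetric] using c by (simp add: inner_commute)
  \<comment> \<open>The second boost moves by the same multiple \<open>b + d\<close> of
    \<open>p\<close>, in the opposite direction.\<close>
  ultimately have "ht (boost p y) + (boost p y \<bullet> - p) / (1 + ht (- p)) = b + d"
    unfolding ht_minus a_def[symmetric] inner_minus_right minus_divide_left[symmetric] by (simp add: algebra_simps)
  then have "boost (- p) (boost p y) = boost p y + (b + d) *\<^sub>R (- p)"
    unfolding boost_def[of "- p"] by presburger
  then show ?thesis by (simp add: z)
qed

lemma boost_boost_minus: "boost p (boost (- p) y) = y"
  using boost_minus_boost[of "- p" y] by simp

lemma boost_0: "boost p 0 = p"
  by (simp add: boost_def)

definition dboost :: "real ^ 'n \<Rightarrow> real ^ 'n \<Rightarrow> real ^ 'n \<Rightarrow> real ^ 'n" where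
  "dboost p y v = v + ((y \<bullet> v) / ht y + (v \<bullet> p) / (1 + ht p)) *\<^sub>R p"

lemma has_derivative_boost: "(boost p has_derivative dboost p y) (at y)"
  unfolding boost_def[abs_def] dboost_def[abs_def] divide_inverse[of "_ \<bullet> p"]
  by (intro has_derivative_add has_derivative_ident has_derivative_scaleR_left has_derivative_ht
      has_derivative_mult_left has_derivative_inner_left)

lemma smooth_on_boost [intro]: "open S \<Longrightarrow> smooth_on S (\<lambda>y. boost p y $ i)"
  unfolding boost_def vector_add_component vector_scaleR_component divide_inverse real_scaleR_def
  by (intro smooth_on_add smooth_on_component smooth_on_mult smooth_on_ht smooth_on_inner smooth_on_const)

lemma continuous_on_boost: "continuous_on S (boost p)"
  by (meson has_derivative_boost has_derivative_continuous continuous_at_imp_continuous_on)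

lemma dboost_dboost_minus: "dboost p y (dboost (- p) (boost p y) v) = v"
proof -
  have "(boost (- p) has_derivative dboost (- p) (boost p y)) (at (boost p y))"
    by (rule has_derivative_boost)
  moreover have "(boost p has_derivative dboost p y) (at (boost (- p) (boost p y)))"
    unfolding boost_minus_boost by (rule has_derivative_boost)
  ultimately have "((boost p \<circ> boost (- p)) has_derivative (dboost p y \<circ> dboost (- p) (boost p y))) (at (boost p y))"
    by (rule diff_chain_at)
  moreover have "boost p \<circ> boost (- p) = (\<lambda>x. x)" by (auto simp: boost_boost_minus)
  ultimately have "dboost p y \<circ> dboost (- p) (boost p y) = (\<lambda>x. x)"
    using has_derivative_unique has_derivative_ident by metis
  then show ?thesis by (metis comp_apply)
qed

text \<open>Boosts act linearly on Minkowski space and preserve the Lorentz form, so besides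
  \<open>dboost\<close> only the time component of the image of a tangent vector has to be
  found.\<close>

lemma hyp_metric_boost: "hyp_metric (boost p y) (dboost p y v) (dboost p y w) = hyp_metric y v w"
proof -
  \<comment> \<open>The time component comes from differentiating the formula
    \<open>ht_boost\<close> for the height.\<close>
  have 1: "(boost p y \<bullet> dboost p y v) / ht (boost p y) = ht p * ((y \<bullet> v) / ht y) + p \<bullet> v" for v
  proof -
    have "((ht \<circ> boost p) has_derivative ((\<lambda>v. (boost p y \<bullet> v) / ht (boost p y)) \<circ> dboost p y)) (at y)"
      by (rule diff_chain_at[OF has_derivative_boost has_derivative_ht])
    moreover have "((\<lambda>y. ht p * ht y + p \<bullet> y) has_derivative (\<lambda>v. ht p * ((y \<bullet> v) / ht y) + p \<bullet> v)) (at y)"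
      by (intro has_derivative_add has_derivative_mult_right has_derivative_ht has_derivative_inner_right
          has_derivative_ident)
    moreover have "ht \<circ> boost p = (\<lambda>y. ht p * ht y + p \<bullet> y)" by (auto simp only: o_def ht_boost)
    ultimately show ?thesis
      using has_derivative_unique by (metis (no_types, lifting) comp_apply)
  qed
  define a where "a = ht p"
  have a1: "1 + a \<noteq> 0" using one_plus_ht by (simp add: a_def)
  have P: "p \<bullet> p = a\<^sup>2 - 1" using ht_square[of p] by (simp add: a_def)
  define \<alpha> \<beta> where "\<alpha> = (y \<bullet> v) / ht y" and "\<beta> = (y \<bullet> w) / ht y"
  define d e where "d = (v \<bullet> p) / (1 + a)" and "e = (w \<bullet> p) / (1 + a)"
  have d: "v \<bullet> p = d * (1 + a)" and e: "w \<bullet> p = e * (1 + a)" using a1 by (simp_all add: d_def e_def)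
  have "dboost p y v \<bullet> dboost p y w = v \<bullet> w + (\<beta> + e) * (v \<bullet> p) + (\<alpha> + d) * (w \<bullet> p) + (\<alpha> + d) * (\<beta> + e) * (p \<bullet> p)"
    unfolding dboost_def a_def[symmetric] \<alpha>_def[symmetric] \<beta>_def[symmetric] d_def[symmetric] e_def[symmetric]
    by (simp add: inner_add_left inner_add_right inner_commute[of p w] algebra_simps)
  then show ?thesis
    unfolding hyp_metric_lorentz 1 lorentz_def fst_conv snd_conv
      \<alpha>_def[symmetric] \<beta>_def[symmetric] a_def[symmetric] inner_commute[of p v] inner_commute[of p w] P d e
    by (simp add: power2_eq_square algebra_simps)
qed

lemma D_boost:
  assumes "u differentiable (at (boost p y))"
  shows "D (\<lambda>y. u (boost p y)) y v = D u (boost p y) (dboost p y v)"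
    "(\<lambda>y. u (boost p y)) differentiable (at y)"
proof -
  have "(u has_derivative D u (boost p y)) (at (boost p y))"
    using assms by (simp add: frechet_derivative_works[symmetric])
  then have *: "((\<lambda>y. u (boost p y)) has_derivative (\<lambda>v. D u (boost p y) (dboost p y v))) (at y)"
    using diff_chain_at[OF has_derivative_boost] by (simp add: o_def)
  show "D (\<lambda>y. u (boost p y)) y v = D u (boost p y) (dboost p y v)"
    using frechet_derivative_at[OF *] by metis
  show "(\<lambda>y. u (boost p y)) differentiable (at y)"
    using * differentiable_def by blast
qed

lemma hyp_grad_boost:
  assumes "u differentiable (at (boost p y))"
  shows "hyp_grad u (boost p y) = dboost p y (hyp_grad (\<lambda>y. u (boost p y)) y)"
proof (rule hyp_grad_unique[OF assms])
  fix v
  define v' where "v' = dboost (- p) (boost p y) v"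
  have v: "v = dboost p y v'" by (simp add: v'_def dboost_dboost_minus)
  show "hyp_metric (boost p y) (dboost p y (hyp_grad (\<lambda>y. u (boost p y)) y)) v = D u (boost p y) v"
    unfolding v hyp_metric_boost hyp_metric_grad[OF D_boost(2)[OF assms]] D_boost(1)[OF assms] ..
qed

lemma hyp_grad_sq_boost:
  "u differentiable (at (boost p y)) \<Longrightarrow>
    hyp_grad_sq u (boost p y) = hyp_grad_sq (\<lambda>y. u (boost p y)) y"
  unfolding hyp_grad_sq_def by (simp add: hyp_grad_boost hyp_metric_boost)

lemma D_hyp_grad_boost:
  assumes "u differentiable (at (boost p y))" "v differentiable (at (boost p y))"
  shows "D v (boost p y) (hyp_grad u (boost p y)) =
    D (\<lambda>y. v (boost p y)) y (hyp_grad (\<lambda>y. u (boost p y)) y)"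
  by (simp add: hyp_grad_boost[OF assms(1)] D_boost(1)[OF assms(2)])

section \<open>Distance, geodesics and radial derivatives under boosts\<close>

lemma hyp_dist_0: "cosh (hyp_dist 0 y) = ht y" "sinh (hyp_dist 0 y) = norm y" "hyp_dist 0 y = arsinh (norm y)"
proof -
  have "hyp_dist 0 y = arcosh (ht y)"
    by (simp add: hyp_dist_def lorentz_def hyp_emb_def)
  also have "ht y = cosh (arsinh (norm y))"
    using cosh_square_eq[of "arsinh (norm y)"] by (simp add: real_sqrt_unique add.commute)
  finally show 3: "hyp_dist 0 y = arsinh (norm y)"
    using sinh_real_nonneg_iff[of "arsinh (norm y)"] by (simp add: arcosh_cosh_real)
  show "cosh (hyp_dist 0 y) = ht y" "sinh (hyp_dist 0 y) = norm y"
    unfolding 3 using cosh_square_eq[of "arsinh (norm y)"] by (simp_all add: real_sqrt_unique add.commute)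
qed

lemma hyp_dist_0_pos: "y \<noteq> 0 \<Longrightarrow> hyp_dist 0 y > 0"
  unfolding hyp_dist_0 by simp

lemma hyp_dist_boost: "hyp_dist p (boost p y) = hyp_dist 0 y"
proof -
  define a b d where "a = ht p" and "b = ht y" and "d = (y \<bullet> p) / (1 + ht p)"
  have c: "y \<bullet> p = d * (1 + a)" using one_plus_ht[of p] by (simp add: d_def a_def)
  have P: "p \<bullet> p = a\<^sup>2 - 1" using ht_square[of p] by (simp add: a_def)
  have "p \<bullet> boost p y = y \<bullet> p + (b + d) * (p \<bullet> p)"
    by (simp add: boost_def b_def d_def inner_add_right inner_commute)
  moreover have "ht (boost p y) = a * b + y \<bullet> p"
    unfolding ht_boost a_def b_def by (simp add: inner_commute)
  ultimately have "- lorentz (hyp_emb p) (hyp_emb (boost p y)) = b"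
    unfolding lorentz_def hyp_emb_def fst_conv snd_conv a_def[symmetric]
    by (simp add: P c power2_eq_square algebra_simps)
  moreover have "- lorentz (hyp_emb 0) (hyp_emb y) = b"
    by (simp add: lorentz_def hyp_emb_def b_def)
  ultimately show ?thesis unfolding hyp_dist_def by metis
qed

lemma hyp_geodesic_0: "hyp_geodesic 0 y t = (sinh t / norm y) *\<^sub>R y"
  by (simp add: hyp_geodesic_def hyp_dist_0)

text \<open>A boost is linear on Minkowski space, and the height of the ray at time \<open>t\<close>
  is \<open>cosh t\<close>, the same linear combination of the heights of its end points as the ray
  is of the points themselves.\<close>

lemma boost_hyp_geodesic:
  assumes "y \<noteq> 0"
  shows "boost p (hyp_geodesic 0 y t) = hyp_geodesic p (boost p y) t"
proof -
  define s z where "s = norm y" and "z = hyp_geodesic 0 y t"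
  have s: "s > 0" using assms by (simp add: s_def)
  have z: "z = (sinh t / s) *\<^sub>R y" by (simp add: z_def s_def hyp_geodesic_0)
  have "norm z = \<bar>sinh t\<bar>" using s by (simp add: z s_def[symmetric])
  then have htz: "ht z = cosh t"
    using cosh_square_eq[of t] by (simp add: real_sqrt_unique add.commute)
  have "sinh (hyp_dist 0 y - t) / s + sinh t / s * ht y = cosh t"
    using s by (simp add: sinh_diff hyp_dist_0(1,2) s_def[symmetric] field_simps)
  then show ?thesis
    unfolding z_def[symmetric] hyp_geodesic_def[of p] hyp_dist_boost hyp_dist_0(2) s_def[symmetric]
    unfolding boost_def htz s_def[symmetric] unfolding z
    by (simp add: algebra_simps flip: scaleR_add_left)
qed

lemma radial_deriv_boost: "radial_deriv p u (boost p y) = radial_deriv 0 (\<lambda>y. u (boost p y)) y"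
proof (cases "y = 0")
  case True
  \<comment> \<open>Division by \<open>sinh 0 = 0\<close> makes the geodesic from the pole to itself
    constantly \<open>0\<close>, so both sides are derivatives of constants.\<close>
  have "hyp_geodesic p p t = 0" for t
    using hyp_dist_boost[of p 0] by (simp add: hyp_geodesic_def boost_0 hyp_dist_0)
  then show ?thesis
    unfolding radial_deriv_def True boost_0 by (simp add: hyp_geodesic_0)
next
  case False
  then show ?thesis
    unfolding radial_deriv_def by (simp add: boost_hyp_geodesic hyp_dist_boost)
qed

lemma radial_laplacian_boost:
  "radial_laplacian p u (boost p y) = radial_laplacian 0 (\<lambda>y. u (boost p y)) y"
  unfolding radial_laplacian_def by (simp add: radial_deriv_boost hyp_dist_boost)

lemma norm_boost_le: "norm (boost p y) \<le> norm y + (1 + norm y + norm y * norm p) * norm p"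
proof -
  have "ht y \<le> 1 + norm y"
    by (rule real_le_lsqrt) (auto simp: power2_eq_square algebra_simps)
  moreover have "\<bar>y \<bullet> p\<bar> / (1 + ht p) \<le> norm y * norm p / 1"
    using ht_ge_1[of p] by (intro frac_le Cauchy_Schwarz_ineq2) auto
  ultimately have "\<bar>ht y + (y \<bullet> p) / (1 + ht p)\<bar> \<le> 1 + norm y + norm y * norm p"
    using ht_pos[of y] one_plus_ht(1)[of p] abs_triangle_ineq[of "ht y" "(y \<bullet> p) / (1 + ht p)"] by simp
  then have "norm ((ht y + (y \<bullet> p) / (1 + ht p)) *\<^sub>R p) \<le> (1 + norm y + norm y * norm p) * norm p"
    by (simp add: mult_right_mono)
  then show ?thesis
    unfolding boost_def using norm_triangle_ineq[of y "(ht y + (y \<bullet> p) / (1 + ht p)) *\<^sub>R p"] by linarith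
qed

text \<open>The growth bound applied to the inverse boost. It is uniform over
  \<open>norm p \<le> R\<close>, which keeps the supports along a whole family of boosts in one
  ball.\<close>

lemma norm_boost_gt:
  assumes "norm y > b + (1 + b + b * R) * R" "b \<ge> 0" "norm p \<le> R"
  shows "norm (boost p y) > b"
proof (rule ccontr)
  assume "\<not> norm (boost p y) > b"
  then have *: "norm (boost p y) \<le> b" by simp
  have "R \<ge> 0" using assms(3) norm_ge_zero order_trans by blast
  have "norm y \<le> norm (boost p y) + (1 + norm (boost p y) + norm (boost p y) * norm p) * norm p"
    using norm_boost_le[of "- p" "boost p y"] by (simp add: boost_minus_boost)
  also have "\<dots> \<le> b + (1 + b + b * R) * R"
    using * assms(2,3) \<open>R \<ge> 0\<close> by (intro add_mono mult_mono order_refl) auto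
  finally show False using assms(1) by simp
qed

lemma test_functions_boost:
  assumes "u \<in> test_functions (boost p q)"
  shows "(\<lambda>y. u (boost p y)) \<in> test_functions q"
  unfolding test_functions_iff
proof (intro conjI)
  show "smooth_on UNIV (\<lambda>y. u (boost p y))"
    using smooth_on_compose[OF open_UNIV test_functions_smooth[OF assms] smooth_on_boost[OF open_UNIV]] by simp
  obtain b where b: "b > 0" "\<And>x. norm x > b \<Longrightarrow> u x = 0"
    using bounded_supp_bound[OF test_functions_bounded_supp[OF assms]] by blast
  then show "bounded_supp (\<lambda>y. u (boost p y))"
    unfolding bounded_supp_def
    by (intro exI[of _ "b + (1 + b + b * norm p) * norm p"]) (auto intro!: b(2) norm_boost_gt[of b])
  obtain a where a: "a > 0" "\<And>x. dist x (boost p q) < a \<Longrightarrow> u x = 0"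
    using assms unfolding test_functions_iff by metis
  have "continuous (at q) (boost p)"
    using has_derivative_continuous[OF has_derivative_boost] .
  then obtain d where "d > 0" "\<And>y. dist y q < d \<Longrightarrow> dist (boost p y) (boost p q) < a"
    using a(1) unfolding continuous_at_eps_delta by metis
  then show "\<exists>a>0. \<forall>y. dist y q < a \<longrightarrow> u (boost p y) = 0" using a(2) by blast
qed

subsection \<open>Invariance of the hyperbolic volume\<close>

text \<open>The rapidity \<open>a\<close> is the flow time of the boosts along \<open>e\<close>; the
  coefficient simplifies by \<open>sinh^2 a = (cosh a - 1) (1 + cosh a)\<close>.\<close>

lemma boost_sinh:
  assumes "norm e = 1"
  shows "boost (sinh a *\<^sub>R e) y = y + (sinh a * ht y + (cosh a - 1) * (y \<bullet> e)) *\<^sub>R e"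
    "ht (sinh a *\<^sub>R e) = cosh a"
proof -
  show h: "ht (sinh a *\<^sub>R e) = cosh a"
  proof -
    have "1 + (norm (sinh a *\<^sub>R e))\<^sup>2 = (cosh a)\<^sup>2"
      using assms by (simp add: cosh_square_eq)
    then show ?thesis by simp
  qed
  have "1 + cosh a \<noteq> 0" using cosh_real_ge_1[of a] by linarith
  moreover have "(sinh a)\<^sup>2 = (cosh a - 1) * (1 + cosh a)"
    using sinh_square_eq[of a] by (simp add: power2_eq_square algebra_simps)
  ultimately have "(sinh a)\<^sup>2 / (1 + cosh a) = cosh a - 1" by simp
  moreover have "(y \<bullet> (sinh a *\<^sub>R e)) / (1 + cosh a) * sinh a = (sinh a)\<^sup>2 / (1 + cosh a) * (y \<bullet> e)"
    by (simp add: power2_eq_square)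
  ultimately have "(y \<bullet> (sinh a *\<^sub>R e)) / (1 + cosh a) * sinh a = (cosh a - 1) * (y \<bullet> e)"
    by simp
  then show "boost (sinh a *\<^sub>R e) y = y + (sinh a * ht y + (cosh a - 1) * (y \<bullet> e)) *\<^sub>R e"
    unfolding boost_def h scaleR_scaleR distrib_right[of "ht y"] by (simp only: mult.commute[of "ht y"])
qed

text \<open>
  The boosts along \<open>e\<close> form the flow of the vector field \<open>ht y *\<^sub>R e\<close>, which times the density
  \<open>1 / ht\<close> is constant, hence divergence free.
\<close>

lemma hyp_integral_boost_unit:
  assumes u: "u \<in> test_functions q" and e: "norm e = 1"
  shows "(\<integral>y. u (boost (sinh R *\<^sub>R e) y) / ht y \<partial>lborel) = (\<integral>y. u y / ht y \<partial>lborel)"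
proof -
  define B where "B \<theta> = boost (sinh (\<theta> * R) *\<^sub>R e)" for \<theta>
  have B: "B \<theta> y = y + (sinh (\<theta> * R) * ht y + (cosh (\<theta> * R) - 1) * (y \<bullet> e)) *\<^sub>R e" for \<theta> y
    unfolding B_def by (rule boost_sinh[OF e])
  have htB: "ht (B \<theta> y) = cosh (\<theta> * R) * ht y + sinh (\<theta> * R) * (y \<bullet> e)" for \<theta> y
    unfolding B_def ht_boost boost_sinh(2)[OF e] by (simp add: inner_commute)
  have contB: "continuous_on ({0..1} \<times> UNIV) (\<lambda>z. B (fst z) (snd z))"
    unfolding B by (intro continuous_intros)
  have contB\<theta>: "continuous_on UNIV (B \<theta>)" for \<theta>
    unfolding B_def by (rule continuous_on_boost)
  have diff: "u differentiable (at x)" for x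
    using smooth_on_differentiable[OF test_functions_smooth[OF u]] by simp
  have Due: "(\<lambda>x. D u x e) \<in> test_functions q"
    using u by (intro test_functions_D) auto
  obtain b where b: "b > 0" "\<And>x. norm x > b \<Longrightarrow> u x = 0"
    using bounded_supp_bound[OF test_functions_bounded_supp[OF u]] by blast
  define S where "S = sinh \<bar>R\<bar>"
  define F' where "F' \<theta> y = R * ht (B \<theta> y) * D u (B \<theta> y) e / ht y" for \<theta> y
  have norm_p: "norm (sinh (\<theta> * R) *\<^sub>R e) \<le> S" if "\<theta> \<in> {0..1}" for \<theta>
  proof -
    have "\<bar>\<theta> * R\<bar> \<le> \<bar>R\<bar>" using that by (simp add: abs_mult mult_left_le_one_le)
    then have "sinh \<bar>\<theta> * R\<bar> \<le> sinh \<bar>R\<bar>" by (simp only: sinh_real_le_iff)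
    then show ?thesis using e by (simp add: S_def)
  qed
  have far: "norm (B \<theta> y) > b" if "\<theta> \<in> {0..1}" "norm y > b + (1 + b + b * S) * S" for \<theta> y
    unfolding B_def using that b(1) by (intro norm_boost_gt[OF _ _ norm_p]) auto
  have "(\<integral>y. u (B 1 y) / ht y \<partial>lborel) = (\<integral>y. u (B 0 y) / ht y \<partial>lborel)"
  proof (rule integral_parameter_constant[where F' = F' and b = "b + (1 + b + b * S) * S"])
    fix \<theta> :: real and y
    assume \<theta>: "\<theta> \<in> {0..1}"
    \<comment> \<open>The velocity is \<open>R\<close> times the generating field at the moving
      point, whose length factor is \<open>ht (B \<theta> y)\<close>.\<close>
    have "((\<lambda>\<theta>. B \<theta> y) has_derivative (\<lambda>h. h *\<^sub>R ((R * ht (B \<theta> y)) *\<^sub>R e))) (at \<theta>)"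
      unfolding htB unfolding B by (auto intro!: derivative_eq_intros simp: algebra_simps)
    moreover have "(u has_derivative D u (B \<theta> y)) (at (B \<theta> y))"
      using diff by (simp add: frechet_derivative_works[symmetric])
    ultimately have "((\<lambda>\<theta>. u (B \<theta> y)) has_derivative (\<lambda>h. D u (B \<theta> y) (h *\<^sub>R ((R * ht (B \<theta> y)) *\<^sub>R e)))) (at \<theta>)"
      using diff_chain_at[of "\<lambda>\<theta>. B \<theta> y"] by (simp add: o_def)
    then have "((\<lambda>\<theta>. u (B \<theta> y)) has_real_derivative R * ht (B \<theta> y) * D u (B \<theta> y) e) (at \<theta>)"
      using linear_cmul[OF linear_frechet_derivative[OF diff]]
      by (simp add: has_field_derivative_def mult_ac mult_commute_abs)
    then have "((\<lambda>\<theta>. u (B \<theta> y) / ht y) has_real_derivative F' \<theta> y) (at \<theta>)"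
      unfolding F'_def by (rule DERIV_cdivide)
    then show "((\<lambda>\<theta>. u (B \<theta> y) / ht y) has_real_derivative F' \<theta> y) (at \<theta> within {0..1})"
      by (rule has_field_derivative_at_within)
  next
    show "continuous_on UNIV (\<lambda>y. u (B \<theta> y) / ht y)" for \<theta>
      using continuous_on_compose2[OF smooth_on_continuous[OF test_functions_smooth[OF u]] contB\<theta>]
      by (intro continuous_on_divide continuous_on_ht) (use ht_nz in auto)
    have "continuous_on ({0..1} \<times> UNIV) (\<lambda>z. D u (B (fst z) (snd z)) e)"
      using continuous_on_compose2[OF smooth_on_continuous[OF test_functions_smooth[OF Due]] contB] by simp
    then show "continuous_on ({0..1} \<times> UNIV) (\<lambda>(\<theta>, y). F' \<theta> y)"
      unfolding F'_def split_beta htB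
      by (intro continuous_intros) (use ht_nz in auto)
    show "u (B \<theta> y) / ht y = 0" if "\<theta> \<in> {0..1}" "norm y > b + (1 + b + b * S) * S" for \<theta> y
      using b(2)[OF far[OF that]] by simp
    show "F' \<theta> y = 0" if "\<theta> \<in> {0..1}" "norm y > b + (1 + b + b * S) * S" for \<theta> y
      using D_bounded_supp[OF b(2) far[OF that]] by (simp add: F'_def)
  next
    fix \<theta> :: real
    let ?p = "sinh (\<theta> * R) *\<^sub>R e"
    have "(\<lambda>y. u (B \<theta> y)) \<in> test_functions (boost (- ?p) q)"
      unfolding B_def using u by (intro test_functions_boost) (simp add: boost_boost_minus)
    then have "(\<integral>y. D (\<lambda>y. u (B \<theta> y)) y e \<partial>lborel) = 0"
      by (intro integral_directional_derivative smooth_on_imp_Ck_on test_functions_smooth test_functions_bounded_supp)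
    \<comment> \<open>A flow maps its own generating field to itself, so \<open>dboost\<close>
      carries \<open>ht y *\<^sub>R e\<close> to \<open>ht (B \<theta> y) *\<^sub>R e\<close>. Thus
      \<open>F'\<close> is, up to \<open>R\<close>, a derivative in the constant direction
      \<open>e\<close>.\<close>
    moreover have "F' \<theta> y = R * D (\<lambda>y. u (B \<theta> y)) y e" for y
    proof -
      have "(B \<theta> has_derivative (\<lambda>v. v + (sinh (\<theta> * R) * ((y \<bullet> v) / ht y) + (cosh (\<theta> * R) - 1) * (v \<bullet> e)) *\<^sub>R e)) (at y)"
        unfolding B by (intro has_derivative_add has_derivative_ident has_derivative_scaleR_left has_derivative_ht
            has_derivative_mult_right has_derivative_inner_left)
      then have "dboost ?p y = (\<lambda>v. v + (sinh (\<theta> * R) * ((y \<bullet> v) / ht y) + (cosh (\<theta> * R) - 1) * (v \<bullet> e)) *\<^sub>R e)"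
        unfolding B_def using has_derivative_unique has_derivative_boost by blast
      then have "dboost ?p y e = (ht (B \<theta> y) / ht y) *\<^sub>R e"
        using e ht_nz[of y] unfolding htB
        by (simp add: norm_eq_1 add_divide_distrib algebra_simps flip: scaleR_add_left)
      then have "D (\<lambda>y. u (B \<theta> y)) y e = ht (B \<theta> y) / ht y * D u (B \<theta> y) e"
        unfolding B_def D_boost(1)[OF diff] using linear_cmul[OF linear_frechet_derivative[OF diff]] by simp
      then show ?thesis by (simp add: F'_def)
    qed
    ultimately show "(\<integral>y. F' \<theta> y \<partial>lborel) = 0" by simp
  qed
  \<comment> \<open>At \<open>\<theta> = 0\<close> the boost is the identity.\<close>
  then show ?thesis by (simp add: B_def boost_def)
qed

theorem hyp_integral_boost:
  assumes g: "g \<in> test_functions 0" and F: "\<And>y. F (boost p y) = g y"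
  shows "(\<integral>x. F x \<partial>hyp_volume) = (\<integral>x. g x \<partial>hyp_volume)" "F \<in> test_functions p"
proof -
  have "F = (\<lambda>x. g (boost (- p) x))"
    using F by (auto simp: fun_eq_iff boost_boost_minus F[symmetric])
  moreover have "(\<lambda>x. g (boost (- p) x)) \<in> test_functions p"
    using g boost_minus_boost[of p 0] by (intro test_functions_boost) (simp add: boost_0)
  ultimately show Ft: "F \<in> test_functions p" by simp
  show "(\<integral>x. F x \<partial>hyp_volume) = (\<integral>x. g x \<partial>hyp_volume)"
  proof (cases "p = 0")
    case True
    then have "F = g" using F by (auto simp: boost_def fun_eq_iff)
    then show ?thesis by simp
  next
    case False
    \<comment> \<open>Rapidity \<open>arsinh (norm p)\<close> in the direction of \<open>p\<close>
      reproduces the boost by \<open>p\<close>.\<close>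
    have "sinh (arsinh (norm p)) *\<^sub>R (p /\<^sub>R norm p) = p" using False by simp
    then have "(\<integral>y. F (boost p y) / ht y \<partial>lborel) = (\<integral>y. F y / ht y \<partial>lborel)"
      using hyp_integral_boost_unit[OF Ft, of "p /\<^sub>R norm p" "arsinh (norm p)"] False by simp
    then show ?thesis
      by (simp add: F hyp_integral_test[OF g] hyp_integral_test[OF Ft])
  qed
qed

section \<open>Radial and angular derivatives at the pole \<open>0\<close>\<close>

abbreviation rd :: "(real ^ 'n \<Rightarrow> real) \<Rightarrow> real ^ 'n \<Rightarrow> real" where
  "rd \<equiv> radial_deriv 0"

definition Rot :: "'n \<Rightarrow> 'n \<Rightarrow> (real ^ 'n \<Rightarrow> real) \<Rightarrow> real ^ 'n \<Rightarrow> real" where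
  "Rot i j u x = x $ i * pd j u x - x $ j * pd i u x"

lemma test_functions_differentiable: "u \<in> test_functions p \<Longrightarrow> u differentiable (at x)"
  using smooth_on_differentiable[OF test_functions_smooth] by simp

lemma smooth_on_norm [intro]:
  assumes "open S" "0 \<notin> S"
  shows "smooth_on S norm"
  unfolding norm_eq_sqrt_inner
  by (intro smooth_on_sqrt smooth_on_inner_self assms(1)) (use assms in auto)

lemma smooth_on_hyp_dist_0 [intro]:
  fixes S :: "(real ^ 'n) set"
  assumes "open S" "0 \<notin> S"
  shows "smooth_on S (hyp_dist 0)"
proof -
  have "smooth_on S (\<lambda>x. ln (norm x + ht x))"
    by (intro smooth_on_ln smooth_on_add smooth_on_ht smooth_on_norm assms add_nonneg_pos norm_ge_zero ht_pos)
  moreover have "hyp_dist 0 = (\<lambda>x :: real ^ 'n. ln (norm x + ht x))"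
    by (auto simp: hyp_dist_0 arsinh_real_def add.commute)
  ultimately show ?thesis by simp
qed

lemma coth_hyp_dist_0: "coth (hyp_dist 0 x) = ht x / norm x"
  by (simp add: coth_def hyp_dist_0(1,2))

lemma hyp_geodesic_hyp_dist: "x \<noteq> 0 \<Longrightarrow> hyp_geodesic 0 x (hyp_dist 0 x) = x"
  by (simp add: hyp_geodesic_0 hyp_dist_0(2))

lemma radial_deriv_at_0: "rd u 0 = 0"
  by (simp add: radial_deriv_def hyp_geodesic_0)

text \<open>In the chart the ray is \<open>sinh t\<close> times a unit vector, so its velocity at
  \<open>x\<close> is \<open>cosh r\<close> times \<open>x / norm x\<close>.\<close>

lemma geodesic_derivative:
  assumes "x \<noteq> 0" "u differentiable (at x)"
  shows "((\<lambda>t. u (hyp_geodesic 0 x t)) has_real_derivative ht x / norm x * D u x x) (at (hyp_dist 0 x))"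
proof -
  let ?r = "hyp_dist 0 x"
  have 1: "(hyp_geodesic 0 x has_derivative (\<lambda>h. h *\<^sub>R ((ht x / norm x) *\<^sub>R x))) (at ?r)"
    unfolding hyp_geodesic_0 [abs_def] hyp_dist_0(1)[symmetric] using assms(1)
    by (auto intro!: derivative_eq_intros simp: field_simps)
  have "(u has_derivative D u x) (at (hyp_geodesic 0 x ?r))"
    using assms by (simp add: frechet_derivative_works[symmetric] hyp_geodesic_hyp_dist)
  from diff_chain_at[OF 1 this]
  have "((\<lambda>t. u (hyp_geodesic 0 x t)) has_derivative (\<lambda>h. D u x (h *\<^sub>R ((ht x / norm x) *\<^sub>R x)))) (at ?r)"
    by (simp add: o_def)
  moreover have "(\<lambda>h. D u x (h *\<^sub>R ((ht x / norm x) *\<^sub>R x))) = (*) (ht x / norm x * D u x x)"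
    by (rule ext) (simp add: linear_cmul[OF linear_frechet_derivative[OF assms(2)]])
  ultimately show ?thesis
    unfolding has_field_derivative_def by simp
qed

lemma radial_deriv_eq: "u differentiable (at x) \<Longrightarrow> rd u x = ht x / norm x * D u x x"
  using DERIV_imp_deriv[OF geodesic_derivative[of x u]]
  by (cases "x = 0") (simp_all add: radial_deriv_def radial_deriv_at_0[unfolded radial_deriv_def])

lemma radial_deriv_DERIV:
  "x \<noteq> 0 \<Longrightarrow> u differentiable (at x) \<Longrightarrow>
    ((\<lambda>t. u (hyp_geodesic 0 x t)) has_real_derivative rd u x) (at (hyp_dist 0 x))"
  using geodesic_derivative[of x u] radial_deriv_eq[of u x] by simp

text \<open>The distance from \<open>0\<close> along the ray is \<open>t\<close> for
  \<open>t > 0\<close>, which is all that the derivative at a positive time sees.\<close>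

lemma radial_weight_DERIV:
  assumes "x \<noteq> 0" "(\<phi> has_real_derivative d) (at (hyp_dist 0 x))"
  shows "((\<lambda>t. \<phi> (hyp_dist 0 (hyp_geodesic 0 x t))) has_real_derivative d) (at (hyp_dist 0 x))"
proof -
  have "hyp_dist 0 (hyp_geodesic 0 x t) = t" if "t > 0" for t
    using assms(1) that by (simp add: hyp_dist_0(3) hyp_geodesic_0 arsinh_sinh_real)
  then have "\<phi> (hyp_dist 0 (hyp_geodesic 0 x t)) = \<phi> t" if "t \<in> {0<..}" for t using that by simp
  then show ?thesis
    using has_field_derivative_transform_within_open[OF assms(2), of "{0<..}" "\<lambda>t. \<phi> (hyp_dist 0 (hyp_geodesic 0 x t))"]
      hyp_dist_0_pos[OF assms(1)] by simp
qed

lemma radial_deriv_eqI: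
  "((\<lambda>t. u (hyp_geodesic 0 x t)) has_real_derivative d) (at (hyp_dist 0 x)) \<Longrightarrow> rd u x = d"
  unfolding radial_deriv_def by (rule DERIV_imp_deriv)

lemma test_functions_rd [intro]:
  assumes "u \<in> test_functions 0"
  shows "rd u \<in> test_functions 0"
proof -
  have "rd u = (\<lambda>x. ht x / norm x * D u x x)"
    using radial_deriv_eq[OF test_functions_differentiable[OF assms]] by auto
  moreover have "(\<lambda>x. ht x / norm x * D u x x) \<in> test_functions 0"
    by (intro test_functions_weight smooth_on_divide smooth_on_norm test_functions_D assms smooth_on_ht
        smooth_on_component) auto
  ultimately show ?thesis by simp
qed

lemma test_functions_eq_0_at_pole: "u \<in> test_functions p \<Longrightarrow> u p = 0"
  unfolding test_functions_iff by (metis dist_self)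

lemma Rot_at_0: "Rot i j u 0 = 0"
  by (simp add: Rot_def)

lemma Rot_eq_D:
  "u differentiable (at x) \<Longrightarrow> Rot i j u x = D u x (x $ i *\<^sub>R axis j 1 - x $ j *\<^sub>R axis i 1)"
  using linear_frechet_derivative[of u "at x"] by (simp add: Rot_def linear_diff linear_cmul)

lemma test_functions_Rot [intro]:
  assumes "u \<in> test_functions 0"
  shows "Rot i j u \<in> test_functions 0"
  unfolding Rot_def [abs_def]
  by (intro test_functions_diff test_functions_weight test_functions_D assms smooth_on_component smooth_on_const) auto

lemma pd_component:
  fixes x :: "real ^ 'n"
  shows "pd j (\<lambda>x. x $ i) x = (if i = j then 1 else 0)"
proof -
  have *: "((\<lambda>x :: real ^ 'n. x $ i) has_derivative (\<lambda>x. x $ i)) (at x)"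
    by (rule bounded_linear_imp_has_derivative[OF bounded_linear_vec_nth])
  show ?thesis
    unfolding frechet_derivative_at[OF *, symmetric] by (simp add: axis_def)
qed

lemma differentiable_component: "(\<lambda>x :: real ^ 'n. x $ i) differentiable (at x)"
  using bounded_linear_imp_differentiable[OF bounded_linear_vec_nth] by blast

lemma pd_component_mult:
  "u differentiable (at x) \<Longrightarrow>
    pd j (\<lambda>x. x $ i * u x) x = x $ i * pd j u x + (if i = j then 1 else 0) * u x"
  by (simp add: D_mult[OF differentiable_component] pd_component)

section \<open>Radial functions, rotation fields and the Euler field\<close>

definition radial :: "(real ^ 'n \<Rightarrow> real) \<Rightarrow> bool" where
  "radial w \<longleftrightarrow> (\<forall>x y. norm x = norm y \<longrightarrow> w x = w y)"

text \<open>A radial function is constant along the great circle through \<open>x\<close> in a direction orthogonal to \<open>x\<close>.\<close>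

lemma D_radial:
  assumes "radial w" "w differentiable (at x)" "x \<bullet> v = 0" "x \<noteq> 0"
  shows "D w x v = 0"
proof (cases "v = 0")
  case True
  then show ?thesis using linear_0[OF linear_frechet_derivative[OF assms(2)]] by simp
next
  case False
  define v' where "v' = (norm x / norm v) *\<^sub>R v"
  define c where "c t = cos t *\<^sub>R x + sin t *\<^sub>R v'" for t :: real
  have v': "x \<bullet> v' = 0" "v' \<bullet> v' = x \<bullet> x"
    using assms(3) False by (simp_all add: v'_def field_simps power2_eq_square flip: power2_norm_eq_inner)
  have "(norm (c t))\<^sup>2 = (norm x)\<^sup>2" for t
  proof -
    have "c t \<bullet> c t = (cos t * cos t) * (x \<bullet> x) + (sin t * sin t) * (x \<bullet> x)"
      unfolding c_def by (simp add: inner_add_left inner_add_right v' inner_commute[of v' x])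
    also have "\<dots> = ((cos t)\<^sup>2 + (sin t)\<^sup>2) * (x \<bullet> x)"
      by (simp only: distrib_right power2_eq_square)
    finally have "c t \<bullet> c t = x \<bullet> x" by simp
    then show ?thesis by (simp add: power2_norm_eq_inner)
  qed
  then have "norm (c t) = norm x" for t by (simp add: power2_eq_iff_nonneg)
  then have "w (c t) = w x" for t using assms(1) unfolding radial_def by blast
  then have "((\<lambda>t. w (c t)) has_derivative (\<lambda>h. 0)) (at 0)" by simp
  moreover have "(c has_derivative (\<lambda>h. h *\<^sub>R v')) (at 0)"
    unfolding c_def by (auto intro!: derivative_eq_intros)
  moreover have "(w has_derivative D w x) (at (c 0))"
    using assms(2) by (simp add: frechet_derivative_works[symmetric] c_def)
  ultimately have "(\<lambda>h. D w x (h *\<^sub>R v')) = (\<lambda>h. 0)"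
    using diff_chain_at[of c "\<lambda>h. h *\<^sub>R v'" 0 w "D w x"] has_derivative_unique
    by (auto simp: o_def)
  then have "D w x (1 *\<^sub>R v') = 0" by meson
  then show ?thesis
    using assms(4) False by (simp add: v'_def linear_cmul[OF linear_frechet_derivative[OF assms(2)]])
qed

lemma Rot_mult:
  "f differentiable (at x) \<Longrightarrow> g differentiable (at x) \<Longrightarrow>
    Rot i j (\<lambda>x. f x * g x) x = f x * Rot i j g x + Rot i j f x * g x"
  by (simp add: Rot_def D_mult algebra_simps)

lemma Rot_radial:
  assumes "radial w" "w differentiable (at x)"
  shows "Rot i j w x = 0"
proof (cases "x = 0")
  case False
  have "x \<bullet> (x $ i *\<^sub>R axis j 1 - x $ j *\<^sub>R axis i 1) = 0"
    by (simp add: inner_diff_right inner_axis)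
  then show ?thesis unfolding Rot_eq_D[OF assms(2)] using D_radial[OF assms] False by blast
qed (simp add: Rot_at_0)

lemma Rot_radial_mult:
  assumes "radial w" "smooth_on (- {0}) w" "u differentiable (at x)"
  shows "Rot i j (\<lambda>x. w x * u x) x = w x * Rot i j u x"
proof (cases "x = 0")
  case False
  then have "w differentiable (at x)" using smooth_on_differentiable[OF assms(2)] by simp
  then show ?thesis using Rot_radial[OF assms(1)] assms(3) by (subst Rot_mult) simp_all
qed (simp add: Rot_at_0)

text \<open>Rotation fields are divergence free: the terms from differentiating the coefficients
  \<open>x $ i\<close> and \<open>x $ j\<close> cancel, also when \<open>i = j\<close>.\<close>

lemma integral_Rot_lborel:
  assumes "u \<in> test_functions 0"
  shows "(\<integral>x. Rot i j u x \<partial>lborel) = 0"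
proof -
  have t: "(\<lambda>x. x $ k * u x) \<in> test_functions 0" for k
    by (intro test_functions_weight smooth_on_component assms) auto
  have "Rot i j u x = pd j (\<lambda>x. x $ i * u x) x - pd i (\<lambda>x. x $ j * u x) x" for x
    using test_functions_differentiable[OF assms] by (simp add: pd_component_mult Rot_def)
  moreover have "(\<integral>x. pd l (\<lambda>x. x $ k * u x) x \<partial>lborel) = 0" for k l
    by (intro integral_directional_derivative smooth_on_imp_Ck_on test_functions_smooth[OF t] test_functions_bounded_supp[OF t])
  moreover have "integrable lborel (\<lambda>x. pd l (\<lambda>x. x $ k * u x) x)" for k l
    by (intro test_functions_integrable[of _ 0] test_functions_D t) auto
  ultimately show ?thesis by simp
qed

text \<open>The density \<open>1 / ht\<close> is itself radial, so it joins the weight and both pass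
  through the rotation.\<close>

lemma hyp_integral_Rot:
  assumes "radial w" "smooth_on (- {0}) w" "u \<in> test_functions 0"
  shows "(\<integral>x. w x * Rot i j u x \<partial>hyp_volume) = 0"
proof -
  have r: "radial (\<lambda>x. w x / ht x)" using assms(1) unfolding radial_def by metis
  have s: "smooth_on (- {0}) (\<lambda>x. w x / ht x)"
    by (intro smooth_on_divide assms smooth_on_ht ht_pos) auto
  have "(\<integral>x. w x * Rot i j u x \<partial>hyp_volume) = (\<integral>x. w x * Rot i j u x / ht x \<partial>lborel)"
    by (intro hyp_integral_test[of _ 0] test_functions_weight assms test_functions_Rot)
  also have "\<dots> = (\<integral>x. Rot i j (\<lambda>x. w x / ht x * u x) x \<partial>lborel)"
    by (subst Rot_radial_mult[OF r s test_functions_differentiable[OF assms(3)]]) simp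
  also have "\<dots> = 0"
    by (intro integral_Rot_lborel test_functions_weight s assms)
  finally show ?thesis .
qed

lemma hyp_integral_Rot_by_parts:
  assumes "radial w" "smooth_on (- {0}) w" "u \<in> test_functions 0" "v \<in> test_functions 0"
  shows "(\<integral>x. w x * (Rot i j u x * v x) \<partial>hyp_volume) = - (\<integral>x. w x * (u x * Rot i j v x) \<partial>hyp_volume)"
proof -
  have "(\<integral>x. w x * (Rot i j u x * v x) \<partial>hyp_volume) + (\<integral>x. w x * (u x * Rot i j v x) \<partial>hyp_volume) =
      (\<integral>x. w x * (Rot i j u x * v x) + w x * (u x * Rot i j v x) \<partial>hyp_volume)"
    by (intro Bochner_Integration.integral_add[symmetric] hyp_integrable_test[of _ 0] test_functions_weight assms
        test_functions_mult test_functions_Rot)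
  also have "\<dots> = (\<integral>x. w x * Rot i j (\<lambda>x. u x * v x) x \<partial>hyp_volume)"
    by (simp add: Rot_mult test_functions_differentiable[OF assms(3)] test_functions_differentiable[OF assms(4)] algebra_simps)
  also have "\<dots> = 0"
    by (intro hyp_integral_Rot assms test_functions_mult)
  finally show ?thesis by simp
qed

text \<open>The integrand is the divergence of \<open>g x *\<^sub>R x\<close>; differentiating the
  factor \<open>x\<close> contributes the dimension.\<close>

theorem integral_euler:
  fixes g :: "real ^ 'n \<Rightarrow> real"
  assumes g: "g \<in> test_functions 0"
  shows "(\<integral>x. D g x x + real CARD('n) * g x \<partial>lborel) = 0"
proof -
  have t: "(\<lambda>x. x $ i * g x) \<in> test_functions 0" for i
    by (intro test_functions_weight smooth_on_component g) auto
  have "D g x x + real CARD('n) * g x = (\<Sum>i\<in>UNIV. pd i (\<lambda>x. x $ i * g x) x)" for x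
    using test_functions_differentiable[OF g]
    by (subst frechet_derivative_componentwise[of g]) (simp_all add: pd_component_mult sum.distrib)
  then have "(\<integral>x. D g x x + real CARD('n) * g x \<partial>lborel) = (\<integral>x. (\<Sum>i\<in>UNIV. pd i (\<lambda>x. x $ i * g x) x) \<partial>lborel)"
    by simp
  also have "\<dots> = (\<Sum>i\<in>UNIV. \<integral>x. pd i (\<lambda>x. x $ i * g x) x \<partial>lborel)"
    by (intro Bochner_Integration.integral_sum test_functions_integrable[of _ 0] test_functions_D t) auto
  also have "\<dots> = 0"
    by (intro sum.neutral ballI integral_directional_derivative smooth_on_imp_Ck_on test_functions_smooth[OF t]
        test_functions_bounded_supp[OF t])
  finally show ?thesis .
qed

text \<open>The field \<open>\<partial>\<^sub>r\<close> times the density is \<open>x / norm x\<close>.\<close>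

theorem hyp_integral_radial:
  fixes w :: "real ^ 'n \<Rightarrow> real"
  assumes w: "w \<in> test_functions 0"
  shows "(\<integral>x. rd w x + (real CARD('n) - 1) * coth (hyp_dist 0 x) * w x \<partial>hyp_volume) = 0"
proof -
  \<comment> \<open>With this \<open>g\<close>, the field \<open>g x *\<^sub>R x\<close> is
    \<open>w x\<close> times the density times the radial unit field.\<close>
  define g where "g x = inverse (norm x) * w x" for x
  have s: "smooth_on (- {0}) (\<lambda>x :: real ^ 'n. inverse (norm x))"
    unfolding inverse_eq_divide by (intro smooth_on_divide smooth_on_const smooth_on_norm) auto
  have g: "g \<in> test_functions 0"
    unfolding g_def by (intro test_functions_weight s w)
  have c: "smooth_on (- {0}) (\<lambda>x :: real ^ 'n. (real CARD('n) - 1) * coth (hyp_dist 0 x))"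
    unfolding coth_hyp_dist_0 by (intro smooth_on_mult smooth_on_const smooth_on_divide smooth_on_ht smooth_on_norm) auto
  have "(\<integral>x. rd w x + (real CARD('n) - 1) * coth (hyp_dist 0 x) * w x \<partial>hyp_volume) =
      (\<integral>x. (rd w x + (real CARD('n) - 1) * coth (hyp_dist 0 x) * w x) / ht x \<partial>lborel)"
    by (intro hyp_integral_test[of _ 0] test_functions_add test_functions_rd test_functions_weight[OF c] w)
  also have "\<dots> = (\<integral>x. D g x x + real CARD('n) * g x \<partial>lborel)"
  proof (intro Bochner_Integration.integral_cong refl)
    fix x
    show "(rd w x + (real CARD('n) - 1) * coth (hyp_dist 0 x) * w x) / ht x =
        D g x x + real CARD('n) * g x"
    proof (cases "x = 0")
      case True
      then show ?thesis
        using test_functions_eq_0_at_pole[OF w] test_functions_eq_0_at_pole[OF g]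
          linear_0[OF linear_frechet_derivative[OF test_functions_differentiable[OF g]]]
        by (simp add: radial_deriv_at_0)
    next
      case False
      have "(norm has_derivative (\<lambda>h. h \<bullet> sgn x)) (at x)"
        by (rule has_derivative_norm[OF False])
      from DERIV_compose_FDERIV[OF DERIV_inverse this]
      have i: "((\<lambda>x. inverse (norm x)) has_derivative (\<lambda>h. (h \<bullet> sgn x) * - (inverse (norm x) ^ Suc (Suc 0)))) (at x)"
        using False by simp
      have "x \<bullet> sgn x = norm x"
        using False by (simp add: sgn_div_norm power2_eq_square flip: power2_norm_eq_inner)
      then have Di: "D (\<lambda>x. inverse (norm x)) x x = - inverse (norm x)"
        unfolding frechet_derivative_at[OF i, symmetric] using False by (simp add: field_simps)
      have "(\<lambda>x :: real ^ 'n. inverse (norm x)) differentiable (at x)"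
        using i differentiable_def by blast
      then have "D g x x = inverse (norm x) * D w x x + D (\<lambda>x. inverse (norm x)) x x * w x"
        using test_functions_differentiable[OF w] unfolding g_def by (intro D_mult)
      then have Dg: "D g x x = (D w x x - w x) / norm x"
        unfolding Di by (simp add: divide_inverse algebra_simps)
      have "D g x x + real CARD('n) * g x = (rd w x + (real CARD('n) - 1) * coth (hyp_dist 0 x) * w x) / ht x"
        using False ht_nz[of x]
        unfolding Dg radial_deriv_eq[OF test_functions_differentiable[OF w]] coth_hyp_dist_0 g_def
        by (simp add: field_simps)
      then show ?thesis by simp
    qed
  qed
  also have "\<dots> = 0"
    by (rule integral_euler[OF g])
  finally show ?thesis .
qed

section \<open>Commutation relations of the rotation fields\<close>

lemma D_add:
  "f differentiable (at x) \<Longrightarrow> g differentiable (at x) \<Longrightarrow>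
    D (\<lambda>y. f y + g y) x v = D f x v + D g x v"
  using frechet_derivative_at[OF has_derivative_add[of f "D f x" "at x" g "D g x"]]
  by (auto simp: frechet_derivative_works dest!: fun_cong[of _ _ v])

lemma D_uminus: "f differentiable (at x) \<Longrightarrow> D (\<lambda>y. - f y) x v = - D f x v"
  using frechet_derivative_at[OF has_derivative_minus[of f "D f x" "at x"]]
  by (auto simp: frechet_derivative_works dest!: fun_cong[of _ _ v])

lemma D_diff:
  "f differentiable (at x) \<Longrightarrow> g differentiable (at x) \<Longrightarrow>
    D (\<lambda>y. f y - g y) x v = D f x v - D g x v"
  using frechet_derivative_at[OF has_derivative_diff[of f "D f x" "at x" g "D g x"]]
  by (auto simp: frechet_derivative_works dest!: fun_cong[of _ _ v])

lemma D_sum: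
  "(\<And>i. i \<in> I \<Longrightarrow> f i differentiable (at x)) \<Longrightarrow>
    D (\<lambda>y. \<Sum>i\<in>I. f i y) x v = (\<Sum>i\<in>I. D (f i) x v)"
  using frechet_derivative_at[OF has_derivative_sum[of I f "\<lambda>i. D (f i) x" "at x"]]
  by (auto simp: frechet_derivative_works dest!: fun_cong[of _ _ v])

lemma Rot_add:
  "f differentiable (at x) \<Longrightarrow> g differentiable (at x) \<Longrightarrow>
    Rot i j (\<lambda>y. f y + g y) x = Rot i j f x + Rot i j g x"
  by (simp add: Rot_def D_add algebra_simps)

lemma Rot_diff:
  "f differentiable (at x) \<Longrightarrow> g differentiable (at x) \<Longrightarrow>
    Rot i j (\<lambda>y. f y - g y) x = Rot i j f x - Rot i j g x"
  by (simp add: Rot_def D_diff algebra_simps)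

lemma Rot_sum:
  "(\<And>k. k \<in> K \<Longrightarrow> f k differentiable (at x)) \<Longrightarrow>
    Rot i j (\<lambda>y. \<Sum>k\<in>K. f k y) x = (\<Sum>k\<in>K. Rot i j (f k) x)"
  by (simp add: Rot_def D_sum sum_subtractf sum_distrib_left)

lemma Rot_cmult: "f differentiable (at x) \<Longrightarrow> Rot i j (\<lambda>y. c * f y) x = c * Rot i j f x"
  by (simp add: Rot_def D_mult algebra_simps)

lemma Rot_swap: "Rot j i u = (\<lambda>x. - Rot i j u x)"
  by (auto simp: Rot_def)

lemma Rot_uminus: "f differentiable (at x) \<Longrightarrow> Rot i j (\<lambda>y. - f y) x = - Rot i j f x"
  by (simp add: Rot_def D_uminus algebra_simps)

lemma test_functions_pd [intro]: "u \<in> test_functions p \<Longrightarrow> pd i u \<in> test_functions p"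
  by (intro test_functions_D) auto

lemma pd_commute:
  assumes "u \<in> test_functions p"
  shows "pd i (pd j u) x = pd j (pd i u) x"
  by (intro second_derivative_symmetric smooth_on_imp_Ck_on test_functions_smooth[OF assms])

lemma pd_Rot:
  assumes "u \<in> test_functions p"
  shows "pd m (Rot k l u) x = x $ k * pd m (pd l u) x + (if k = m then 1 else 0) * pd l u x
    - x $ l * pd m (pd k u) x - (if l = m then 1 else 0) * pd k u x"
proof -
  have d: "pd i u differentiable (at x)" for i
    using test_functions_differentiable[OF test_functions_pd[OF assms]] .
  have "(\<lambda>x. x $ k * pd l u x) differentiable (at x)" for k l
    by (intro differentiable_mult differentiable_component d)
  then show ?thesis
    unfolding Rot_def [abs_def] by (subst D_diff) (auto simp: pd_component_mult d)
qed

lemma pd_euler: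
  assumes "u \<in> test_functions p"
  shows "pd j (\<lambda>x. D u x x) x = pd j u x + (\<Sum>k\<in>UNIV. x $ k * pd j (pd k u) x)"
proof -
  have d: "pd i u differentiable (at x)" for i
    using test_functions_differentiable[OF test_functions_pd[OF assms]] .
  have 1: "(\<lambda>x. D u x x) = (\<lambda>x. \<Sum>k\<in>UNIV. x $ k * pd k u x)"
    by (rule ext, rule frechet_derivative_componentwise, rule test_functions_differentiable[OF assms])
  have "(\<lambda>x. x $ k * pd l u x) differentiable (at x)" for k l
    by (intro differentiable_mult differentiable_component d)
  then show ?thesis
    unfolding 1 by (subst D_sum) (auto simp: pd_component_mult d sum.distrib if_distrib[of "\<lambda>c. c * _"] cong: if_cong)
qed

text \<open>Dilations commute with rotations: the first order terms match, and the second order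
  terms agree by symmetry of second derivatives.\<close>

lemma Rot_euler:
  assumes "u \<in> test_functions 0"
  shows "Rot i j (\<lambda>x. D u x x) x = D (Rot i j u) x x"
proof -
  have c: "pd m (pd a u) x = pd a (pd m u) x" for m a by (rule pd_commute[OF assms])
  have "D (Rot i j u) x x = (\<Sum>m\<in>UNIV. x $ m * pd m (Rot i j u) x)"
    by (rule frechet_derivative_componentwise, rule test_functions_differentiable, rule test_functions_Rot[OF assms])
  also have "\<dots> = (\<Sum>m\<in>UNIV. x $ i * (x $ m * pd j (pd m u) x) - x $ j * (x $ m * pd i (pd m u) x)
      + (if m = i then x $ i * pd j u x else 0) - (if m = j then x $ j * pd i u x else 0))"
    unfolding pd_Rot[OF assms] c[of _ i] c[of _ j]
    by (intro sum.cong refl) (auto simp: algebra_simps)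
  also have "\<dots> = Rot i j (\<lambda>x. D u x x) x"
    unfolding Rot_def pd_euler[OF assms]
    by (simp add: sum.distrib sum_subtractf sum_distrib_left algebra_simps)
  finally show ?thesis by simp
qed

text \<open>The factor \<open>ht x / norm x\<close> between \<open>rd\<close> and the Euler field is
  radial, so the commutation with the Euler field is enough.\<close>

lemma Rot_rd:
  assumes "u \<in> test_functions 0"
  shows "Rot i j (rd u) x = rd (Rot i j u) x"
proof -
  have r: "radial (\<lambda>x :: real ^ 'a. ht x / norm x)" unfolding radial_def by simp
  have s: "smooth_on (- {0}) (\<lambda>x :: real ^ 'a. ht x / norm x)"
    by (intro smooth_on_divide smooth_on_ht smooth_on_norm) auto
  have E: "(\<lambda>x. D u x x) \<in> test_functions 0"
    by (intro test_functions_D assms) auto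
  have "rd u = (\<lambda>x. ht x / norm x * D u x x)"
    using radial_deriv_eq[OF test_functions_differentiable[OF assms]] by auto
  then show ?thesis
    unfolding radial_deriv_eq[OF test_functions_differentiable[OF test_functions_Rot[OF assms]]]
    by (simp only: Rot_radial_mult[OF r s test_functions_differentiable[OF E]] Rot_euler[OF assms])
qed

lemma Rot_Rot:
  assumes "u \<in> test_functions 0"
  shows "Rot i j (Rot k l u) x = x $ i * pd j (Rot k l u) x - x $ j * pd i (Rot k l u) x"
  by (simp add: Rot_def[of i j])

text \<open>The structure relations of the Lie algebra of rotations; the second order terms cancel
  by symmetry of second derivatives.\<close>

lemma Rot_commutator:
  assumes u: "u \<in> test_functions 0"
  shows "Rot i j (Rot k l u) x = Rot k l (Rot i j u) x
    + ((if j = k then 1 else 0) * Rot i l u x - (if i = k then 1 else 0) * Rot j l u x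
     - (if j = l then 1 else 0) * Rot i k u x + (if i = l then 1 else 0) * Rot j k u x)"
proof -
  have c: "pd a (pd b u) x = pd b (pd a u) x" for a b by (rule pd_commute[OF u])
  have 1: "x $ i * (x $ k * pd j (pd l u) x) = x $ k * (x $ i * pd l (pd j u) x)"
    "x $ i * (x $ l * pd j (pd k u) x) = x $ l * (x $ i * pd k (pd j u) x)"
    "x $ j * (x $ k * pd i (pd l u) x) = x $ k * (x $ j * pd l (pd i u) x)"
    "x $ j * (x $ l * pd i (pd k u) x) = x $ l * (x $ j * pd k (pd i u) x)"
    using c[of j l] c[of j k] c[of i l] c[of i k] by simp_all
  show ?thesis
    unfolding Rot_Rot[OF u] pd_Rot[OF u] right_diff_distrib distrib_left 1
    unfolding Rot_def
    by (cases "j = k"; cases "i = k"; cases "j = l"; cases "i = l") (simp_all add: algebra_simps)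
qed

text \<open>The Laplacian of the unit sphere, as the Casimir sum of the rotations. Each coordinate
  plane occurs twice in the double sum, hence the division by 2.\<close>

definition Ang :: "(real ^ 'n \<Rightarrow> real) \<Rightarrow> real ^ 'n \<Rightarrow> real" where
  "Ang u x = (\<Sum>i\<in>UNIV. \<Sum>j\<in>UNIV. Rot i j (Rot i j u) x) / 2"

text \<open>The polarised squared gradient of the unit sphere, that is, the density of the Dirichlet
  form of \<open>Ang\<close>.\<close>

definition Gam :: "(real ^ 'n \<Rightarrow> real) \<Rightarrow> (real ^ 'n \<Rightarrow> real) \<Rightarrow> real ^ 'n \<Rightarrow> real" where
  "Gam u v x = (\<Sum>i\<in>UNIV. \<Sum>j\<in>UNIV. Rot i j u x * Rot i j v x) / 2"

lemma test_functions_Ang [intro]: "u \<in> test_functions 0 \<Longrightarrow> Ang u \<in> test_functions 0"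
  unfolding Ang_def [abs_def] divide_inverse mult.commute[of _ "inverse 2"]
  by (intro test_functions_cmult test_functions_sum test_functions_Rot)

lemma test_functions_Gam [intro]:
  "u \<in> test_functions 0 \<Longrightarrow> v \<in> test_functions 0 \<Longrightarrow> Gam u v \<in> test_functions 0"
  unfolding Gam_def [abs_def] divide_inverse mult.commute[of _ "inverse 2"]
  by (intro test_functions_cmult test_functions_sum test_functions_mult test_functions_Rot)

text \<open>A Casimir operator commutes with its Lie algebra: summed over all pairs, the commutators
  \<open>K\<close> cancel by antisymmetry of \<open>Rot\<close> in its two indices.\<close>

lemma Ang_Rot:
  fixes u :: "real ^ 'n \<Rightarrow> real"
  assumes u: "u \<in> test_functions 0"
  shows "Ang (Rot k l u) x = Rot k l (Ang u) x"
proof -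
  let ?\<delta> = "\<lambda>a b :: 'n. if a = b then 1 else 0 :: real"
  define K where "K i j f x = ?\<delta> j k * Rot i l f x - ?\<delta> i k * Rot j l f x - ?\<delta> j l * Rot i k f x + ?\<delta> i l * Rot j k f x"
    for i j and f :: "real ^ 'n \<Rightarrow> real" and x
  have t: "Rot a b (Rot c d u) \<in> test_functions 0" "Rot a b u \<in> test_functions 0" for a b c d
    using u by auto
  note d = test_functions_differentiable[OF t(1)] test_functions_differentiable[OF t(2)]
  have K: "K i j u \<in> test_functions 0" for i j
    unfolding K_def [abs_def] by (intro test_functions_diff test_functions_add test_functions_cmult t)
  have comm: "Rot i j (Rot k l f) = (\<lambda>x. Rot k l (Rot i j f) x + K i j f x)" if "f \<in> test_functions 0" for i j f
    unfolding K_def by (intro ext Rot_commutator that)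
  have 1: "Rot i j (Rot i j (Rot k l u)) x = Rot k l (Rot i j (Rot i j u)) x + (K i j (Rot i j u) x + Rot i j (K i j u) x)" for i j
    unfolding comm[OF u, of i j]
    by (subst Rot_add) (simp_all add: d test_functions_differentiable[OF K] comm[OF t(2)])
  have 2: "Rot i j (K i j u) x = ?\<delta> j k * Rot i j (Rot i l u) x - ?\<delta> i k * Rot i j (Rot j l u) x
      - ?\<delta> j l * Rot i j (Rot i k u) x + ?\<delta> i l * Rot i j (Rot j k u) x" for i j
  proof -
    have dc: "(\<lambda>x. c * Rot a b u x) differentiable (at x)" for c a b
      by (intro test_functions_differentiable[of _ 0] test_functions_cmult t)
    show ?thesis unfolding K_def [abs_def]
      by (simp only: Rot_add Rot_diff Rot_cmult dc d differentiable_add differentiable_diff)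
  qed
  have 3: "Rot a b (Rot c d u) x = - Rot a b (Rot d c u) x" for a b c d
    unfolding Rot_swap[of c d] by (rule Rot_uminus[OF d(2)])
  have 4: "Rot a b (Rot c d u) x = - Rot b a (Rot c d u) x" for a b c d
    unfolding Rot_swap[of b a] by simp
  have s: "(\<Sum>i\<in>UNIV. \<Sum>j\<in>UNIV. ?\<delta> j m * f i j) = (\<Sum>i\<in>UNIV. f i m)"
    "(\<Sum>i\<in>UNIV. \<Sum>j\<in>UNIV. ?\<delta> i m * f i j) = (\<Sum>j\<in>UNIV. f m j)" for m :: 'n and f
    by (simp_all add: if_distrib[of "\<lambda>c. c * _"] cong: if_cong) (subst sum.swap, simp)
  have "(\<Sum>i\<in>UNIV. \<Sum>j\<in>UNIV. K i j (Rot i j u) x) = (\<Sum>i\<in>UNIV. Rot i l (Rot i k u) x) - (\<Sum>j\<in>UNIV. Rot j l (Rot k j u) x)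
      - (\<Sum>i\<in>UNIV. Rot i k (Rot i l u) x) + (\<Sum>j\<in>UNIV. Rot j k (Rot l j u) x)"
    unfolding K_def sum.distrib sum_subtractf s ..
  moreover have "(\<Sum>i\<in>UNIV. \<Sum>j\<in>UNIV. Rot i j (K i j u) x) = (\<Sum>i\<in>UNIV. Rot i k (Rot i l u) x) - (\<Sum>j\<in>UNIV. Rot k j (Rot j l u) x)
      - (\<Sum>i\<in>UNIV. Rot i l (Rot i k u) x) + (\<Sum>j\<in>UNIV. Rot l j (Rot j k u) x)"
    unfolding 2 sum.distrib sum_subtractf s ..
  ultimately have "(\<Sum>i\<in>UNIV. \<Sum>j\<in>UNIV. K i j (Rot i j u) x + Rot i j (K i j u) x) = 0"
    unfolding 3[of _ _ k] 3[of _ _ l] 4[of k] 4[of l] sum.distrib sum_negf by simp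
  then have "(\<Sum>i\<in>UNIV. \<Sum>j\<in>UNIV. Rot i j (Rot i j (Rot k l u)) x) = (\<Sum>i\<in>UNIV. \<Sum>j\<in>UNIV. Rot k l (Rot i j (Rot i j u)) x)"
    unfolding 1 sum.distrib by simp
  also have "\<dots> = Rot k l (\<lambda>x. \<Sum>i\<in>UNIV. \<Sum>j\<in>UNIV. Rot i j (Rot i j u) x) x"
    by (simp add: Rot_sum d test_functions_differentiable[OF test_functions_sum[OF t(1)]])
  finally show ?thesis
    unfolding Ang_def [abs_def] divide_inverse mult.commute[of _ "inverse 2"]
    by (subst Rot_cmult) (auto intro!: test_functions_differentiable[of _ 0] test_functions_sum t(1))
qed

text \<open>The Cauchy-Binet identity for the inner product of two bivectors; summing over ordered
  index pairs gives the factor 2.\<close>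

lemma wedge_inner:
  fixes a b c d :: "real ^ 'n"
  shows "(\<Sum>k\<in>UNIV. \<Sum>l\<in>UNIV. (a $ k * b $ l - a $ l * b $ k) * (c $ k * d $ l - c $ l * d $ k)) =
    2 * ((a \<bullet> c) * (b \<bullet> d) - (a \<bullet> d) * (b \<bullet> c))"
proof -
  have p: "(\<Sum>k\<in>UNIV. \<Sum>l\<in>UNIV. (p $ k * q $ k) * (r $ l * s $ l)) = (p \<bullet> q) * (r \<bullet> s)" for p q r s :: "real ^ 'n"
    by (simp add: inner_vec_def sum_product)
  have "(\<Sum>k\<in>UNIV. \<Sum>l\<in>UNIV. (a $ k * b $ l - a $ l * b $ k) * (c $ k * d $ l - c $ l * d $ k)) =
      (\<Sum>k\<in>UNIV. \<Sum>l\<in>UNIV. (a $ k * c $ k) * (b $ l * d $ l)) - (\<Sum>k\<in>UNIV. \<Sum>l\<in>UNIV. (a $ k * d $ k) * (b $ l * c $ l))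
     - (\<Sum>k\<in>UNIV. \<Sum>l\<in>UNIV. (b $ k * c $ k) * (a $ l * d $ l)) + (\<Sum>k\<in>UNIV. \<Sum>l\<in>UNIV. (b $ k * d $ k) * (a $ l * c $ l))"
    unfolding sum_subtractf[symmetric] sum.distrib[symmetric]
    by (intro sum.cong refl) (simp add: algebra_simps)
  then show ?thesis unfolding p by (simp add: algebra_simps)
qed

text \<open>The numbers \<open>Rot i j u x\<close> are the components of the bivector spanned by
  \<open>x\<close> and the Euclidean gradient.\<close>

lemma Gam_eq:
  assumes "u differentiable (at x)" "v differentiable (at x)"
  shows "Gam u v x = (x \<bullet> x) * (grad u x \<bullet> grad v x) - D u x x * D v x x"
proof -
  have R: "Rot i j f x = x $ i * grad f x $ j - x $ j * grad f x $ i" for i j f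
    by (simp add: Rot_def grad_def)
  show ?thesis
    unfolding Gam_def R wedge_inner D_eq_inner_grad[OF assms(1)] D_eq_inner_grad[OF assms(2)]
    by (simp add: inner_commute[of x "grad u x"] inner_commute[of x "grad v x"])
qed

text \<open>The metric in polar coordinates, polarised. The rank one part of the inverse metric
  \<open>I + x x^T\<close> and the Euler part that \<open>Gam\<close> removes from the Euclidean
  gradients together make up \<open>rd u x * rd v x\<close>.\<close>

lemma D_hyp_grad_polar:
  assumes "u differentiable (at x)" "v differentiable (at x)" "x \<noteq> 0"
  shows "D v x (hyp_grad u x) = rd u x * rd v x + Gam u v x / (norm x)\<^sup>2"
proof -
  have n: "(norm x)\<^sup>2 = x \<bullet> x" "x \<bullet> x \<noteq> 0" using assms(3) by (simp_all add: power2_norm_eq_inner)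
  have "rd u x * rd v x = ((ht x)\<^sup>2 * (D u x x * D v x x)) / (norm x)\<^sup>2"
    by (simp add: radial_deriv_eq assms power2_eq_square)
  also have "\<dots> = ((1 + x \<bullet> x) * (D u x x * D v x x)) / (x \<bullet> x)"
    unfolding ht_square by (simp only: n)
  finally have "rd u x * rd v x + Gam u v x / (norm x)\<^sup>2 =
      ((1 + x \<bullet> x) * (D u x x * D v x x) + ((x \<bullet> x) * (grad u x \<bullet> grad v x) - D u x x * D v x x)) / (x \<bullet> x)"
    unfolding Gam_eq[OF assms(1,2)] n by (simp add: add_divide_distrib)
  also have "\<dots> = grad u x \<bullet> grad v x + D u x x * D v x x"
    using n(2) by (simp add: field_simps)
  also have "\<dots> = D v x (hyp_grad u x)"
    unfolding D_eq_inner_grad[OF assms(1)] D_eq_inner_grad[OF assms(2)] hyp_grad_eq[OF assms(1)]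
    by (simp add: inner_add_right inner_commute)
  finally show ?thesis by simp
qed

lemma hyp_grad_sq_polar:
  assumes "u differentiable (at x)" "x \<noteq> 0"
  shows "hyp_grad_sq u x = (rd u x)\<^sup>2 + Gam u u x / (norm x)\<^sup>2"
  unfolding hyp_grad_sq_def hyp_metric_grad[OF assms(1)] D_hyp_grad_polar[OF assms(1,1,2)]
  by (simp add: power2_eq_square)

lemma hyp_grad_sq_at_pole:
  assumes "u \<in> test_functions 0"
  shows "hyp_grad_sq u 0 = 0"
  unfolding hyp_grad_sq_def hyp_metric_grad[OF test_functions_differentiable[OF assms]]
proof -
  have "(\<lambda>x. D u x v) \<in> test_functions 0" for v by (intro test_functions_D assms) auto
  from test_functions_eq_0_at_pole[OF this] show "D u 0 (hyp_grad u 0) = 0" .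
qed

section \<open>The Bochner inequality on spheres\<close>

text \<open>Let \<open>P\<close> be the projection orthogonal to \<open>x\<close>, of rank
  \<open>N - 1\<close>. Up to the factor \<open>|x|^4\<close> the claim bounds the squared trace of
  \<open>P H P\<close>, divided by \<open>N - 1\<close>, by the squared norm of
  \<open>P H P\<close>; the difference is the squared norm of the trace-free part.\<close>

lemma symmetric_traceless_inequality:
  fixes H :: "'n::finite \<Rightarrow> real ^ 'n" and x :: "real ^ 'n"
  assumes sym: "\<And>m l. H m $ l = H l $ m" and x: "x \<noteq> 0" and card: "CARD('n) \<ge> 2"
  defines "y \<equiv> \<Sum>m\<in>UNIV. x $ m *\<^sub>R H m"
  shows "((x \<bullet> x) * (\<Sum>m\<in>UNIV. H m $ m) - x \<bullet> y)\<^sup>2 / (real CARD('n) - 1) \<le>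
    (x \<bullet> x)\<^sup>2 * (\<Sum>m\<in>UNIV. H m \<bullet> H m) - 2 * (x \<bullet> x) * (y \<bullet> y) + (x \<bullet> y)\<^sup>2"
proof -
  define N where "N = real CARD('n)"
  define \<sigma> \<kappa> tr where "\<sigma> = x \<bullet> x" and "\<kappa> = x \<bullet> y" and "tr = (\<Sum>m\<in>UNIV. H m $ m)"
  define \<mu> where "\<mu> = (\<sigma> * tr - \<kappa>) / (N - 1)"
  have N: "N - 1 > 0" using card by (simp add: N_def)
  have \<sigma>: "\<sigma> > 0" using x by (simp add: \<sigma>_def)
  have ym: "H m \<bullet> x = y $ m" for m
    unfolding y_def by (simp add: inner_vec_def sym[of m] mult.commute)
  define z where "z = y - ((\<kappa> + \<mu>) / \<sigma>) *\<^sub>R x"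
  \<comment> \<open>The vectors \<open>\<sigma> *\<^sub>R H m - Q m\<close> are the rows of
    \<open>\<sigma> P H P - \<mu> P\<close>, which is trace free by the choice of
    \<open>\<mu>\<close>.\<close>
  define Q where "Q m = y $ m *\<^sub>R x + x $ m *\<^sub>R z + \<mu> *\<^sub>R axis m 1" for m
  have dot: "(\<Sum>m\<in>UNIV. a $ m * b $ m) = a \<bullet> b" for a b :: "real ^ 'n"
    by (simp add: inner_vec_def)
  have xz: "x \<bullet> z = - \<mu>"
    using \<sigma> by (simp add: z_def inner_diff_right \<sigma>_def[symmetric] \<kappa>_def[symmetric])
  have yz: "\<sigma> * (y \<bullet> z) = \<sigma> * (y \<bullet> y) - (\<kappa> + \<mu>) * \<kappa>"
  proof -
    have "y \<bullet> z = y \<bullet> y - ((\<kappa> + \<mu>) / \<sigma>) * \<kappa>"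
      by (simp add: z_def inner_diff_right inner_commute[of y x] \<kappa>_def)
    then show ?thesis using \<sigma> by (simp add: right_diff_distrib)
  qed
  have zz: "\<sigma> * (z \<bullet> z) = \<sigma> * (y \<bullet> y) - 2 * (\<kappa> + \<mu>) * \<kappa> + (\<kappa> + \<mu>)\<^sup>2"
  proof -
    have "z \<bullet> z = y \<bullet> z - ((\<kappa> + \<mu>) / \<sigma>) * (x \<bullet> z)"
      by (subst (1) z_def) (simp add: inner_diff_left)
    then have "\<sigma> * (z \<bullet> z) = \<sigma> * (y \<bullet> z) - (\<kappa> + \<mu>) * (x \<bullet> z)"
      using \<sigma> by (simp add: field_simps)
    then show ?thesis unfolding yz xz by (simp add: power2_eq_square algebra_simps)
  qed
  have HQ: "(\<Sum>m\<in>UNIV. H m \<bullet> Q m) = y \<bullet> y + y \<bullet> z + \<mu> * tr"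
  proof -
    have "H m \<bullet> Q m = y $ m * y $ m + x $ m * (H m \<bullet> z) + \<mu> * H m $ m" for m
      by (simp add: Q_def inner_add_right ym inner_axis)
    moreover have "(\<Sum>m\<in>UNIV. x $ m * (H m \<bullet> z)) = y \<bullet> z"
      by (simp add: y_def inner_sum_left)
    ultimately show ?thesis
      by (simp add: sum.distrib dot tr_def sum_distrib_left)
  qed
  have QQ: "(\<Sum>m\<in>UNIV. Q m \<bullet> Q m) =
      \<sigma> * (y \<bullet> y) + \<sigma> * (z \<bullet> z) + N * \<mu>\<^sup>2 + 2 * \<kappa> * (x \<bullet> z) + 2 * \<mu> * \<kappa> + 2 * \<mu> * (x \<bullet> z)"
  proof -
    have "Q m \<bullet> Q m = \<sigma> * (y $ m * y $ m) + (z \<bullet> z) * (x $ m * x $ m) + \<mu>\<^sup>2 +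
        2 * (x \<bullet> z) * (x $ m * y $ m) + 2 * \<mu> * (x $ m * y $ m) + 2 * \<mu> * (x $ m * z $ m)" for m
      by (simp add: Q_def \<sigma>_def inner_add_right inner_add_left inner_axis inner_axis' inner_axis_axis inner_commute[of z x]
          power2_eq_square algebra_simps)
    then show ?thesis
      by (simp add: sum.distrib sum_distrib_left[symmetric] dot N_def \<sigma>_def \<kappa>_def)
  qed
  have sq: "(\<sigma> *\<^sub>R a - q) \<bullet> (\<sigma> *\<^sub>R a - q) = \<sigma>\<^sup>2 * (a \<bullet> a) - 2 * \<sigma> * (a \<bullet> q) + q \<bullet> q" for a q :: "real ^ 'n"
    by (simp add: inner_diff_left inner_diff_right inner_commute[of q a] power2_eq_square algebra_simps)
  have "0 \<le> (\<Sum>m\<in>UNIV. (\<sigma> *\<^sub>R H m - Q m) \<bullet> (\<sigma> *\<^sub>R H m - Q m))"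
    by (intro sum_nonneg inner_ge_zero)
  also have "\<dots> = \<sigma>\<^sup>2 * (\<Sum>m\<in>UNIV. H m \<bullet> H m) - 2 * \<sigma> * (\<Sum>m\<in>UNIV. H m \<bullet> Q m) + (\<Sum>m\<in>UNIV. Q m \<bullet> Q m)"
    unfolding sq by (simp add: sum.distrib sum_subtractf sum_distrib_left)
  also have "\<dots> = \<sigma>\<^sup>2 * (\<Sum>m\<in>UNIV. H m \<bullet> H m) - 2 * (\<sigma> * (y \<bullet> y)) - 2 * (\<sigma> * (y \<bullet> z)) - 2 * \<sigma> * \<mu> * tr
      + (\<sigma> * (y \<bullet> y) + \<sigma> * (z \<bullet> z) + N * \<mu>\<^sup>2 + 2 * \<kappa> * (x \<bullet> z) + 2 * \<mu> * \<kappa> + 2 * \<mu> * (x \<bullet> z))"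
    unfolding HQ QQ by (simp add: algebra_simps)
  also have "\<dots> = \<sigma>\<^sup>2 * (\<Sum>m\<in>UNIV. H m \<bullet> H m) - 2 * \<sigma> * (y \<bullet> y) + \<kappa>\<^sup>2 + (N - 1) * \<mu>\<^sup>2 - 2 * \<mu> * (\<sigma> * tr - \<kappa>)"
    unfolding yz zz xz by (simp add: power2_eq_square algebra_simps)
  finally have "0 \<le> \<sigma>\<^sup>2 * (\<Sum>m\<in>UNIV. H m \<bullet> H m) - 2 * \<sigma> * (y \<bullet> y) + \<kappa>\<^sup>2 + (N - 1) * \<mu>\<^sup>2 - 2 * \<mu> * (\<sigma> * tr - \<kappa>)" .
  moreover have "(N - 1) * \<mu>\<^sup>2 - 2 * \<mu> * (\<sigma> * tr - \<kappa>) = - ((\<sigma> * tr - \<kappa>)\<^sup>2 / (N - 1))"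
    using N by (simp add: \<mu>_def power2_eq_square)
  ultimately have "(\<sigma> * tr - \<kappa>)\<^sup>2 / (N - 1) \<le> \<sigma>\<^sup>2 * (\<Sum>m\<in>UNIV. H m \<bullet> H m) - 2 * \<sigma> * (y \<bullet> y) + \<kappa>\<^sup>2"
    by linarith
  then show ?thesis
    unfolding \<sigma>_def \<kappa>_def tr_def N_def .
qed

text \<open>The right side equals the squared norm of the spherical Hessian plus
  \<open>(N - 2) Gam u u\<close>, where \<open>N - 2\<close> is the Ricci curvature of the unit
  sphere. \<open>Ang u\<close> is the trace of that Hessian, so the trace inequality in dimension
  \<open>N - 1\<close> applies.\<close>

lemma bochner_pointwise:
  fixes u :: "real ^ 'n \<Rightarrow> real"
  assumes u: "u \<in> test_functions 0" and x: "x \<noteq> 0" and card: "CARD('n) \<ge> 2"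
  shows "(Ang u x)\<^sup>2 / (real CARD('n) - 1) + (real CARD('n) - 2) * Gam u u x \<le>
    (\<Sum>k\<in>UNIV. \<Sum>l\<in>UNIV. Gam (Rot k l u) (Rot k l u) x) / 2"
proof -
  define N where "N = real CARD('n)"
  have N: "N - 1 > 0" using card by (simp add: N_def)
  define g where "g = grad u x"
  define H where "H m = (\<chi> l. pd m (pd l u) x)" for m
  define y where "y = (\<Sum>m\<in>UNIV. x $ m *\<^sub>R H m)"
  define \<sigma> \<kappa> tr \<gamma> where "\<sigma> = x \<bullet> x" and "\<kappa> = x \<bullet> y" and "tr = (\<Sum>m\<in>UNIV. H m $ m)" and "\<gamma> = g \<bullet> x"
  have sym: "H m $ l = H l $ m" for m l
    unfolding H_def by (simp add: pd_commute[OF u, where i = m and j = l])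
  have ym: "x \<bullet> H m = y $ m" for m
    unfolding y_def by (simp add: inner_vec_def sym[of m])
  have dot: "(\<Sum>m\<in>UNIV. a $ m * b $ m) = a \<bullet> b" for a b :: "real ^ 'n"
    by (simp add: inner_vec_def)
  have xH: "(\<Sum>m\<in>UNIV. x $ m * (a \<bullet> H m)) = a \<bullet> y" for a
    by (simp add: y_def inner_sum_right)
  \<comment> \<open>The Euclidean derivatives of \<open>Rot k l u\<close> as a sum of two bivectors:
    the first comes from differentiating the coefficients, the second from the row
    \<open>H m\<close> of the Hessian.\<close>
  define W where "W m k l = (axis m 1 $ k * g $ l - axis m 1 $ l * g $ k) + (x $ k * H m $ l - x $ l * H m $ k)"
    for m k l
  have W: "pd m (Rot k l u) x = W m k l" for m k l
    unfolding pd_Rot[OF u] W_def g_def grad_def H_def by (simp add: axis_def)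
  have dR: "Rot k l u differentiable (at x)" for k l
    by (rule test_functions_differentiable, rule test_functions_Rot[OF u])
  have DR: "D (Rot k l u) x x = x $ k * (g + y) $ l - x $ l * (g + y) $ k" for k l
  proof -
    have "D (Rot k l u) x x = (\<Sum>m\<in>UNIV. x $ m * W m k l)"
      unfolding W[symmetric] by (rule frechet_derivative_componentwise[OF dR])
    also have "\<dots> = (\<Sum>m\<in>UNIV. x $ m * axis m 1 $ k) * g $ l - (\<Sum>m\<in>UNIV. x $ m * axis m 1 $ l) * g $ k
        + x $ k * (\<Sum>m\<in>UNIV. x $ m * H m $ l) - x $ l * (\<Sum>m\<in>UNIV. x $ m * H m $ k)"
      unfolding W_def by (simp add: sum.distrib sum_subtractf sum_distrib_left sum_distrib_right algebra_simps)
    also have "\<dots> = x $ k * g $ l - x $ l * g $ k + x $ k * y $ l - x $ l * y $ k"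
    proof -
      have "(\<Sum>m\<in>UNIV. x $ m * axis m 1 $ k) = x $ k" for k
        by (simp add: axis_def if_distrib[of "\<lambda>c. _ * c"] cong: if_cong)
      moreover have "(\<Sum>m\<in>UNIV. x $ m * H m $ l) = y $ l" for l
        by (simp add: y_def)
      ultimately show ?thesis by simp
    qed
    finally show ?thesis by (simp add: algebra_simps)
  qed
  have GR: "Gam (Rot k l u) (Rot k l u) x = \<sigma> * (\<Sum>m\<in>UNIV. (W m k l)\<^sup>2)
      - (x $ k * (g + y) $ l - x $ l * (g + y) $ k) * (x $ k * (g + y) $ l - x $ l * (g + y) $ k)" for k l
  proof -
    have "grad (Rot k l u) x \<bullet> grad (Rot k l u) x = (\<Sum>m\<in>UNIV. (W m k l)\<^sup>2)"
      unfolding inner_vec_def by (simp add: grad_def W power2_eq_square)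
    then show ?thesis unfolding Gam_eq[OF dR dR] DR \<sigma>_def by simp
  qed
  have WW: "(\<Sum>k\<in>UNIV. \<Sum>l\<in>UNIV. (W m k l)\<^sup>2) = 2 * (g \<bullet> g - (g $ m * g $ m)
      + 2 * (x $ m * (g \<bullet> H m) - H m $ m * \<gamma>) + (\<sigma> * (H m \<bullet> H m) - y $ m * y $ m))" for m
  proof -
    let ?a = "\<lambda>k l. axis m 1 $ k * g $ l - axis m 1 $ l * g $ k"
    let ?b = "\<lambda>k l. x $ k * H m $ l - x $ l * H m $ k"
    have "(\<Sum>k\<in>UNIV. \<Sum>l\<in>UNIV. (W m k l)\<^sup>2) = (\<Sum>k\<in>UNIV. \<Sum>l\<in>UNIV. ?a k l * ?a k l)
        + 2 * (\<Sum>k\<in>UNIV. \<Sum>l\<in>UNIV. ?a k l * ?b k l) + (\<Sum>k\<in>UNIV. \<Sum>l\<in>UNIV. ?b k l * ?b k l)"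
      unfolding W_def sum_distrib_left sum.distrib[symmetric]
      by (intro sum.cong refl) (simp add: power2_eq_square algebra_simps)
    then show ?thesis
      unfolding wedge_inner
      by (simp add: inner_axis inner_axis' inner_axis_axis ym inner_commute[of "H m" x] \<sigma>_def \<gamma>_def)
  qed
  have "(\<Sum>k\<in>UNIV. \<Sum>l\<in>UNIV. Gam (Rot k l u) (Rot k l u) x) =
      \<sigma> * (\<Sum>m\<in>UNIV. \<Sum>k\<in>UNIV. \<Sum>l\<in>UNIV. (W m k l)\<^sup>2) - 2 * (\<sigma> * ((g + y) \<bullet> (g + y)) - (x \<bullet> (g + y)) * ((g + y) \<bullet> x))"
  proof -
    have "(\<Sum>k\<in>UNIV. \<Sum>l\<in>UNIV. \<sigma> * (\<Sum>m\<in>UNIV. (W m k l)\<^sup>2)) = \<sigma> * (\<Sum>k\<in>UNIV. \<Sum>m\<in>UNIV. \<Sum>l\<in>UNIV. (W m k l)\<^sup>2)"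
      unfolding sum_distrib_left by (subst sum.swap) (rule refl)
    also have "(\<Sum>k\<in>UNIV. \<Sum>m\<in>UNIV. \<Sum>l\<in>UNIV. (W m k l)\<^sup>2) = (\<Sum>m\<in>UNIV. \<Sum>k\<in>UNIV. \<Sum>l\<in>UNIV. (W m k l)\<^sup>2)"
      by (rule sum.swap)
    finally show ?thesis
      unfolding GR sum_subtractf wedge_inner \<sigma>_def by simp
  qed
  also have "(\<Sum>m\<in>UNIV. \<Sum>k\<in>UNIV. \<Sum>l\<in>UNIV. (W m k l)\<^sup>2) =
      2 * (N * (g \<bullet> g) - g \<bullet> g + 2 * (g \<bullet> y - tr * \<gamma>) + (\<sigma> * (\<Sum>m\<in>UNIV. H m \<bullet> H m) - y \<bullet> y))"
    unfolding WW sum_distrib_left[symmetric] sum.distrib sum_subtractf dot xH sum_distrib_right[symmetric] tr_def N_def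
    by simp
  finally have B: "(\<Sum>k\<in>UNIV. \<Sum>l\<in>UNIV. Gam (Rot k l u) (Rot k l u) x) / 2 =
      \<sigma> * (N * (g \<bullet> g) - g \<bullet> g + 2 * (g \<bullet> y - tr * \<gamma>) + (\<sigma> * (\<Sum>m\<in>UNIV. H m \<bullet> H m) - y \<bullet> y))
      - (\<sigma> * (g \<bullet> g + 2 * (g \<bullet> y) + y \<bullet> y) - (\<gamma> + \<kappa>)\<^sup>2)"
    by (simp add: inner_add_left inner_add_right inner_commute[of x g] inner_commute[of y g] inner_commute[of y x]
        \<gamma>_def[symmetric] \<kappa>_def[symmetric] power2_eq_square algebra_simps)
  have A: "Ang u x = \<sigma> * tr - \<kappa> - (N - 1) * \<gamma>"
  proof -
    have RR: "Rot i j (Rot i j u) x = x $ i * W j i j - x $ j * W i i j" for i j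
      unfolding Rot_def[of i j "Rot i j u"] W ..
    have swap: "W i i j = - W i j i" for i j
      by (simp add: W_def)
    have "(\<Sum>i\<in>UNIV. \<Sum>j\<in>UNIV. x $ i * W j i j) = (\<Sum>i\<in>UNIV. \<Sum>j\<in>UNIV.
        (if i = j then x $ i * g $ j else 0) - x $ i * g $ i + (x $ i * x $ i) * H j $ j - x $ j * (H j $ i * x $ i))"
      unfolding W_def by (intro sum.cong refl) (auto simp: axis_def algebra_simps)
    also have "\<dots> = x \<bullet> g - N * (x \<bullet> g) + \<sigma> * tr - (\<Sum>i\<in>UNIV. \<Sum>j\<in>UNIV. x $ j * (H j $ i * x $ i))"
      by (simp add: sum.distrib sum_subtractf dot sum_distrib_left[symmetric] sum_distrib_right[symmetric] N_def \<sigma>_def tr_def)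
    also have "(\<Sum>i\<in>UNIV. \<Sum>j\<in>UNIV. x $ j * (H j $ i * x $ i)) = \<kappa>"
      unfolding \<kappa>_def xH[symmetric] by (subst sum.swap) (simp add: inner_vec_def sum_distrib_left mult_ac)
    finally have S: "(\<Sum>i\<in>UNIV. \<Sum>j\<in>UNIV. x $ i * W j i j) = \<sigma> * tr - \<kappa> - (N - 1) * \<gamma>"
      by (simp add: \<gamma>_def inner_commute[of g x] algebra_simps)
    have "(\<Sum>i\<in>UNIV. \<Sum>j\<in>UNIV. x $ j * W i i j) = - (\<Sum>i\<in>UNIV. \<Sum>j\<in>UNIV. x $ j * W i j i)"
      unfolding swap by (simp add: sum_negf)
    also have "(\<Sum>i\<in>UNIV. \<Sum>j\<in>UNIV. x $ j * W i j i) = (\<Sum>i\<in>UNIV. \<Sum>j\<in>UNIV. x $ i * W j i j)"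
      by (rule sum.swap)
    finally show ?thesis
      unfolding Ang_def RR sum_subtractf S by simp
  qed
  have G: "Gam u u x = \<sigma> * (g \<bullet> g) - \<gamma>\<^sup>2"
    unfolding Gam_eq[OF test_functions_differentiable[OF u] test_functions_differentiable[OF u]]
      D_eq_inner_grad[OF test_functions_differentiable[OF u]]
    by (simp add: \<sigma>_def g_def \<gamma>_def power2_eq_square)
  define \<tau> where "\<tau> = \<sigma> * tr - \<kappa>"
  define \<Xi> where "\<Xi> = \<sigma>\<^sup>2 * (\<Sum>m\<in>UNIV. H m \<bullet> H m) - 2 * \<sigma> * (y \<bullet> y) + \<kappa>\<^sup>2"
  have \<Xi>: "\<tau>\<^sup>2 / (N - 1) \<le> \<Xi>"
    using symmetric_traceless_inequality[OF sym x card]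
    unfolding \<tau>_def \<Xi>_def \<sigma>_def \<kappa>_def tr_def N_def y_def .
  \<comment> \<open>The last parenthesis is the squared norm of the spherical Hessian
    \<open>\<sigma> P H P - \<gamma> P\<close>, where \<open>P\<close> projects orthogonally to
    \<open>x\<close>; the part with \<open>\<gamma>\<close> reflects the curvature of the sphere in
    the ambient space.\<close>
  have "(\<Sum>k\<in>UNIV. \<Sum>l\<in>UNIV. Gam (Rot k l u) (Rot k l u) x) / 2 =
      (N - 2) * Gam u u x + ((N - 1) * \<gamma>\<^sup>2 - 2 * \<gamma> * \<tau> + \<Xi>)"
    unfolding B G \<tau>_def \<Xi>_def by (simp add: power2_eq_square algebra_simps)
  moreover have "(Ang u x)\<^sup>2 / (N - 1) = \<tau>\<^sup>2 / (N - 1) - 2 * \<gamma> * \<tau> + (N - 1) * \<gamma>\<^sup>2"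
  proof -
    have "(\<tau> - (N - 1) * \<gamma>)\<^sup>2 = \<tau>\<^sup>2 + (N - 1) * (- 2 * \<gamma> * \<tau> + (N - 1) * \<gamma>\<^sup>2)"
      by (simp add: power2_eq_square algebra_simps)
    then show ?thesis using N unfolding A \<tau>_def[symmetric] by (simp add: add_divide_distrib)
  qed
  ultimately show ?thesis using \<Xi> unfolding N_def by linarith
qed

text \<open>Green's formula on the spheres, one rotation at a time; a radial weight is a constant
  for each of them.\<close>

lemma Ang_by_parts:
  assumes w: "radial w" "smooth_on (- {0}) w" and u: "u \<in> test_functions 0" and v: "v \<in> test_functions 0"
  shows "(\<integral>x. w x * (Ang u x * v x) \<partial>hyp_volume) = - (\<integral>x. w x * Gam u v x \<partial>hyp_volume)"
proof -
  have t1: "(\<lambda>x. w x * (Rot i j (Rot i j u) x * v x)) \<in> test_functions 0" for i j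
    by (intro test_functions_weight w test_functions_mult test_functions_Rot u v)
  have t2: "(\<lambda>x. w x * (Rot i j u x * Rot i j v x)) \<in> test_functions 0" for i j
    by (intro test_functions_weight w test_functions_mult test_functions_Rot u v)
  have "(\<integral>x. w x * (Ang u x * v x) \<partial>hyp_volume) =
      (\<integral>x. (\<Sum>i\<in>UNIV. \<Sum>j\<in>UNIV. w x * (Rot i j (Rot i j u) x * v x)) / 2 \<partial>hyp_volume)"
    by (simp add: Ang_def sum_distrib_left sum_distrib_right)
  also have "\<dots> = (\<Sum>i\<in>UNIV. \<Sum>j\<in>UNIV. \<integral>x. w x * (Rot i j (Rot i j u) x * v x) \<partial>hyp_volume) / 2"
    by (simp add: hyp_integrable_test[OF t1])
  also have "\<dots> = - ((\<Sum>i\<in>UNIV. \<Sum>j\<in>UNIV. \<integral>x. w x * (Rot i j u x * Rot i j v x) \<partial>hyp_volume) / 2)"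
    unfolding hyp_integral_Rot_by_parts[OF w test_functions_Rot[OF u] v] by (simp add: sum_negf)
  also have "(\<Sum>i\<in>UNIV. \<Sum>j\<in>UNIV. \<integral>x. w x * (Rot i j u x * Rot i j v x) \<partial>hyp_volume) / 2 =
      (\<integral>x. (\<Sum>i\<in>UNIV. \<Sum>j\<in>UNIV. w x * (Rot i j u x * Rot i j v x)) / 2 \<partial>hyp_volume)"
    by (simp add: hyp_integrable_test[OF t2])
  also have "\<dots> = (\<integral>x. w x * Gam u v x \<partial>hyp_volume)"
    by (simp add: Gam_def sum_distrib_left sum_distrib_right)
  finally show ?thesis .
qed

lemma hyp_integral_mono:
  assumes "f \<in> test_functions p" "g \<in> test_functions p" "\<And>x. x \<noteq> p \<Longrightarrow> f x \<le> g x"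
  shows "(\<integral>x. f x \<partial>hyp_volume) \<le> (\<integral>x. g x \<partial>hyp_volume)"
proof (rule integral_mono[OF hyp_integrable_test[OF assms(1)] hyp_integrable_test[OF assms(2)]])
  show "f x \<le> g x" for x
    using assms(3) test_functions_eq_0_at_pole[OF assms(1)] test_functions_eq_0_at_pole[OF assms(2)]
    by (cases "x = p") auto
qed

text \<open>Lichnerowicz's argument: integration by parts and \<open>Ang_Rot\<close> turn the
  integral of \<open>(Ang u)^2\<close> into half the sum of the energies of all
  \<open>Rot k l u\<close>, to which the pointwise bound applies. The constant is the first nonzero
  eigenvalue of the sphere.\<close>

theorem bochner_inequality:
  fixes u :: "real ^ 'n \<Rightarrow> real"
  assumes w: "radial w" "smooth_on (- {0}) w" "\<And>x. w x \<ge> 0" and u: "u \<in> test_functions 0"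
    and card: "CARD('n) \<ge> 3"
  shows "(real CARD('n) - 1) * (\<integral>x. w x * Gam u u x \<partial>hyp_volume) \<le> (\<integral>x. w x * (Ang u x)\<^sup>2 \<partial>hyp_volume)"
proof -
  define N where "N = real CARD('n)"
  have N: "N - 2 > 0" using card by (simp add: N_def)
  have tG: "(\<lambda>x. w x * Gam f g x) \<in> test_functions 0" if "f \<in> test_functions 0" "g \<in> test_functions 0" for f g
    by (intro test_functions_weight w test_functions_Gam that)
  have tR: "(\<lambda>x. w x * (Rot k l u x * Rot k l (Ang u) x)) \<in> test_functions 0" for k l
    by (intro test_functions_weight w test_functions_mult test_functions_Rot test_functions_Ang u)
  have tA: "(\<lambda>x. w x * (Ang u x)\<^sup>2) \<in> test_functions 0"
    by (intro test_functions_weight w test_functions_power2 test_functions_Ang u)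
  let ?B = "\<lambda>x. \<Sum>k\<in>UNIV. \<Sum>l\<in>UNIV. w x * Gam (Rot k l u) (Rot k l u) x"
  have "(\<integral>x. w x * (Ang u x)\<^sup>2 \<partial>hyp_volume) = - (\<integral>x. w x * Gam u (Ang u) x \<partial>hyp_volume)"
    unfolding power2_eq_square by (rule Ang_by_parts[OF w(1,2) u test_functions_Ang[OF u]])
  also have "(\<integral>x. w x * Gam u (Ang u) x \<partial>hyp_volume) =
      (\<integral>x. (\<Sum>k\<in>UNIV. \<Sum>l\<in>UNIV. w x * (Rot k l u x * Rot k l (Ang u) x)) / 2 \<partial>hyp_volume)"
    by (simp add: Gam_def sum_distrib_left sum_distrib_right)
  also have "\<dots> = (\<Sum>k\<in>UNIV. \<Sum>l\<in>UNIV. \<integral>x. w x * (Rot k l u x * Rot k l (Ang u) x) \<partial>hyp_volume) / 2"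
    by (simp add: hyp_integrable_test[OF tR])
  also have "\<dots> = (\<Sum>k\<in>UNIV. \<Sum>l\<in>UNIV. \<integral>x. w x * (Ang (Rot k l u) x * Rot k l u x) \<partial>hyp_volume) / 2"
    by (simp add: Ang_Rot[OF u] mult.commute[of "Rot _ _ u _"])
  also have "\<dots> = - ((\<Sum>k\<in>UNIV. \<Sum>l\<in>UNIV. \<integral>x. w x * Gam (Rot k l u) (Rot k l u) x \<partial>hyp_volume) / 2)"
    unfolding Ang_by_parts[OF w(1,2) test_functions_Rot[OF u] test_functions_Rot[OF u]] by (simp add: sum_negf)
  also have "(\<Sum>k\<in>UNIV. \<Sum>l\<in>UNIV. \<integral>x. w x * Gam (Rot k l u) (Rot k l u) x \<partial>hyp_volume) / 2 =
      (\<integral>x. 1 / 2 * ?B x \<partial>hyp_volume)"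
    by (simp add: hyp_integrable_test[OF tG[OF test_functions_Rot[OF u] test_functions_Rot[OF u]]])
  finally have *: "(\<integral>x. w x * (Ang u x)\<^sup>2 \<partial>hyp_volume) = (\<integral>x. 1 / 2 * ?B x \<partial>hyp_volume)" by simp
  have "(\<integral>x. 1 / (N - 1) * (w x * (Ang u x)\<^sup>2) + (N - 2) * (w x * Gam u u x) \<partial>hyp_volume) \<le> (\<integral>x. 1 / 2 * ?B x \<partial>hyp_volume)"
  proof (rule hyp_integral_mono[of _ 0])
    fix x :: "real ^ 'n" assume "x \<noteq> 0"
    have "w x * ((Ang u x)\<^sup>2 / (N - 1) + (N - 2) * Gam u u x) \<le>
        w x * ((\<Sum>k\<in>UNIV. \<Sum>l\<in>UNIV. Gam (Rot k l u) (Rot k l u) x) / 2)"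
      using bochner_pointwise[OF u \<open>x \<noteq> 0\<close>] card w(3) unfolding N_def by (intro mult_left_mono) auto
    moreover have "w x * ((\<Sum>k\<in>UNIV. \<Sum>l\<in>UNIV. Gam (Rot k l u) (Rot k l u) x) / 2) = 1 / 2 * ?B x"
      by (simp add: sum_distrib_left[symmetric])
    moreover have "w x * ((Ang u x)\<^sup>2 / (N - 1) + (N - 2) * Gam u u x) =
        1 / (N - 1) * (w x * (Ang u x)\<^sup>2) + (N - 2) * (w x * Gam u u x)"
      by (simp add: algebra_simps)
    ultimately show "1 / (N - 1) * (w x * (Ang u x)\<^sup>2) + (N - 2) * (w x * Gam u u x) \<le> 1 / 2 * ?B x"
      by simp
  qed (intro test_functions_add test_functions_cmult test_functions_sum tA tG test_functions_Rot u)+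
  also have "(\<integral>x. 1 / (N - 1) * (w x * (Ang u x)\<^sup>2) + (N - 2) * (w x * Gam u u x) \<partial>hyp_volume) =
      1 / (N - 1) * (\<integral>x. w x * (Ang u x)\<^sup>2 \<partial>hyp_volume) + (N - 2) * (\<integral>x. w x * Gam u u x \<partial>hyp_volume)"
    by (simp add: hyp_integrable_test[OF tA] hyp_integrable_test[OF tG[OF u u]])
  finally have F1: "1 / (N - 1) * (\<integral>x. w x * (Ang u x)\<^sup>2 \<partial>hyp_volume) + (N - 2) * (\<integral>x. w x * Gam u u x \<partial>hyp_volume)
      \<le> (\<integral>x. w x * (Ang u x)\<^sup>2 \<partial>hyp_volume)" unfolding * .
  \<comment> \<open>The integral \<open>a\<close> of the squared spherical Laplacian stands on both
    sides; solving for it divides by \<open>N - 2\<close>, hence at least three dimensions.\<close>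
  have F2: "(N - 1) * b \<le> a" if "1 / (N - 1) * a + (N - 2) * b \<le> a" for a b
  proof -
    have "(N - 1) * (1 / (N - 1) * a + (N - 2) * b) \<le> (N - 1) * a"
      using that N by (intro mult_left_mono) auto
    moreover have "(N - 1) * (1 / (N - 1) * a) = a" using N by simp
    ultimately have "(N - 2) * ((N - 1) * b) \<le> (N - 2) * a" by (simp add: algebra_simps)
    then show ?thesis using N by simp
  qed
  show ?thesis using F2[OF F1] unfolding N_def .
qed

section \<open>The radial identity and the radial inequality\<close>

lemma smooth_on_coth_hyp_dist [intro]:
  "open S \<Longrightarrow> 0 \<notin> S \<Longrightarrow> smooth_on S (\<lambda>x. coth (hyp_dist 0 x))"
  unfolding coth_hyp_dist_0 by (intro smooth_on_divide smooth_on_ht smooth_on_norm) auto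

text \<open>The left side of \<open>le\<close> is the divergence of \<open>w\<close> times the
  radial unit field and integrates to zero.\<close>

lemma radial_ibp_le:
  fixes F w :: "real ^ 'n \<Rightarrow> real"
  assumes F: "F \<in> test_functions 0" and w: "w \<in> test_functions 0"
    and le: "\<And>x. x \<noteq> 0 \<Longrightarrow> rd w x + (real CARD('n) - 1) * coth (hyp_dist 0 x) * w x \<le> F x"
  shows "0 \<le> (\<integral>x. F x \<partial>hyp_volume)"
proof -
  have "smooth_on (- {0}) (\<lambda>x :: real ^ 'n. (real CARD('n) - 1) * coth (hyp_dist 0 x))"
    by (intro smooth_on_mult smooth_on_const smooth_on_coth_hyp_dist) auto
  then have "(\<lambda>x. rd w x + (real CARD('n) - 1) * coth (hyp_dist 0 x) * w x) \<in> test_functions 0"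
    by (intro test_functions_add test_functions_rd test_functions_weight w)
  from hyp_integral_mono[OF this F le] show ?thesis
    unfolding hyp_integral_radial[OF w] .
qed

lemma radial_ibp_eq:
  fixes F G w :: "real ^ 'n \<Rightarrow> real"
  assumes F: "F \<in> test_functions 0" and G: "G \<in> test_functions 0" and w: "w \<in> test_functions 0"
    and eq: "\<And>x. x \<noteq> 0 \<Longrightarrow> F x - G x = rd w x + (real CARD('n) - 1) * coth (hyp_dist 0 x) * w x"
  shows "(\<integral>x. F x \<partial>hyp_volume) = (\<integral>x. G x \<partial>hyp_volume)"
proof -
  have "F x - G x = rd w x + (real CARD('n) - 1) * coth (hyp_dist 0 x) * w x" for x
    using eq[of x] test_functions_eq_0_at_pole[OF F] test_functions_eq_0_at_pole[OF G]
      test_functions_eq_0_at_pole[OF w] by (cases "x = 0") (auto simp: radial_deriv_at_0)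
  then have "(\<integral>x. F x - G x \<partial>hyp_volume) = 0"
    using hyp_integral_radial[OF w] by simp
  then show ?thesis
    by (simp add: hyp_integrable_test[OF F] hyp_integrable_test[OF G])
qed

lemma radial_laplacian_0:
  fixes u :: "real ^ 'n \<Rightarrow> real"
  shows "radial_laplacian 0 u x = rd (rd u) x + (real CARD('n) - 1) * coth (hyp_dist 0 x) * rd u x"
  by (simp add: radial_laplacian_def)

lemma test_functions_radial_laplacian [intro]:
  fixes u :: "real ^ 'n \<Rightarrow> real"
  assumes "u \<in> test_functions 0"
  shows "radial_laplacian 0 u \<in> test_functions 0"
proof -
  have "smooth_on (- {0}) (\<lambda>x :: real ^ 'n. (real CARD('n) - 1) * coth (hyp_dist 0 x))"
    by (intro smooth_on_mult smooth_on_const smooth_on_coth_hyp_dist) auto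
  then show ?thesis
    unfolding radial_laplacian_0 [abs_def]
    by (intro test_functions_add test_functions_rd test_functions_weight assms)
qed

lemma has_derivative_coth: "r > 0 \<Longrightarrow> (coth has_real_derivative 1 - (coth r)\<^sup>2) (at r)"
  unfolding coth_def [abs_def]
  by (auto intro!: derivative_eq_intros simp: power2_eq_square field_simps)

text \<open>The weight in front is the inverse square of the factor \<open>a\<close> that multiplies
  \<open>f\<close>, so only the logarithmic derivative of \<open>a\<close> remains.\<close>

lemma weighted_radial_deriv_identity:
  fixes N :: nat
  assumes f: "f \<in> test_functions 0" and x: "x \<noteq> 0"
  shows "hyp_dist 0 x ^ N / sinh (hyp_dist 0 x) ^ (2 * (N - 1)) *
      (rd (\<lambda>y. sinh (hyp_dist 0 y) ^ (N - 1) * f y / hyp_dist 0 y powr (real N / 2)) x)\<^sup>2 =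
    (rd f x + (real (N - 1) * coth (hyp_dist 0 x) - real N / (2 * hyp_dist 0 x)) * f x)\<^sup>2"
proof -
  define r where "r = hyp_dist 0 x"
  define a where "a = sinh r ^ (N - 1) * r powr (- (real N / 2))"
  have r: "r > 0" and S: "sinh r > 0" unfolding r_def using hyp_dist_0_pos[OF x] by auto
  let ?\<phi> = "\<lambda>r. sinh r ^ (N - 1) * r powr (- (real N / 2))"
  let ?d = "a * (real (N - 1) * coth r - real N / (2 * r))"
  have d1: "((\<lambda>r. sinh r ^ (N - 1)) has_real_derivative real (N - 1) * coth r * sinh r ^ (N - 1)) (at r)"
  \<comment> \<open>The exponent may be 0, where the power is constant.\<close>
  proof (cases "N - 1")
    case (Suc m)
    have "((\<lambda>r. sinh r ^ Suc m) has_real_derivative real (Suc m) * (cosh r * sinh r ^ (Suc m - Suc 0))) (at r)"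
      by (rule DERIV_power) (auto intro!: derivative_eq_intros)
    then show ?thesis
      using S Suc by (simp add: coth_def)
  qed simp
  have d2: "((\<lambda>r. r powr (- (real N / 2))) has_real_derivative - (real N / 2) * r powr (- (real N / 2) - 1)) (at r)"
    by (rule has_real_derivative_powr[OF r])
  have "r powr (- (real N / 2) - 1) = r powr (- (real N / 2)) / r"
    using r by (simp only: powr_diff powr_one)
  then have "(?\<phi> has_real_derivative ?d) (at r)"
    using r by (intro DERIV_cong[OF DERIV_mult[OF d1 d2]]) (simp add: a_def field_simps)
  then have "((\<lambda>t. ?\<phi> (hyp_dist 0 (hyp_geodesic 0 x t))) has_real_derivative ?d) (at r)"
    unfolding r_def by (rule radial_weight_DERIV[OF x])
  from DERIV_mult[OF this radial_deriv_DERIV[OF x test_functions_differentiable[OF f], folded r_def]]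
  have "rd (\<lambda>y. ?\<phi> (hyp_dist 0 y) * f y) x = ?d * f x + rd f x * a"
    using x by (intro radial_deriv_eqI) (simp add: r_def a_def hyp_geodesic_hyp_dist)
  moreover have "(\<lambda>y. ?\<phi> (hyp_dist 0 y) * f y) = (\<lambda>y. sinh (hyp_dist 0 y) ^ (N - 1) * f y / hyp_dist 0 y powr (real N / 2))"
    by (auto simp: powr_minus field_simps)
  ultimately have 1: "rd (\<lambda>y. sinh (hyp_dist 0 y) ^ (N - 1) * f y / hyp_dist 0 y powr (real N / 2)) x =
      a * (rd f x + (real (N - 1) * coth r - real N / (2 * r)) * f x)"
    by (simp add: algebra_simps)
  have "(r powr (- (real N / 2)))\<^sup>2 = inverse (r ^ N)"
  proof -
    have "(r powr (- (real N / 2)))\<^sup>2 = r powr (- real N)"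
      by (simp add: power2_eq_square flip: powr_add)
    then show ?thesis using r by (simp add: powr_minus powr_realpow)
  qed
  then have "r ^ N / sinh r ^ (2 * (N - 1)) * a\<^sup>2 = 1"
    using r S by (simp add: a_def power_mult_distrib power_mult[symmetric] mult.commute[of _ 2] field_simps)
  then have "r ^ N / sinh r ^ (2 * (N - 1)) * (a * z)\<^sup>2 = z\<^sup>2" for z
    by (simp only: power_mult_distrib mult.assoc[symmetric] mult_1_left)
  then show ?thesis
    unfolding 1 r_def[symmetric] .
qed

theorem radial_identity:
  fixes u :: "real ^ 'n \<Rightarrow> real"
  assumes u: "u \<in> test_functions 0"
  defines "N \<equiv> real CARD('n)"
  shows "(\<integral>x. (radial_laplacian 0 u x)\<^sup>2 \<partial>hyp_volume) =
    (\<integral>x. (N / 2)\<^sup>2 * ((rd u x)\<^sup>2 / (hyp_dist 0 x)\<^sup>2)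
      + N * (N - 1) / 2 * ((hyp_dist 0 x * coth (hyp_dist 0 x) - 1) / (hyp_dist 0 x)\<^sup>2 * (rd u x)\<^sup>2)
      + (rd (rd u) x + ((N - 1) * coth (hyp_dist 0 x) - N / (2 * hyp_dist 0 x)) * rd u x)\<^sup>2 \<partial>hyp_volume)"
proof -
  define f where "f = rd u"
  have f: "f \<in> test_functions 0" unfolding f_def by (rule test_functions_rd[OF u])
  note fd = test_functions_differentiable[OF f]
  have pos: "hyp_dist 0 x > 0" if "x \<in> - {0}" for x :: "real ^ 'n" using hyp_dist_0_pos that by auto
  have si: "smooth_on (- {0}) (\<lambda>x :: real ^ 'n. c / (hyp_dist 0 x) ^ k)" for c k
    by (intro smooth_on_divide smooth_on_const smooth_on_power smooth_on_hyp_dist_0 zero_less_power pos) auto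
  have s1: "smooth_on (- {0}) (\<lambda>x :: real ^ 'n. N / 2 / hyp_dist 0 x)"
    by (intro smooth_on_divide smooth_on_const smooth_on_hyp_dist_0 pos) auto
  have s2: "smooth_on (- {0}) (\<lambda>x :: real ^ 'n. (hyp_dist 0 x * coth (hyp_dist 0 x) - 1) / (hyp_dist 0 x)\<^sup>2)"
    by (intro smooth_on_divide smooth_on_diff smooth_on_mult smooth_on_const smooth_on_power smooth_on_hyp_dist_0
        smooth_on_coth_hyp_dist zero_less_power pos) auto
  have s3: "smooth_on (- {0}) (\<lambda>x :: real ^ 'n. (N - 1) * coth (hyp_dist 0 x) - N / (2 * hyp_dist 0 x))"
    by (intro smooth_on_divide smooth_on_diff smooth_on_mult smooth_on_const smooth_on_hyp_dist_0
        smooth_on_coth_hyp_dist mult_pos_pos pos) auto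
  have w: "(\<lambda>x. N / 2 / hyp_dist 0 x * (f x)\<^sup>2) \<in> test_functions 0"
    by (intro test_functions_weight s1 test_functions_power2 f)
  have G1: "(\<lambda>x. (f x)\<^sup>2 / (hyp_dist 0 x)\<^sup>2) \<in> test_functions 0"
    using test_functions_weight[OF si[of 1 2] test_functions_power2[OF f]] by simp
  have G: "(\<lambda>x. (N / 2)\<^sup>2 * ((f x)\<^sup>2 / (hyp_dist 0 x)\<^sup>2)
      + N * (N - 1) / 2 * ((hyp_dist 0 x * coth (hyp_dist 0 x) - 1) / (hyp_dist 0 x)\<^sup>2 * (f x)\<^sup>2)
      + (rd f x + ((N - 1) * coth (hyp_dist 0 x) - N / (2 * hyp_dist 0 x)) * f x)\<^sup>2) \<in> test_functions 0"
    by (intro test_functions_add test_functions_cmult G1 test_functions_weight s2 s3 test_functions_power2 f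
        test_functions_rd)
  have "(\<integral>x. (radial_laplacian 0 u x)\<^sup>2 \<partial>hyp_volume) =
    (\<integral>x. (N / 2)\<^sup>2 * ((f x)\<^sup>2 / (hyp_dist 0 x)\<^sup>2)
      + N * (N - 1) / 2 * ((hyp_dist 0 x * coth (hyp_dist 0 x) - 1) / (hyp_dist 0 x)\<^sup>2 * (f x)\<^sup>2)
      + (rd f x + ((N - 1) * coth (hyp_dist 0 x) - N / (2 * hyp_dist 0 x)) * f x)\<^sup>2 \<partial>hyp_volume)"
  proof (rule radial_ibp_eq[OF _ G w])
    show "(\<lambda>x. (radial_laplacian 0 u x)\<^sup>2) \<in> test_functions 0"
      by (intro test_functions_power2 test_functions_radial_laplacian u)
    fix x :: "real ^ 'n" assume x: "x \<noteq> 0"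
    define r X where "r = hyp_dist 0 x" and "X = coth r"
    have r: "r > 0" unfolding r_def by (rule hyp_dist_0_pos[OF x])
    have "((\<lambda>t. N / 2 / t) has_real_derivative - N / (2 * r\<^sup>2)) (at r)"
      using r by (auto intro!: derivative_eq_intros simp: power2_eq_square field_simps)
    then have d1: "((\<lambda>t. N / 2 / hyp_dist 0 (hyp_geodesic 0 x t)) has_real_derivative - N / (2 * r\<^sup>2)) (at r)"
      unfolding r_def by (rule radial_weight_DERIV[OF x])
    have d2: "((\<lambda>t. (f (hyp_geodesic 0 x t))\<^sup>2) has_real_derivative 2 * f x * rd f x) (at r)"
      using DERIV_power[OF radial_deriv_DERIV[OF x fd], of 2] x
      by (simp add: r_def hyp_geodesic_hyp_dist mult_ac)
    have W: "rd (\<lambda>x. N / 2 / hyp_dist 0 x * (f x)\<^sup>2) x = - N / (2 * r\<^sup>2) * (f x)\<^sup>2 + 2 * f x * rd f x * (N / 2 / r)"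
      using DERIV_mult[OF d1 d2] x by (intro radial_deriv_eqI) (simp add: r_def hyp_geodesic_hyp_dist)
    \<comment> \<open>A polynomial identity with \<open>X = coth r\<close> and
      \<open>y = 1 / r\<close> as independent variables: the field contains only
      \<open>1 / r\<close>, so the derivative of \<open>coth\<close> does not enter.\<close>
    have alg: "(b + (N - 1) * X * a)\<^sup>2 - ((N / 2)\<^sup>2 * (a\<^sup>2 * (y * y)) + N * (N - 1) / 2 * ((X * y - y * y) * a\<^sup>2)
        + (b + ((N - 1) * X - N / 2 * y) * a)\<^sup>2) = - N / 2 * (y * y) * a\<^sup>2 + 2 * a * b * (N / 2 * y) + (N - 1) * X * (N / 2 * y * a\<^sup>2)"
      for a b y by (simp add: power2_eq_square field_simps)
    have "(r * X - 1) / r\<^sup>2 = X * (1 / r) - 1 / r * (1 / r)"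
      using r by (simp add: power2_eq_square field_simps)
    then show "(radial_laplacian 0 u x)\<^sup>2 - ((N / 2)\<^sup>2 * ((f x)\<^sup>2 / (hyp_dist 0 x)\<^sup>2)
      + N * (N - 1) / 2 * ((hyp_dist 0 x * coth (hyp_dist 0 x) - 1) / (hyp_dist 0 x)\<^sup>2 * (f x)\<^sup>2)
      + (rd f x + ((N - 1) * coth (hyp_dist 0 x) - N / (2 * hyp_dist 0 x)) * f x)\<^sup>2) =
      rd (\<lambda>x. N / 2 / hyp_dist 0 x * (f x)\<^sup>2) x
      + (real CARD('n) - 1) * coth (hyp_dist 0 x) * (N / 2 / hyp_dist 0 x * (f x)\<^sup>2)"
      unfolding W radial_laplacian_0 f_def[symmetric] r_def[symmetric] X_def[symmetric] N_def[symmetric]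
      using alg[of "rd f x" "f x" "1 / r"] by (simp add: power2_eq_square)
  qed
  then show ?thesis unfolding f_def .
qed

section \<open>The one-dimensional inequality for a rotation derivative\<close>

lemma coth_gt_inverse:
  assumes "r > 0"
  shows "coth r > 1 / r" "coth r > 1"
proof -
  have "(\<lambda>r. r * cosh r - sinh r) 0 < (\<lambda>r. r * cosh r - sinh r) r"
  proof (rule DERIV_pos_imp_increasing_open[OF assms])
    fix t :: real assume "0 < t" "t < r"
    then have "t * sinh t > 0" by simp
    moreover have "((\<lambda>r. r * cosh r - sinh r) has_real_derivative t * sinh t) (at t)"
      by (auto intro!: derivative_eq_intros)
    ultimately show "\<exists>y. ((\<lambda>r. r * cosh r - sinh r) has_real_derivative y) (at t) \<and> 0 < y" by blast
  qed (intro continuous_intros)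
  then show "coth r > 1 / r" using assms by (simp add: coth_def field_simps)
  show "coth r > 1"
    using assms cosh_minus_sinh[of r] by (simp add: coth_def field_simps)
qed

text \<open>\<open>X\<close> and \<open>y\<close> stand for \<open>coth r\<close> and
  \<open>1 / r\<close>, which agree to leading order at the pole. For \<open>X = y\<close> the
  regrouped remainder is \<open>(m - 1) (2 X^2 - 1)\<close> with \<open>m - 1 = (N - 5) / 2\<close>;
  the other terms carry a factor \<open>X - y\<close> or are bounded by completing a square.\<close>

lemma radial_remainder_nonneg:
  fixes N X y :: real
  assumes N: "N \<ge> 5" and X: "X \<ge> 1" and y: "0 < y" "y \<le> X"
  defines "p \<equiv> 3 / 2 * y - (N - 1) / 2 * X"
  shows "0 \<le> (N - 3) * (X\<^sup>2 - 1) + (2 * N - 6) * X\<^sup>2 - (N\<^sup>2 / 4 * y\<^sup>2 + N * (N - 1) / 2 * (X * y - y\<^sup>2))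
    - (- 3 / 2 * y\<^sup>2 - (N - 1) / 2 * (1 - X\<^sup>2)) - (N - 3) * X * p - p\<^sup>2"
proof -
  define m where "m = (N - 3) / 2"
  have m: "m \<ge> 1" using N by (simp add: m_def)
  \<comment> \<open>\<open>15 / 8\<close> is what completing the square in \<open>y\<close> leaves
    of the coefficient 5.\<close>
  have "15 / 8 * X\<^sup>2 - 1 \<ge> 0"
    using mult_mono[OF X X] X by (simp add: power2_eq_square)
  moreover have "5 * X\<^sup>2 - 1 - 5 * X * y + 2 * y\<^sup>2 = 2 * (y - 5 / 4 * X)\<^sup>2 + (15 / 8 * X\<^sup>2 - 1)"
    by (simp add: power2_eq_square field_simps)
  ultimately have q: "5 * X\<^sup>2 - 1 - 5 * X * y + 2 * y\<^sup>2 \<ge> 0"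
    using zero_le_power2[of "y - 5 / 4 * X"] by linarith
  have "(m\<^sup>2 - 1) * (X - y)\<^sup>2 \<ge> 0" using m by (intro mult_nonneg_nonneg) auto
  moreover have "(m - 1) * (5 * X\<^sup>2 - 1 - 5 * X * y + 2 * y\<^sup>2) \<ge> 0"
    using m q by (intro mult_nonneg_nonneg) auto
  moreover have "(X - y) * (4 * X - 3 * y) \<ge> 0"
    using y by (intro mult_nonneg_nonneg) auto
  moreover have "(N - 3) * (X\<^sup>2 - 1) + (2 * N - 6) * X\<^sup>2 - (N\<^sup>2 / 4 * y\<^sup>2 + N * (N - 1) / 2 * (X * y - y\<^sup>2))
    - (- 3 / 2 * y\<^sup>2 - (N - 1) / 2 * (1 - X\<^sup>2)) - (N - 3) * X * p - p\<^sup>2 =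
    (m\<^sup>2 - 1) * (X - y)\<^sup>2 + (m - 1) * (5 * X\<^sup>2 - 1 - 5 * X * y + 2 * y\<^sup>2) + (X - y) * (4 * X - 3 * y)"
    unfolding p_def m_def by (simp add: power2_eq_square field_simps)
  ultimately show ?thesis by linarith
qed

text \<open>
  The weight \<open>p\<close> is the logarithmic derivative of the supersolution
  \<open>r powr (3 / 2) * sinh r powr ((1 - N) / 2)\<close>; completing the square with it leaves the remainder above.
\<close>

theorem radial_inequality:
  fixes w :: "real ^ 'n \<Rightarrow> real"
  assumes w: "w \<in> test_functions 0" and card: "CARD('n) \<ge> 5"
  defines "N \<equiv> real CARD('n)"
  shows "0 \<le> (\<integral>x. (N - 1) / norm x ^ 4 * (w x)\<^sup>2 - 2 / (norm x)\<^sup>2 * (radial_laplacian 0 w x * w x)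
      - 1 / (norm x)\<^sup>2 * (rd w x)\<^sup>2
      - ((N / 2)\<^sup>2 / (hyp_dist 0 x)\<^sup>2 + N * (N - 1) / 2 * ((hyp_dist 0 x * coth (hyp_dist 0 x) - 1) / (hyp_dist 0 x)\<^sup>2))
        / (norm x)\<^sup>2 * (w x)\<^sup>2 \<partial>hyp_volume)"
proof -
  define p where "p r = 3 / 2 * (1 / r) - (N - 1) / 2 * coth r" for r
  have N: "N \<ge> 5" using card by (simp add: N_def)
  have pos: "hyp_dist 0 x > 0" if "x \<in> - {0}" for x :: "real ^ 'n" using hyp_dist_0_pos that by auto
  have npos: "norm x ^ k > 0" if "x \<in> - {0}" for x :: "real ^ 'n" and k using that by auto
  have sn: "smooth_on (- {0}) (\<lambda>x :: real ^ 'n. c / norm x ^ k)" for c k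
    by (intro smooth_on_divide smooth_on_const smooth_on_power smooth_on_norm npos) auto
  have sq: "smooth_on (- {0}) (\<lambda>x :: real ^ 'n. ((N / 2)\<^sup>2 / (hyp_dist 0 x)\<^sup>2 +
      N * (N - 1) / 2 * ((hyp_dist 0 x * coth (hyp_dist 0 x) - 1) / (hyp_dist 0 x)\<^sup>2)) / (norm x)\<^sup>2)"
    by (intro smooth_on_divide smooth_on_add smooth_on_diff smooth_on_mult smooth_on_const smooth_on_power
        smooth_on_hyp_dist_0 smooth_on_coth_hyp_dist smooth_on_norm zero_less_power pos) auto
  have sp: "smooth_on (- {0}) (\<lambda>x :: real ^ 'n. (p (hyp_dist 0 x) - 2 * coth (hyp_dist 0 x)) * (1 / (norm x)\<^sup>2))"
    unfolding p_def
    by (intro smooth_on_divide smooth_on_diff smooth_on_mult smooth_on_const smooth_on_power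
        smooth_on_hyp_dist_0 smooth_on_coth_hyp_dist smooth_on_norm zero_less_power pos) auto
  \<comment> \<open>The last summand integrates the product of \<open>w\<close> with its radial
    Laplacian by parts. The term \<open>- 2 coth\<close> comes from the derivative of
    \<open>1 / sinh^2\<close> and removes the mixed term left by this; \<open>p\<close> then
    completes the square.\<close>
  let ?W = "\<lambda>x. (p (hyp_dist 0 x) - 2 * coth (hyp_dist 0 x)) * (1 / (norm x)\<^sup>2) * (w x * w x) + (- 2) * (1 / (norm x)\<^sup>2 * (w x * rd w x))"
  show ?thesis
  proof (rule radial_ibp_le[where w = ?W])
    show "?W \<in> test_functions 0"
      by (intro test_functions_add test_functions_cmult test_functions_weight sp sn test_functions_mult w test_functions_rd)
    show "(\<lambda>x. (N - 1) / norm x ^ 4 * (w x)\<^sup>2 - 2 / (norm x)\<^sup>2 * (radial_laplacian 0 w x * w x)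
      - 1 / (norm x)\<^sup>2 * (rd w x)\<^sup>2
      - ((N / 2)\<^sup>2 / (hyp_dist 0 x)\<^sup>2 + N * (N - 1) / 2 * ((hyp_dist 0 x * coth (hyp_dist 0 x) - 1) / (hyp_dist 0 x)\<^sup>2))
        / (norm x)\<^sup>2 * (w x)\<^sup>2) \<in> test_functions 0"
      by (intro test_functions_diff test_functions_weight sq sn test_functions_mult test_functions_power2
          test_functions_radial_laplacian w test_functions_rd)
    fix x :: "real ^ 'n" assume x: "x \<noteq> 0"
    define r X y s where "r = hyp_dist 0 x" and "X = coth r" and "y = 1 / r" and "s = X\<^sup>2 - 1"
    define a b c where "a = w x" and "b = rd w x" and "c = rd (rd w) x"
    have r: "r > 0" unfolding r_def by (rule hyp_dist_0_pos[OF x])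
    have S: "sinh r > 0" using r by simp
    have sinh_norm: "sinh (hyp_dist 0 z) = norm z" for z :: "real ^ 'n" by (rule hyp_dist_0(2))
    have s_eq: "1 / (sinh t)\<^sup>2 = (coth t)\<^sup>2 - 1" if "t > 0" for t
      using that by (simp add: coth_def cosh_square_eq power_divide field_simps)
    have ns: "1 / (norm x)\<^sup>2 = s" using s_eq[OF r] unfolding s_def X_def r_def sinh_norm .
    have ns': "c / (norm x)\<^sup>2 = c * s" "c / norm x ^ 4 = c * s\<^sup>2" for c
      using x unfolding ns[symmetric] by (simp_all add: power_divide flip: power_mult)
    have X: "X > 1" "y < X" "y > 0" using coth_gt_inverse[OF r] r by (simp_all add: X_def y_def)
    have s: "s > 0" using X(1) by (simp add: s_def power2_eq_square) (smt (verit) mult_less_cancel_left1)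
    have pr: "p r = 3 / 2 * y - (N - 1) / 2 * X" by (simp add: p_def y_def X_def)
    have dX: "(coth has_real_derivative - s) (at r)"
      using has_derivative_coth[OF r] by (simp add: s_def X_def)
    have dp: "(p has_real_derivative (- 3 / 2 * y\<^sup>2 - (N - 1) / 2 * (1 - X\<^sup>2))) (at r)"
      unfolding p_def[abs_def] using r
      by (auto intro!: derivative_eq_intros dX simp: y_def s_def power2_eq_square field_simps)
    have ds: "((\<lambda>t. 1 / (sinh t)\<^sup>2) has_real_derivative - 2 * X * s) (at r)"
      using S unfolding s_eq[OF r, folded X_def, folded s_def, symmetric] X_def coth_def
      by (auto intro!: derivative_eq_intros simp: power2_eq_square field_simps)
    let ?\<gamma> = "hyp_geodesic 0 x"
    have g: "?\<gamma> r = x" unfolding r_def by (rule hyp_geodesic_hyp_dist[OF x])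
    have d1: "((\<lambda>t. p (hyp_dist 0 (?\<gamma> t)) - 2 * coth (hyp_dist 0 (?\<gamma> t))) has_real_derivative
        (- 3 / 2 * y\<^sup>2 - (N - 1) / 2 * (1 - X\<^sup>2)) - 2 * (- s)) (at r)"
      unfolding r_def
      by (rule radial_weight_DERIV[OF x, where \<phi> = "\<lambda>t. p t - 2 * coth t"], fold r_def)
        (intro DERIV_diff DERIV_cmult dp dX)
    have d2: "((\<lambda>t. 1 / (norm (?\<gamma> t))\<^sup>2) has_real_derivative - 2 * X * s) (at r)"
      using radial_weight_DERIV[OF x ds[unfolded r_def]] unfolding sinh_norm r_def .
    have d3: "((\<lambda>t. w (?\<gamma> t)) has_real_derivative b) (at r)" "((\<lambda>t. rd w (?\<gamma> t)) has_real_derivative c) (at r)"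
      unfolding b_def c_def r_def
      by (intro radial_deriv_DERIV x test_functions_differentiable[of _ 0] w test_functions_rd)+
    have "rd ?W x = ((- 3 / 2 * y\<^sup>2 - (N - 1) / 2 * (1 - X\<^sup>2)) - 2 * (- s)) * s * (a * a)
        + (p r - 2 * X) * (- 2 * X * s) * (a * a) + (p r - 2 * X) * s * (2 * a * b)
        + (- 2) * (- 2 * X * s * (a * b) + s * (b * b + a * c))"
      by (rule radial_deriv_eqI, fold r_def,
          rule DERIV_cong[OF DERIV_add[OF DERIV_mult[OF DERIV_mult[OF d1 d2] DERIV_mult[OF d3(1) d3(1)]]
            DERIV_cmult[OF DERIV_mult[OF d2 DERIV_mult[OF d3]]]]])
        (simp add: g ns r_def[symmetric] X_def[symmetric] a_def[symmetric] b_def[symmetric] algebra_simps)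
    moreover have "radial_laplacian 0 w x = c + (N - 1) * X * b"
      unfolding radial_laplacian_0 by (simp add: c_def b_def X_def r_def N_def)
    moreover have "(N / 2)\<^sup>2 / r\<^sup>2 + N * (N - 1) / 2 * ((r * X - 1) / r\<^sup>2) = N\<^sup>2 / 4 * y\<^sup>2 + N * (N - 1) / 2 * (X * y - y\<^sup>2)"
      using r by (simp add: y_def power2_eq_square field_simps)
    moreover have "0 \<le> s * ((b - p r * a)\<^sup>2 + a\<^sup>2 * ((N - 3) * (X\<^sup>2 - 1) + (2 * N - 6) * X\<^sup>2 - (N\<^sup>2 / 4 * y\<^sup>2 + N * (N - 1) / 2 * (X * y - y\<^sup>2))
    - (- 3 / 2 * y\<^sup>2 - (N - 1) / 2 * (1 - X\<^sup>2)) - (N - 3) * X * p r - (p r)\<^sup>2))"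
      using radial_remainder_nonneg[OF N less_imp_le[OF X(1)] X(3) less_imp_le[OF X(2)]] s unfolding pr
      by (intro mult_nonneg_nonneg add_nonneg_nonneg) auto
    moreover define q where "q = N\<^sup>2 / 4 * y\<^sup>2 + N * (N - 1) / 2 * (X * y - y\<^sup>2)"
    moreover define P where "P = p r"
    moreover have "(N - 1) * s\<^sup>2 * a\<^sup>2 - 2 * s * ((c + (N - 1) * X * b) * a) - 1 * s * b\<^sup>2 - q * s * a\<^sup>2 -
       (((- 3 / 2 * y\<^sup>2 - (N - 1) / 2 * (1 - X\<^sup>2)) - 2 * (- s)) * s * (a * a)
        + (P - 2 * X) * (- 2 * X * s) * (a * a) + (P - 2 * X) * s * (2 * a * b)
        + (- 2) * (- 2 * X * s * (a * b) + s * (b * b + a * c))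
        + (N - 1) * X * ((P - 2 * X) * s * (a * a) + (- 2) * (s * (a * b)))) =
       s * ((b - P * a)\<^sup>2 + a\<^sup>2 * ((N - 3) * (X\<^sup>2 - 1) + (2 * N - 6) * X\<^sup>2 - q
    - (- 3 / 2 * y\<^sup>2 - (N - 1) / 2 * (1 - X\<^sup>2)) - (N - 3) * X * P - P\<^sup>2))"
      unfolding s_def by (simp add: power2_eq_square field_simps)
    ultimately show "rd ?W x + (real CARD('n) - 1) * coth (hyp_dist 0 x) * ?W x
      \<le> (N - 1) / norm x ^ 4 * (w x)\<^sup>2 - 2 / (norm x)\<^sup>2 * (radial_laplacian 0 w x * w x)
      - 1 / (norm x)\<^sup>2 * (rd w x)\<^sup>2
      - ((N / 2)\<^sup>2 / (hyp_dist 0 x)\<^sup>2 + N * (N - 1) / 2 * ((hyp_dist 0 x * coth (hyp_dist 0 x) - 1) / (hyp_dist 0 x)\<^sup>2))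
        / (norm x)\<^sup>2 * (w x)\<^sup>2"
      unfolding ns ns' r_def[symmetric] X_def[symmetric] a_def[symmetric] b_def[symmetric] N_def[symmetric]
      by simp
  qed
qed

section \<open>Polar decomposition of the Laplacian\<close>

lemma hyp_integral_linear:
  assumes "f \<in> test_functions p" "g \<in> test_functions p" "h \<in> test_functions p"
  shows "(\<integral>x. a * f x + b * g x + h x \<partial>hyp_volume) =
    a * (\<integral>x. f x \<partial>hyp_volume) + b * (\<integral>x. g x \<partial>hyp_volume) + (\<integral>x. h x \<partial>hyp_volume)"
  using assms by (simp add: hyp_integrable_test)

lemma smooth_on_const_div_norm_power:
  "open S \<Longrightarrow> 0 \<notin> S \<Longrightarrow> smooth_on S (\<lambda>x. c / norm x ^ k)"
  by (intro smooth_on_divide smooth_on_const smooth_on_power smooth_on_norm zero_less_power) auto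

lemma hyp_integral_add3:
  assumes "f \<in> test_functions p" "g \<in> test_functions p" "h \<in> test_functions p"
  shows "(\<integral>x. f x + g x + h x \<partial>hyp_volume) =
    (\<integral>x. f x \<partial>hyp_volume) + (\<integral>x. g x \<partial>hyp_volume) + (\<integral>x. h x \<partial>hyp_volume)"
  using assms by (simp add: hyp_integrable_test)

lemma radial_laplacian_weak:
  fixes v \<phi> :: "real ^ 'n \<Rightarrow> real"
  assumes v: "v \<in> test_functions 0" and \<phi>: "\<phi> \<in> test_functions 0"
  shows "(\<integral>x. radial_laplacian 0 v x * \<phi> x \<partial>hyp_volume) = (\<integral>x. - (rd v x * rd \<phi> x) \<partial>hyp_volume)"
proof (rule radial_ibp_eq)
  show "(\<lambda>x. radial_laplacian 0 v x * \<phi> x) \<in> test_functions 0" "(\<lambda>x. - (rd v x * rd \<phi> x)) \<in> test_functions 0"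
    "(\<lambda>x. rd v x * \<phi> x) \<in> test_functions 0"
    by (intro test_functions_uminus test_functions_mult test_functions_rd test_functions_radial_laplacian v \<phi>)+
  fix x :: "real ^ 'n" assume x: "x \<noteq> 0"
  have "rd (\<lambda>x. rd v x * \<phi> x) x = rd (rd v) x * \<phi> x + rd \<phi> x * rd v x"
    using DERIV_mult[OF radial_deriv_DERIV[OF x test_functions_differentiable[OF test_functions_rd[OF v]]]
        radial_deriv_DERIV[OF x test_functions_differentiable[OF \<phi>]]]
    by (intro radial_deriv_eqI) (simp add: hyp_geodesic_hyp_dist[OF x])
  then show "radial_laplacian 0 v x * \<phi> x - - (rd v x * rd \<phi> x) =
      rd (\<lambda>x. rd v x * \<phi> x) x + (real CARD('n) - 1) * coth (hyp_dist 0 x) * (rd v x * \<phi> x)"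
    by (simp add: radial_laplacian_0 algebra_simps)
qed

text \<open>The polar form of the Laplacian is established weakly: after transport to the pole
  \<open>0\<close>, the Laplacian \<open>h\<close> and the polar expression \<open>L\<close> have
  the same integral against every test function. So only first derivatives have to be transported by
  the boost.\<close>

theorem hyp_laplacian_square:
  fixes u :: "real ^ 'n \<Rightarrow> real"
  assumes u: "u \<in> test_functions p"
  defines "v \<equiv> \<lambda>y. u (boost p y)"
  shows "(\<integral>x. (hyp_laplacian u x)\<^sup>2 \<partial>hyp_volume) =
    (\<integral>x. (radial_laplacian 0 v x + 1 / norm x ^ 2 * Ang v x)\<^sup>2 \<partial>hyp_volume)"
proof -
  have v: "v \<in> test_functions 0"
    unfolding v_def using u by (intro test_functions_boost) (simp add: boost_0)
  define h where "h y = hyp_laplacian u (boost p y)" for y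
  have h: "h \<in> test_functions 0"
    unfolding h_def [abs_def] using test_functions_hyp_laplacian[OF u] by (intro test_functions_boost) (simp add: boost_0)
  define L where "L x = radial_laplacian 0 v x + 1 / norm x ^ 2 * Ang v x" for x
  have sn: "smooth_on (- {0}) (\<lambda>x :: real ^ 'n. 1 / norm x ^ 2)"
    by (rule smooth_on_const_div_norm_power) auto
  have rn: "radial (\<lambda>x :: real ^ 'n. 1 / norm x ^ 2)" by (simp add: radial_def)
  have L: "L \<in> test_functions 0"
    unfolding L_def [abs_def] by (intro test_functions_add test_functions_radial_laplacian test_functions_weight[OF sn] test_functions_Ang v)
  have weak: "(\<integral>x. h x * \<phi> x \<partial>hyp_volume) = (\<integral>x. L x * \<phi> x \<partial>hyp_volume)" if \<phi>: "\<phi> \<in> test_functions 0" for \<phi>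
  proof -
    define \<psi> where "\<psi> x = \<phi> (boost (- p) x)" for x
    have \<psi>b: "\<psi> (boost p y) = \<phi> y" for y by (simp add: \<psi>_def boost_minus_boost)
    have \<psi>: "\<psi> \<in> test_functions p" by (rule hyp_integral_boost(2)[OF \<phi> \<psi>b])
    have gG: "(\<lambda>x. 1 / norm x ^ 2 * Gam v \<phi> x) \<in> test_functions 0"
      by (intro test_functions_weight sn test_functions_Gam v \<phi>)
    have gR: "(\<lambda>x. rd v x * rd \<phi> x) \<in> test_functions 0"
      by (intro test_functions_mult test_functions_rd v \<phi>)
    have "(\<integral>x. h x * \<phi> x \<partial>hyp_volume) = (\<integral>x. hyp_laplacian u x * \<psi> x \<partial>hyp_volume)"
      by (rule hyp_integral_boost(1)[symmetric, where p = p, OF test_functions_mult[OF h \<phi>]]) (simp add: h_def \<psi>b)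
    also have "\<dots> = - (\<integral>x. D \<psi> x (hyp_grad u x) \<partial>hyp_volume)"
      by (rule hyp_laplacian_weak[OF u \<psi>])
    also have "(\<integral>x. D \<psi> x (hyp_grad u x) \<partial>hyp_volume) = (\<integral>x. rd v x * rd \<phi> x + 1 / norm x ^ 2 * Gam v \<phi> x \<partial>hyp_volume)"
    proof (rule hyp_integral_boost(1)[where p = p])
      show "(\<lambda>x. rd v x * rd \<phi> x + 1 / norm x ^ 2 * Gam v \<phi> x) \<in> test_functions 0"
        by (rule test_functions_add[OF gR gG])
      fix y :: "real ^ 'n"
      have "D \<psi> (boost p y) (hyp_grad u (boost p y)) = D \<phi> y (hyp_grad v y)"
        using D_hyp_grad_boost[OF test_functions_differentiable[OF u] test_functions_differentiable[OF \<psi>], of p y]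
        unfolding \<psi>b v_def .
      also have "\<dots> = rd v y * rd \<phi> y + 1 / norm y ^ 2 * Gam v \<phi> y"
      proof (cases "y = 0")
        case True
        have "(\<lambda>x. D \<phi> x w) \<in> test_functions 0" for w by (intro test_functions_D \<phi>) auto
        from test_functions_eq_0_at_pole[OF this] show ?thesis using True by (simp add: radial_deriv_at_0)
      next
        case False
        then show ?thesis
          by (simp add: D_hyp_grad_polar test_functions_differentiable[OF v] test_functions_differentiable[OF \<phi>])
      qed
      finally show "D \<psi> (boost p y) (hyp_grad u (boost p y)) = rd v y * rd \<phi> y + 1 / norm y ^ 2 * Gam v \<phi> y" .
    qed
    also have "- \<dots> = (\<integral>x. radial_laplacian 0 v x * \<phi> x \<partial>hyp_volume) + (\<integral>x. 1 / norm x ^ 2 * (Ang v x * \<phi> x) \<partial>hyp_volume)"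
      unfolding radial_laplacian_weak[OF v \<phi>] Ang_by_parts[OF rn sn v \<phi>]
      using hyp_integrable_test[OF gR] hyp_integrable_test[OF gG] by simp
    also have "\<dots> = (\<integral>x. radial_laplacian 0 v x * \<phi> x + 1 / norm x ^ 2 * (Ang v x * \<phi> x) \<partial>hyp_volume)"
      by (intro Bochner_Integration.integral_add[symmetric] hyp_integrable_test[of _ 0] test_functions_mult
          test_functions_radial_laplacian test_functions_weight[OF sn] test_functions_Ang v \<phi>)
    finally show ?thesis by (simp add: L_def algebra_simps)
  qed
  have t: "(\<lambda>x. h x * h x) \<in> test_functions 0" "(\<lambda>x. h x * L x) \<in> test_functions 0" "(\<lambda>x. L x * L x) \<in> test_functions 0"
    by (intro test_functions_mult h L)+
  \<comment> \<open>Both \<open>h\<close> and \<open>L\<close> are test functions, so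
    \<open>h + L\<close> may be inserted; the mixed integral cancels and the squares have equal
    integrals.\<close>
  have "(\<integral>x. h x * h x \<partial>hyp_volume) + (\<integral>x. h x * L x \<partial>hyp_volume) = (\<integral>x. h x * (h x + L x) \<partial>hyp_volume)"
    using hyp_integrable_test[OF t(1)] hyp_integrable_test[OF t(2)] by (simp add: distrib_left)
  also have "\<dots> = (\<integral>x. L x * (h x + L x) \<partial>hyp_volume)"
    by (intro weak test_functions_add h L)
  also have "\<dots> = (\<integral>x. h x * L x \<partial>hyp_volume) + (\<integral>x. L x * L x \<partial>hyp_volume)"
    using hyp_integrable_test[OF t(2)] hyp_integrable_test[OF t(3)] by (simp add: distrib_left mult.commute[of "L _" "h _"])
  finally have "(\<integral>x. (h x)\<^sup>2 \<partial>hyp_volume) = (\<integral>x. (L x)\<^sup>2 \<partial>hyp_volume)"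
    by (simp add: power2_eq_square)
  moreover have "(\<integral>x. (hyp_laplacian u x)\<^sup>2 \<partial>hyp_volume) = (\<integral>x. (h x)\<^sup>2 \<partial>hyp_volume)"
    by (rule hyp_integral_boost(1)[where p = p, OF test_functions_power2[OF h]]) (simp add: h_def)
  ultimately show ?thesis unfolding L_def by simp
qed

section \<open>The nonradial inequality\<close>

lemma Rot_radial_laplacian:
  fixes v :: "real ^ 'n \<Rightarrow> real"
  assumes v: "v \<in> test_functions 0"
  shows "Rot i j (radial_laplacian 0 v) x = radial_laplacian 0 (Rot i j v) x"
proof -
  have R: "Rot i j (rd f) = rd (Rot i j f)" if "f \<in> test_functions 0" for f
    using Rot_rd[OF that] by auto
  have r: "radial (\<lambda>x :: real ^ 'n. (real CARD('n) - 1) * coth (hyp_dist 0 x))"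
    unfolding coth_hyp_dist_0 by (simp add: radial_def)
  have s: "smooth_on (- {0}) (\<lambda>x :: real ^ 'n. (real CARD('n) - 1) * coth (hyp_dist 0 x))"
    by (intro smooth_on_mult smooth_on_const smooth_on_coth_hyp_dist) auto
  have t: "rd v \<in> test_functions 0" by (rule test_functions_rd[OF v])
  show ?thesis
    unfolding radial_laplacian_0 [abs_def]
    by (subst Rot_add) (simp_all add: R[OF v] R[OF t] Rot_radial_mult[OF r s test_functions_differentiable[OF t]]
        test_functions_differentiable[OF test_functions_rd[OF t]] test_functions_differentiable[OF test_functions_weight[OF s t]])
qed

text \<open>The combined coefficient of the squared gradient in the first two integrals on the right
  of the claim.\<close>

definition hardy_weight :: "real ^ 'n \<Rightarrow> real" where
  "hardy_weight x = (real CARD('n) / 2)\<^sup>2 / (hyp_dist 0 x)\<^sup>2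
    + real CARD('n) * (real CARD('n) - 1) / 2 * ((hyp_dist 0 x * coth (hyp_dist 0 x) - 1) / (hyp_dist 0 x)\<^sup>2)"

lemma smooth_on_hardy_weight: "smooth_on (- {0}) hardy_weight"
  unfolding hardy_weight_def [abs_def]
  by (intro smooth_on_divide smooth_on_add smooth_on_diff smooth_on_mult smooth_on_const smooth_on_power
        smooth_on_hyp_dist_0 smooth_on_coth_hyp_dist zero_less_power hyp_dist_0_pos) auto

text \<open>\<open>Gam\<close> is a sum over rotations, which commute with \<open>rd\<close> and
  with the radial Laplacian, so the radial inequality for every \<open>Rot i j v\<close> adds up to
  one between integrals of \<open>Gam\<close>. Expanding the square on the right supplies these: the
  cross term by parts, the square of \<open>Ang v\<close> by the Bochner bound.\<close>

theorem polar_inequality: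
  fixes v :: "real ^ 'n \<Rightarrow> real"
  assumes v: "v \<in> test_functions 0" and card: "CARD('n) \<ge> 5"
  shows "(\<integral>x. (radial_laplacian 0 v x)\<^sup>2 \<partial>hyp_volume) + (\<integral>x. 1 / norm x ^ 2 * Gam (rd v) (rd v) x \<partial>hyp_volume)
      + (\<integral>x. hardy_weight x / norm x ^ 2 * Gam v v x \<partial>hyp_volume) \<le>
    (\<integral>x. (radial_laplacian 0 v x + 1 / norm x ^ 2 * Ang v x)\<^sup>2 \<partial>hyp_volume)"
proof -
  define N where "N = real CARD('n)"
  let ?\<Delta> = "radial_laplacian 0"
  have sn: "smooth_on (- {0}) (\<lambda>x :: real ^ 'n. c / norm x ^ k)" for c k
    by (rule smooth_on_const_div_norm_power) auto
  have rn: "radial (\<lambda>x :: real ^ 'n. c / norm x ^ k)" for c k by (simp add: radial_def)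
  have sq: "smooth_on (- {0}) (\<lambda>x :: real ^ 'n. hardy_weight x / norm x ^ 2)"
    by (intro smooth_on_divide smooth_on_hardy_weight smooth_on_power smooth_on_norm) auto
  \<comment> \<open>The integrand of \<open>radial_inequality\<close>, with the two Hardy terms
    collected in \<open>hardy_weight\<close>.\<close>
  define \<Phi> where "\<Phi> f x = (N - 1) / norm x ^ 4 * (f x)\<^sup>2 - 2 / norm x ^ 2 * (?\<Delta> f x * f x)
      - 1 / norm x ^ 2 * (rd f x)\<^sup>2 - hardy_weight x / norm x ^ 2 * (f x)\<^sup>2" for f and x :: "real ^ 'n"
  have t\<Phi>: "\<Phi> f \<in> test_functions 0" if "f \<in> test_functions 0" for f
    unfolding \<Phi>_def
    by (intro test_functions_diff test_functions_weight sq sn test_functions_mult test_functions_power2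
          test_functions_radial_laplacian that test_functions_rd)
  have \<Phi>: "0 \<le> (\<integral>x. \<Phi> f x \<partial>hyp_volume)" if "f \<in> test_functions 0" for f
    using radial_inequality[OF that card] unfolding \<Phi>_def hardy_weight_def N_def .
  have t: "(\<lambda>x. (N - 1) / norm x ^ 4 * Gam v v x) \<in> test_functions 0"
    "(\<lambda>x. 2 / norm x ^ 2 * Gam v (?\<Delta> v) x) \<in> test_functions 0"
    "(\<lambda>x. 1 / norm x ^ 2 * Gam (rd v) (rd v) x) \<in> test_functions 0"
    "(\<lambda>x. hardy_weight x / norm x ^ 2 * Gam v v x) \<in> test_functions 0"
    by (intro test_functions_weight sn sq test_functions_Gam v test_functions_rd test_functions_radial_laplacian)+
  have "0 \<le> (\<Sum>i\<in>UNIV. \<Sum>j\<in>UNIV. (\<integral>x. \<Phi> (Rot i j v) x \<partial>hyp_volume)) / 2"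
    by (intro divide_nonneg_pos sum_nonneg \<Phi> test_functions_Rot v) auto
  also have "\<dots> = (\<integral>x. (\<Sum>i\<in>UNIV. \<Sum>j\<in>UNIV. \<Phi> (Rot i j v) x) / 2 \<partial>hyp_volume)"
    by (simp add: hyp_integrable_test[OF t\<Phi>[OF test_functions_Rot[OF v]]])
  also have "\<dots> = (\<integral>x. (N - 1) / norm x ^ 4 * Gam v v x - 2 / norm x ^ 2 * Gam v (?\<Delta> v) x
      - 1 / norm x ^ 2 * Gam (rd v) (rd v) x - hardy_weight x / norm x ^ 2 * Gam v v x \<partial>hyp_volume)"
    unfolding \<Phi>_def Gam_def Rot_radial_laplacian[OF v] Rot_rd[OF v] sum_subtractf sum_distrib_left[symmetric]
      power2_eq_square[of "Rot _ _ v _"] power2_eq_square[of "rd (Rot _ _ v) _"] mult.commute[of "?\<Delta> (Rot _ _ v) _"]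
    by (simp add: diff_divide_distrib)
  also have "\<dots> = (\<integral>x. (N - 1) / norm x ^ 4 * Gam v v x \<partial>hyp_volume) - (\<integral>x. 2 / norm x ^ 2 * Gam v (?\<Delta> v) x \<partial>hyp_volume)
      - (\<integral>x. 1 / norm x ^ 2 * Gam (rd v) (rd v) x \<partial>hyp_volume) - (\<integral>x. hardy_weight x / norm x ^ 2 * Gam v v x \<partial>hyp_volume)"
    using hyp_integrable_test[OF t(1)] hyp_integrable_test[OF t(2)] hyp_integrable_test[OF t(3)] hyp_integrable_test[OF t(4)]
    by simp
  finally have 1: "0 \<le> (\<integral>x. (N - 1) / norm x ^ 4 * Gam v v x \<partial>hyp_volume) - (\<integral>x. 2 / norm x ^ 2 * Gam v (?\<Delta> v) x \<partial>hyp_volume)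
      - (\<integral>x. 1 / norm x ^ 2 * Gam (rd v) (rd v) x \<partial>hyp_volume) - (\<integral>x. hardy_weight x / norm x ^ 2 * Gam v v x \<partial>hyp_volume)" .
  have 2: "(\<integral>x. (N - 1) / norm x ^ 4 * Gam v v x \<partial>hyp_volume) \<le> (\<integral>x. 1 / norm x ^ 4 * (Ang v x)\<^sup>2 \<partial>hyp_volume)"
  proof -
    have "(\<integral>x. (N - 1) / norm x ^ 4 * Gam v v x \<partial>hyp_volume) = (\<integral>x. (N - 1) * (1 / norm x ^ 4 * Gam v v x) \<partial>hyp_volume)"
      by simp
    also have "\<dots> = (N - 1) * (\<integral>x. 1 / norm x ^ 4 * Gam v v x \<partial>hyp_volume)"
      by (rule integral_mult_right_zero)
    also have "\<dots> \<le> (\<integral>x. 1 / norm x ^ 4 * (Ang v x)\<^sup>2 \<partial>hyp_volume)"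
      unfolding N_def using card by (intro bochner_inequality rn sn v) auto
    finally show ?thesis .
  qed
  have 3: "(\<integral>x. 2 / norm x ^ 2 * (Ang v x * ?\<Delta> v x) \<partial>hyp_volume) = - (\<integral>x. 2 / norm x ^ 2 * Gam v (?\<Delta> v) x \<partial>hyp_volume)"
    by (rule Ang_by_parts[OF rn sn v test_functions_radial_laplacian[OF v]])
  have t': "(\<lambda>x. (?\<Delta> v x)\<^sup>2) \<in> test_functions 0" "(\<lambda>x. 2 / norm x ^ 2 * (Ang v x * ?\<Delta> v x)) \<in> test_functions 0"
    "(\<lambda>x. 1 / norm x ^ 4 * (Ang v x)\<^sup>2) \<in> test_functions 0"
    by (intro test_functions_weight sn test_functions_power2 test_functions_mult test_functions_Ang v
        test_functions_radial_laplacian)+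
  have "(?\<Delta> v x + 1 / norm x ^ 2 * Ang v x)\<^sup>2 = (?\<Delta> v x)\<^sup>2 + 2 / norm x ^ 2 * (Ang v x * ?\<Delta> v x) + 1 / norm x ^ 4 * (Ang v x)\<^sup>2" for x
    by (simp add: power2_eq_square power4_eq_xxxx algebra_simps)
  then have "(\<integral>x. (?\<Delta> v x + 1 / norm x ^ 2 * Ang v x)\<^sup>2 \<partial>hyp_volume) = (\<integral>x. (?\<Delta> v x)\<^sup>2 \<partial>hyp_volume)
      + (\<integral>x. 2 / norm x ^ 2 * (Ang v x * ?\<Delta> v x) \<partial>hyp_volume) + (\<integral>x. 1 / norm x ^ 4 * (Ang v x)\<^sup>2 \<partial>hyp_volume)"
    using hyp_integrable_test[OF t'(1)] hyp_integrable_test[OF t'(2)] hyp_integrable_test[OF t'(3)] by simp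
  then show ?thesis using 1 2 3 by linarith
qed

section \<open>Identity and inequality at an arbitrary pole\<close>

lemma smooth_on_div_hyp_dist: "smooth_on (- {0}) (\<lambda>x :: real ^ 'n. 1 / (hyp_dist 0 x)\<^sup>2)"
  by (intro smooth_on_divide smooth_on_const smooth_on_power smooth_on_hyp_dist_0 zero_less_power hyp_dist_0_pos) auto

lemma smooth_on_coth_weight:
  "smooth_on (- {0}) (\<lambda>x :: real ^ 'n. (hyp_dist 0 x * coth (hyp_dist 0 x) - 1) / (hyp_dist 0 x)\<^sup>2)"
  by (intro smooth_on_divide smooth_on_diff smooth_on_mult smooth_on_const smooth_on_power smooth_on_hyp_dist_0
        smooth_on_coth_hyp_dist zero_less_power hyp_dist_0_pos) auto

lemma smooth_on_critical_weight:
  "smooth_on (- {0}) (\<lambda>x :: real ^ 'n. (c - 1) * coth (hyp_dist 0 x) - c / (2 * hyp_dist 0 x))"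
  by (intro smooth_on_divide smooth_on_diff smooth_on_mult smooth_on_const smooth_on_hyp_dist_0
        smooth_on_coth_hyp_dist mult_pos_pos hyp_dist_0_pos) auto

context
  fixes u :: "real ^ 'n \<Rightarrow> real" and p :: "real ^ 'n" and v :: "real ^ 'n \<Rightarrow> real" and N :: nat
  assumes u: "u \<in> test_functions p" and v_def: "v = (\<lambda>y. u (boost p y))" and N: "N = CARD('n)"
begin

lemma test_functions_transported: "v \<in> test_functions 0"
  unfolding v_def using u by (intro test_functions_boost) (simp add: boost_0)

lemma N_pos: "N > 0" by (simp add: N)

text \<open>Boosts preserve the volume, and each integrand at \<open>boost p y\<close> is the
  corresponding one at \<open>y\<close> for the transported function \<open>v\<close>.\<close>

lemma radial_integrals:
  "(\<integral>x. (radial_laplacian p u x)\<^sup>2 \<partial>hyp_volume) = (\<integral>x. (radial_laplacian 0 v x)\<^sup>2 \<partial>hyp_volume)"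
  "(\<integral>x. radial_grad_sq p u x / (hyp_dist p x)\<^sup>2 \<partial>hyp_volume) = (\<integral>x. 1 / (hyp_dist 0 x)\<^sup>2 * (rd v x)\<^sup>2 \<partial>hyp_volume)"
  "(\<integral>x. (hyp_dist p x * coth (hyp_dist p x) - 1) / (hyp_dist p x)\<^sup>2 * radial_grad_sq p u x \<partial>hyp_volume) =
    (\<integral>x. (hyp_dist 0 x * coth (hyp_dist 0 x) - 1) / (hyp_dist 0 x)\<^sup>2 * (rd v x)\<^sup>2 \<partial>hyp_volume)"
  "(\<integral>x. hyp_dist p x ^ N / sinh (hyp_dist p x) ^ (2 * (N - 1)) * radial_grad_sq p
      (\<lambda>y. sinh (hyp_dist p y) ^ (N - 1) * radial_deriv p u y / hyp_dist p y powr (real N / 2)) x \<partial>hyp_volume) =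
    (\<integral>x. (rd (rd v) x + ((real N - 1) * coth (hyp_dist 0 x) - real N / (2 * hyp_dist 0 x)) * rd v x)\<^sup>2 \<partial>hyp_volume)"
proof -
  note v = test_functions_transported
  have b: "radial_deriv p u (boost p y) = rd v y" for y
    unfolding v_def by (rule radial_deriv_boost)
  show "(\<integral>x. (radial_laplacian p u x)\<^sup>2 \<partial>hyp_volume) = (\<integral>x. (radial_laplacian 0 v x)\<^sup>2 \<partial>hyp_volume)"
    by (rule hyp_integral_boost(1)[where p = p, OF test_functions_power2[OF test_functions_radial_laplacian[OF v]]])
      (simp add: radial_laplacian_boost v_def)
  show "(\<integral>x. radial_grad_sq p u x / (hyp_dist p x)\<^sup>2 \<partial>hyp_volume) = (\<integral>x. 1 / (hyp_dist 0 x)\<^sup>2 * (rd v x)\<^sup>2 \<partial>hyp_volume)"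
    by (rule hyp_integral_boost(1)[where p = p, OF test_functions_weight[OF smooth_on_div_hyp_dist
          test_functions_power2[OF test_functions_rd[OF v]]]])
      (simp add: radial_grad_sq_def b hyp_dist_boost)
  show "(\<integral>x. (hyp_dist p x * coth (hyp_dist p x) - 1) / (hyp_dist p x)\<^sup>2 * radial_grad_sq p u x \<partial>hyp_volume) =
    (\<integral>x. (hyp_dist 0 x * coth (hyp_dist 0 x) - 1) / (hyp_dist 0 x)\<^sup>2 * (rd v x)\<^sup>2 \<partial>hyp_volume)"
    by (rule hyp_integral_boost(1)[where p = p, OF test_functions_weight[OF smooth_on_coth_weight
          test_functions_power2[OF test_functions_rd[OF v]]]])
      (simp add: radial_grad_sq_def b hyp_dist_boost)
  show "(\<integral>x. hyp_dist p x ^ N / sinh (hyp_dist p x) ^ (2 * (N - 1)) * radial_grad_sq p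
      (\<lambda>y. sinh (hyp_dist p y) ^ (N - 1) * radial_deriv p u y / hyp_dist p y powr (real N / 2)) x \<partial>hyp_volume) =
    (\<integral>x. (rd (rd v) x + ((real N - 1) * coth (hyp_dist 0 x) - real N / (2 * hyp_dist 0 x)) * rd v x)\<^sup>2 \<partial>hyp_volume)"
  proof (rule hyp_integral_boost(1)[where p = p])
    show "(\<lambda>x. (rd (rd v) x + ((real N - 1) * coth (hyp_dist 0 x) - real N / (2 * hyp_dist 0 x)) * rd v x)\<^sup>2) \<in> test_functions 0"
      by (intro test_functions_power2 test_functions_add test_functions_rd test_functions_weight smooth_on_critical_weight v)
    fix y :: "real ^ 'n"
    show "hyp_dist p (boost p y) ^ N / sinh (hyp_dist p (boost p y)) ^ (2 * (N - 1)) * radial_grad_sq p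
      (\<lambda>y. sinh (hyp_dist p y) ^ (N - 1) * radial_deriv p u y / hyp_dist p y powr (real N / 2)) (boost p y) =
      (rd (rd v) y + ((real N - 1) * coth (hyp_dist 0 y) - real N / (2 * hyp_dist 0 y)) * rd v y)\<^sup>2"
      unfolding radial_grad_sq_def radial_deriv_boost[of p "\<lambda>y. _ y / _ y"] b hyp_dist_boost
      using weighted_radial_deriv_identity[OF test_functions_rd[OF v], of y N] N_pos
      by (cases "y = 0") (simp_all add: radial_deriv_at_0 hyp_dist_0(3) of_nat_diff)
  qed
qed

theorem radial_identity_pole:
  "(\<integral>x. (radial_laplacian p u x)\<^sup>2 \<partial>hyp_volume) =
    (real N / 2)\<^sup>2 * (\<integral>x. radial_grad_sq p u x / (hyp_dist p x)\<^sup>2 \<partial>hyp_volume)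
    + real N * (real N - 1) / 2 *
        (\<integral>x. (hyp_dist p x * coth (hyp_dist p x) - 1) / (hyp_dist p x)\<^sup>2 * radial_grad_sq p u x \<partial>hyp_volume)
    + (\<integral>x. hyp_dist p x ^ N / sinh (hyp_dist p x) ^ (2 * (N - 1)) * radial_grad_sq p
      (\<lambda>y. sinh (hyp_dist p y) ^ (N - 1) * radial_deriv p u y / hyp_dist p y powr (real N / 2)) x \<partial>hyp_volume)"
proof -
  note v = test_functions_transported
  have t: "(\<lambda>x. 1 / (hyp_dist 0 x)\<^sup>2 * (rd v x)\<^sup>2) \<in> test_functions 0"
    "(\<lambda>x. (hyp_dist 0 x * coth (hyp_dist 0 x) - 1) / (hyp_dist 0 x)\<^sup>2 * (rd v x)\<^sup>2) \<in> test_functions 0"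
    "(\<lambda>x. (rd (rd v) x + ((real N - 1) * coth (hyp_dist 0 x) - real N / (2 * hyp_dist 0 x)) * rd v x)\<^sup>2) \<in> test_functions 0"
    by (intro test_functions_power2 test_functions_add test_functions_rd test_functions_weight smooth_on_critical_weight
        smooth_on_div_hyp_dist smooth_on_coth_weight v)+
  show ?thesis
    unfolding radial_integrals radial_identity[OF v] N[symmetric] hyp_integral_linear[OF t, symmetric] by simp
qed

lemma hyp_grad_sq_transported: "hyp_grad_sq u (boost p y) = (rd v y)\<^sup>2 + 1 / norm y ^ 2 * Gam v v y"
proof (cases "y = 0")
  case True
  have "hyp_grad_sq u (boost p y) = hyp_grad_sq v y"
    unfolding v_def by (intro hyp_grad_sq_boost test_functions_differentiable[OF u])
  then show ?thesis using True hyp_grad_sq_at_pole[OF test_functions_transported] by (simp add: radial_deriv_at_0)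
next
  case False
  have "hyp_grad_sq u (boost p y) = hyp_grad_sq v y"
    unfolding v_def by (intro hyp_grad_sq_boost test_functions_differentiable[OF u])
  then show ?thesis
    using hyp_grad_sq_polar[OF test_functions_differentiable[OF test_functions_transported] False] by simp
qed

lemma hyp_integrals:
  "(\<integral>x. hyp_grad_sq u x / (hyp_dist p x)\<^sup>2 \<partial>hyp_volume) =
    (\<integral>x. 1 / (hyp_dist 0 x)\<^sup>2 * ((rd v x)\<^sup>2 + 1 / norm x ^ 2 * Gam v v x) \<partial>hyp_volume)"
  "(\<integral>x. (hyp_dist p x * coth (hyp_dist p x) - 1) / (hyp_dist p x)\<^sup>2 * hyp_grad_sq u x \<partial>hyp_volume) =
    (\<integral>x. (hyp_dist 0 x * coth (hyp_dist 0 x) - 1) / (hyp_dist 0 x)\<^sup>2 * ((rd v x)\<^sup>2 + 1 / norm x ^ 2 * Gam v v x) \<partial>hyp_volume)"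
  "(\<integral>x. hyp_dist p x ^ N / sinh (hyp_dist p x) ^ (2 * (N - 1)) * hyp_grad_sq
      (\<lambda>y. sinh (hyp_dist p y) ^ (N - 1) * radial_deriv p u y / hyp_dist p y powr (real N / 2)) x \<partial>hyp_volume) =
    (\<integral>x. (rd (rd v) x + ((real N - 1) * coth (hyp_dist 0 x) - real N / (2 * hyp_dist 0 x)) * rd v x)\<^sup>2
      + 1 / norm x ^ 2 * Gam (rd v) (rd v) x \<partial>hyp_volume)"
proof -
  note v = test_functions_transported
  have sn: "smooth_on (- {0}) (\<lambda>x :: real ^ 'n. 1 / norm x ^ 2)"
    by (rule smooth_on_const_div_norm_power) auto
  have tg: "(\<lambda>y. (rd v y)\<^sup>2 + 1 / norm y ^ 2 * Gam v v y) \<in> test_functions 0"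
    by (intro test_functions_add test_functions_power2 test_functions_rd test_functions_weight[OF sn] test_functions_Gam v)
  show "(\<integral>x. hyp_grad_sq u x / (hyp_dist p x)\<^sup>2 \<partial>hyp_volume) =
    (\<integral>x. 1 / (hyp_dist 0 x)\<^sup>2 * ((rd v x)\<^sup>2 + 1 / norm x ^ 2 * Gam v v x) \<partial>hyp_volume)"
    by (rule hyp_integral_boost(1)[where p = p, OF test_functions_weight[OF smooth_on_div_hyp_dist tg]])
      (simp add: hyp_grad_sq_transported hyp_dist_boost)
  show "(\<integral>x. (hyp_dist p x * coth (hyp_dist p x) - 1) / (hyp_dist p x)\<^sup>2 * hyp_grad_sq u x \<partial>hyp_volume) =
    (\<integral>x. (hyp_dist 0 x * coth (hyp_dist 0 x) - 1) / (hyp_dist 0 x)\<^sup>2 * ((rd v x)\<^sup>2 + 1 / norm x ^ 2 * Gam v v x) \<partial>hyp_volume)"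
    by (rule hyp_integral_boost(1)[where p = p, OF test_functions_weight[OF smooth_on_coth_weight tg]])
      (simp add: hyp_grad_sq_transported hyp_dist_boost)
  \<comment> \<open>The factor multiplying \<open>rd v\<close> is radial and passes through
    rotations, so it leaves \<open>Gam\<close> squared and cancels against the weight in
    front.\<close>
  define \<phi> where "\<phi> y = norm y ^ (N - 1) / hyp_dist 0 y powr (real N / 2)" for y :: "real ^ 'n"
  have s\<phi>: "smooth_on (- {0}) \<phi>"
    unfolding \<phi>_def [abs_def]
    by (intro smooth_on_divide smooth_on_power smooth_on_norm smooth_on_powr smooth_on_hyp_dist_0 hyp_dist_0_pos)
      (use hyp_dist_0_pos in fastforce)+
  have r\<phi>: "radial \<phi>" unfolding \<phi>_def radial_def hyp_dist_0(3) by simp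
  let ?Gp = "\<lambda>y. sinh (hyp_dist p y) ^ (N - 1) * radial_deriv p u y / hyp_dist p y powr (real N / 2)"
  let ?Gv = "\<lambda>y. sinh (hyp_dist 0 y) ^ (N - 1) * rd v y / hyp_dist 0 y powr (real N / 2)"
  have G0_eq: "?Gv = (\<lambda>y. \<phi> y * rd v y)" unfolding \<phi>_def hyp_dist_0(2) by auto
  have G0: "?Gv \<in> test_functions 0"
    unfolding G0_eq by (intro test_functions_weight s\<phi> test_functions_rd v)
  have GG0: "?Gp (boost p y) = ?Gv y" for y
    unfolding v_def by (simp add: radial_deriv_boost hyp_dist_boost)
  have G: "?Gp \<in> test_functions p" by (rule hyp_integral_boost(2)[OF G0 GG0])
  have gam: "Gam ?Gv ?Gv y = (\<phi> y)\<^sup>2 * Gam (rd v) (rd v) y" for y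
    unfolding G0_eq Gam_def Rot_radial_mult[OF r\<phi> s\<phi> test_functions_differentiable[OF test_functions_rd[OF v]]]
    by (simp add: sum_distrib_left power2_eq_square mult_ac)
  show "(\<integral>x. hyp_dist p x ^ N / sinh (hyp_dist p x) ^ (2 * (N - 1)) * hyp_grad_sq ?Gp x \<partial>hyp_volume) =
    (\<integral>x. (rd (rd v) x + ((real N - 1) * coth (hyp_dist 0 x) - real N / (2 * hyp_dist 0 x)) * rd v x)\<^sup>2
      + 1 / norm x ^ 2 * Gam (rd v) (rd v) x \<partial>hyp_volume)"
  proof (rule hyp_integral_boost(1)[where p = p])
    show "(\<lambda>x. (rd (rd v) x + ((real N - 1) * coth (hyp_dist 0 x) - real N / (2 * hyp_dist 0 x)) * rd v x)\<^sup>2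
      + 1 / norm x ^ 2 * Gam (rd v) (rd v) x) \<in> test_functions 0"
      by (intro test_functions_power2 test_functions_add test_functions_rd test_functions_weight[OF smooth_on_critical_weight]
          test_functions_weight[OF sn] test_functions_Gam v)
    fix y :: "real ^ 'n"
    have "hyp_grad_sq ?Gp (boost p y) = hyp_grad_sq ?Gv y"
      unfolding GG0[symmetric] by (intro hyp_grad_sq_boost test_functions_differentiable[OF G])
    moreover have "hyp_dist 0 y ^ N / sinh (hyp_dist 0 y) ^ (2 * (N - 1)) * hyp_grad_sq ?Gv y =
      (rd (rd v) y + ((real N - 1) * coth (hyp_dist 0 y) - real N / (2 * hyp_dist 0 y)) * rd v y)\<^sup>2
      + 1 / norm y ^ 2 * Gam (rd v) (rd v) y"
    proof (cases "y = 0")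
      case True
      then show ?thesis
        using hyp_grad_sq_at_pole[OF G0] by (simp add: radial_deriv_at_0)
    next
      case False
      let ?k = "hyp_dist 0 y ^ N / sinh (hyp_dist 0 y) ^ (2 * (N - 1))"
      have r: "hyp_dist 0 y > 0" "norm y > 0" using hyp_dist_0_pos[OF False] False by auto
      have "(\<phi> y)\<^sup>2 = norm y ^ (2 * (N - 1)) / hyp_dist 0 y ^ N"
        using r unfolding \<phi>_def power_divide
        by (simp add: power2_eq_square power_mult mult.commute[of 2] powr_realpow flip: powr_add)
      then have "?k * (\<phi> y)\<^sup>2 = 1"
        using r by (simp add: hyp_dist_0(2))
      then have k: "?k * ((\<phi> y)\<^sup>2 * z) = z" for z
        by (simp only: mult.assoc[symmetric] mult_1_left)
      have "?k * hyp_grad_sq ?Gv y = ?k * (rd ?Gv y)\<^sup>2 + ?k * ((\<phi> y)\<^sup>2 * (1 / norm y ^ 2 * Gam (rd v) (rd v) y))"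
        unfolding hyp_grad_sq_polar[OF test_functions_differentiable[OF G0] False] gam
        by (simp add: algebra_simps)
      also have "?k * (rd ?Gv y)\<^sup>2 = (rd (rd v) y + ((real N - 1) * coth (hyp_dist 0 y) - real N / (2 * hyp_dist 0 y)) * rd v y)\<^sup>2"
        using weighted_radial_deriv_identity[OF test_functions_rd[OF v] False, of N] N_pos by (simp add: of_nat_diff)
      finally show ?thesis unfolding k .
    qed
    ultimately show "hyp_dist p (boost p y) ^ N / sinh (hyp_dist p (boost p y)) ^ (2 * (N - 1)) * hyp_grad_sq ?Gp (boost p y) =
      (rd (rd v) y + ((real N - 1) * coth (hyp_dist 0 y) - real N / (2 * hyp_dist 0 y)) * rd v y)\<^sup>2
      + 1 / norm y ^ 2 * Gam (rd v) (rd v) y"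
      by (simp only: hyp_dist_boost)
  qed
qed

text \<open>By \<open>radial_identity\<close> the radial parts of the three integrals add up to the
  integral of the squared radial Laplacian. Their spherical parts are the two \<open>Gam\<close>
  integrals of \<open>polar_inequality\<close>.\<close>

theorem hyp_inequality_pole:
  assumes "N \<ge> 5"
  shows "(real N / 2)\<^sup>2 * (\<integral>x. hyp_grad_sq u x / (hyp_dist p x)\<^sup>2 \<partial>hyp_volume)
    + real N * (real N - 1) / 2 *
        (\<integral>x. (hyp_dist p x * coth (hyp_dist p x) - 1) / (hyp_dist p x)\<^sup>2 * hyp_grad_sq u x \<partial>hyp_volume)
    + (\<integral>x. hyp_dist p x ^ N / sinh (hyp_dist p x) ^ (2 * (N - 1)) * hyp_grad_sq
      (\<lambda>y. sinh (hyp_dist p y) ^ (N - 1) * radial_deriv p u y / hyp_dist p y powr (real N / 2)) x \<partial>hyp_volume)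
    \<le> (\<integral>x. (hyp_laplacian u x)\<^sup>2 \<partial>hyp_volume)"
proof -
  note v = test_functions_transported
  have sn: "smooth_on (- {0}) (\<lambda>x :: real ^ 'n. 1 / norm x ^ 2)"
    by (rule smooth_on_const_div_norm_power) auto
  have sq: "smooth_on (- {0}) (\<lambda>x :: real ^ 'n. hardy_weight x / norm x ^ 2)"
    by (intro smooth_on_divide smooth_on_hardy_weight smooth_on_power smooth_on_norm) auto
  let ?q1 = "\<lambda>x :: real ^ 'n. 1 / (hyp_dist 0 x)\<^sup>2"
  let ?q2 = "\<lambda>x :: real ^ 'n. (hyp_dist 0 x * coth (hyp_dist 0 x) - 1) / (hyp_dist 0 x)\<^sup>2"
  let ?T = "\<lambda>x. (rd (rd v) x + ((real N - 1) * coth (hyp_dist 0 x) - real N / (2 * hyp_dist 0 x)) * rd v x)\<^sup>2"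
  have tG: "(\<lambda>y. 1 / norm y ^ 2 * Gam f f y) \<in> test_functions 0" if "f \<in> test_functions 0" for f :: "real ^ 'n \<Rightarrow> real"
    by (intro test_functions_weight[OF sn] test_functions_Gam that)
  have tg: "(\<lambda>y. (rd v y)\<^sup>2 + 1 / norm y ^ 2 * Gam v v y) \<in> test_functions 0"
    by (intro test_functions_add test_functions_power2 test_functions_rd tG v)
  have t1: "(\<lambda>x. ?q1 x * ((rd v x)\<^sup>2 + 1 / norm x ^ 2 * Gam v v x)) \<in> test_functions 0"
    "(\<lambda>x. ?q2 x * ((rd v x)\<^sup>2 + 1 / norm x ^ 2 * Gam v v x)) \<in> test_functions 0"
    by (intro test_functions_weight smooth_on_div_hyp_dist smooth_on_coth_weight tg)+
  have tT: "?T \<in> test_functions 0"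
    by (intro test_functions_power2 test_functions_add test_functions_rd test_functions_weight[OF smooth_on_critical_weight] v)
  have t2: "(\<lambda>x. ?q1 x * (rd v x)\<^sup>2) \<in> test_functions 0" "(\<lambda>x. ?q2 x * (rd v x)\<^sup>2) \<in> test_functions 0"
    by (intro test_functions_weight smooth_on_div_hyp_dist smooth_on_coth_weight test_functions_power2 test_functions_rd v)+
  have t3: "(\<lambda>x. hardy_weight x / norm x ^ 2 * Gam v v x) \<in> test_functions 0"
    by (intro test_functions_weight sq test_functions_Gam v)
  have tS: "(\<lambda>x. (radial_laplacian 0 v x)\<^sup>2) \<in> test_functions 0"
    by (intro test_functions_power2 test_functions_radial_laplacian v)
  have "(real N / 2)\<^sup>2 * (\<integral>x. ?q1 x * ((rd v x)\<^sup>2 + 1 / norm x ^ 2 * Gam v v x) \<partial>hyp_volume)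
      + real N * (real N - 1) / 2 * (\<integral>x. ?q2 x * ((rd v x)\<^sup>2 + 1 / norm x ^ 2 * Gam v v x) \<partial>hyp_volume)
      + (\<integral>x. ?T x + 1 / norm x ^ 2 * Gam (rd v) (rd v) x \<partial>hyp_volume) =
    (\<integral>x. (real N / 2)\<^sup>2 * (?q1 x * ((rd v x)\<^sup>2 + 1 / norm x ^ 2 * Gam v v x))
      + real N * (real N - 1) / 2 * (?q2 x * ((rd v x)\<^sup>2 + 1 / norm x ^ 2 * Gam v v x))
      + (?T x + 1 / norm x ^ 2 * Gam (rd v) (rd v) x) \<partial>hyp_volume)"
    by (rule hyp_integral_linear[OF t1 test_functions_add[OF tT tG[OF test_functions_rd[OF v]]], symmetric])
  also have "\<dots> = (\<integral>x. ((real N / 2)\<^sup>2 * (?q1 x * (rd v x)\<^sup>2) + real N * (real N - 1) / 2 * (?q2 x * (rd v x)\<^sup>2) + ?T x)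
      + 1 / norm x ^ 2 * Gam (rd v) (rd v) x + hardy_weight x / norm x ^ 2 * Gam v v x \<partial>hyp_volume)"
  proof (intro Bochner_Integration.integral_cong refl)
    fix x :: "real ^ 'n"
    define a b g c where "a = ?q1 x" and "b = ?q2 x" and "g = 1 / norm x ^ 2 * Gam v v x" and "c = (rd v x)\<^sup>2"
    have hw: "hardy_weight x / norm x ^ 2 * Gam v v x = ((real N / 2)\<^sup>2 * a + real N * (real N - 1) / 2 * b) * g"
      unfolding hardy_weight_def N[symmetric] a_def b_def g_def by simp
    have ring: "A * (a * (c + g)) + B * (b * (c + g)) + (d + e) = (A * (a * c) + B * (b * c) + d) + e + (A * a + B * b) * g"
      for A B d e by (simp add: algebra_simps)
    show "(real N / 2)\<^sup>2 * (?q1 x * ((rd v x)\<^sup>2 + 1 / norm x ^ 2 * Gam v v x))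
      + real N * (real N - 1) / 2 * (?q2 x * ((rd v x)\<^sup>2 + 1 / norm x ^ 2 * Gam v v x))
      + (?T x + 1 / norm x ^ 2 * Gam (rd v) (rd v) x) = ((real N / 2)\<^sup>2 * (?q1 x * (rd v x)\<^sup>2) + real N * (real N - 1) / 2 * (?q2 x * (rd v x)\<^sup>2) + ?T x)
      + 1 / norm x ^ 2 * Gam (rd v) (rd v) x + hardy_weight x / norm x ^ 2 * Gam v v x"
      unfolding hw using ring unfolding a_def b_def c_def g_def .
  qed
  also have "\<dots> = (\<integral>x. (real N / 2)\<^sup>2 * (?q1 x * (rd v x)\<^sup>2) + real N * (real N - 1) / 2 * (?q2 x * (rd v x)\<^sup>2) + ?T x \<partial>hyp_volume)
      + (\<integral>x. 1 / norm x ^ 2 * Gam (rd v) (rd v) x \<partial>hyp_volume) + (\<integral>x. hardy_weight x / norm x ^ 2 * Gam v v x \<partial>hyp_volume)"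
    by (rule hyp_integral_add3[OF test_functions_add[OF test_functions_add[OF
          test_functions_cmult[OF t2(1)] test_functions_cmult[OF t2(2)]] tT] tG[OF test_functions_rd[OF v]] t3])
  also have "(\<integral>x. (real N / 2)\<^sup>2 * (?q1 x * (rd v x)\<^sup>2) + real N * (real N - 1) / 2 * (?q2 x * (rd v x)\<^sup>2) + ?T x \<partial>hyp_volume) =
      (\<integral>x. (radial_laplacian 0 v x)\<^sup>2 \<partial>hyp_volume)"
    unfolding radial_identity[OF v] N[symmetric] by simp
  also have "\<dots> + (\<integral>x. 1 / norm x ^ 2 * Gam (rd v) (rd v) x \<partial>hyp_volume) + (\<integral>x. hardy_weight x / norm x ^ 2 * Gam v v x \<partial>hyp_volume)
      \<le> (\<integral>x. (radial_laplacian 0 v x + 1 / norm x ^ 2 * Ang v x)\<^sup>2 \<partial>hyp_volume)"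
    using assms N by (intro polar_inequality v) auto
  also have "\<dots> = (\<integral>x. (hyp_laplacian u x)\<^sup>2 \<partial>hyp_volume)"
    unfolding v_def using hyp_laplacian_square[OF u] by simp
  finally show ?thesis unfolding hyp_integrals .
qed

end

section \<open>Flat functions\<close>

text \<open>The functions \<open>z^-m exp (-1/z)\<close> continued by zero. The derivative of one is
  a combination of those with index \<open>m + 1\<close> and \<open>m + 2\<close>, so their span is
  closed under differentiation.\<close>

definition flat :: "nat \<Rightarrow> real \<Rightarrow> real" where
  "flat m z = (if z \<le> 0 then 0 else (1 / z) ^ m * exp (- (1 / z)))"

text \<open>From \<open>exp t \<ge> (t / k)^k\<close> with \<open>t = 1 / z\<close> and
  \<open>k = m + 2\<close>; the two surplus powers of \<open>z\<close> give differentiability at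
  0.\<close>

lemma flat_le:
  assumes "z > 0"
  shows "flat m z \<le> real (m + 2) ^ (m + 2) * z\<^sup>2"
proof -
  define k where "k = m + 2"
  have k: "real k > 0" by (simp add: k_def)
  have "1 / z / real k \<le> exp (1 / z / real k)"
    using exp_ge_add_one_self[of "1 / z / real k"] by linarith
  then have "(1 / z / real k) ^ k \<le> exp (1 / z / real k) ^ k"
    using assms k by (intro power_mono) auto
  also have "\<dots> = exp (1 / z)"
    using k by (simp flip: exp_of_nat_mult)
  finally have "(1 / z) ^ k / real k ^ k \<le> exp (1 / z)"
    by (simp only: power_divide[symmetric])
  then have "(1 / z) ^ k \<le> real k ^ k * exp (1 / z)"
    using k by (simp only: pos_divide_le_eq zero_less_power mult.commute)
  then have "(1 / z) ^ m * (1 / z)\<^sup>2 \<le> real k ^ k * exp (1 / z)"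
    by (simp only: k_def power_add)
  then have "(1 / z) ^ m \<le> real k ^ k * exp (1 / z) * z\<^sup>2"
    using assms by (simp add: field_simps power_divide)
  then have "(1 / z) ^ m * exp (- (1 / z)) \<le> real k ^ k * exp (1 / z) * z\<^sup>2 * exp (- (1 / z))"
    by (intro mult_right_mono) auto
  also have "\<dots> = real k ^ k * z\<^sup>2"
    by (simp add: exp_minus)
  finally show ?thesis using assms by (simp add: flat_def k_def)
qed

lemma flat_nonneg: "flat m z \<ge> 0"
  by (simp add: flat_def)

lemma DERIV_flat: "(flat m has_real_derivative flat (m + 2) z - real m * flat (m + 1) z) (at z)"
proof -
  consider "z > 0" | "z < 0" | "z = 0" by linarith
  then show ?thesis
  proof cases
    case 1
    have "((\<lambda>z. (1 / z) ^ m * exp (- (1 / z))) has_real_derivative flat (m + 2) z - real m * flat (m + 1) z) (at z)"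
    proof -
      have d: "((\<lambda>z. 1 / z) has_real_derivative - ((1 / z) ^ 2)) (at z)"
        using 1 by (auto intro!: derivative_eq_intros simp: power2_eq_square)
      have e: "((\<lambda>z. exp (- (1 / z))) has_real_derivative exp (- (1 / z)) * (1 / z) ^ 2) (at z)"
        using DERIV_chain2[OF DERIV_exp DERIV_minus[OF d]] by simp
      have eq: "real m * (- ((1 / z) ^ 2) * (1 / z) ^ (m - Suc 0)) = - (real m * (1 / z) ^ (m + 1))"
        by (cases m) (simp_all add: power2_eq_square)
      show ?thesis
        by (rule DERIV_cong[OF DERIV_mult[OF DERIV_power[OF d, of m] e]], unfold eq)
          (use 1 in \<open>simp add: flat_def power_add power2_eq_square algebra_simps\<close>)
    qed
    then show ?thesis
      by (rule has_field_derivative_transform_within_open[of _ _ _ "{0<..}"]) (use 1 in \<open>auto simp: flat_def\<close>)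
  next
    case 2
    have "((\<lambda>z. 0) has_real_derivative 0) (at z)" by simp
    then have "(flat m has_real_derivative 0) (at z)"
      by (rule has_field_derivative_transform_within_open[of _ _ _ "{..<0}"]) (use 2 in \<open>auto simp: flat_def\<close>)
    then show ?thesis using 2 by (simp add: flat_def)
  next
    \<comment> \<open>The quadratic bound \<open>flat_le\<close> forces the difference quotient at 0
      to tend to 0.\<close>
    case 3
    have "((\<lambda>h. flat m h / h) \<longlongrightarrow> 0) (at 0)"
    proof (rule Lim_null_comparison)
      show "\<forall>\<^sub>F h in at 0. norm (flat m h / h) \<le> real (m + 2) ^ (m + 2) * \<bar>h\<bar>"
      proof (intro always_eventually allI)
        fix h :: real
        show "norm (flat m h / h) \<le> real (m + 2) ^ (m + 2) * \<bar>h\<bar>"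
        proof (cases "h > 0")
          case True
          then show ?thesis using flat_le[OF True, of m] flat_nonneg[of m h]
            by (simp add: divide_le_eq power2_eq_square)
        next
          case False
          then have "flat m h = 0" by (simp add: flat_def)
          then show ?thesis
            by (simp only: div_0 norm_zero) (intro mult_nonneg_nonneg zero_le_power of_nat_0_le_iff abs_ge_zero)
        qed
      qed
      show "((\<lambda>h. real (m + 2) ^ (m + 2) * \<bar>h\<bar>) \<longlongrightarrow> 0) (at 0)"
        by (auto intro!: tendsto_eq_intros)
    qed
    then show ?thesis using 3 by (simp add: DERIV_def flat_def)
  qed
qed

lemma Ck_on_flat:
  assumes "open S" "Ck_on S k g"
  shows "Ck_on S k (\<lambda>x. flat m (g x))"
  using assms(2)
proof (induction k arbitrary: m)
  case 0
  have "continuous_on UNIV (flat m)"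
    using DERIV_flat by (intro DERIV_continuous_on) blast
  then show ?case using 0 continuous_on_compose2[of UNIV "flat m" S g] by simp
next
  case (Suc k)
  show ?case
  proof (rule Ck_on_SucI[OF assms(1), where F = "\<lambda>x v. (flat (m + 2) (g x) + - real m * flat (m + 1) (g x)) * D g x v"])
    show "((\<lambda>x. flat m (g x)) has_derivative (\<lambda>v. (flat (m + 2) (g x) + - real m * flat (m + 1) (g x)) * D g x v)) (at x)"
      if "x \<in> S" for x
      using DERIV_compose_FDERIV[OF DERIV_flat Ck_on_SucD[OF Suc.prems that], of m]
      by (simp add: mult.commute)
    show "Ck_on S k (\<lambda>x. (flat (m + 2) (g x) + - real m * flat (m + 1) (g x)) * D g x v)" for v
      using Suc.prems Ck_on_Suc_le[OF Suc.prems]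
      by (intro Ck_on_mult Ck_on_add Ck_on_const Suc.IH assms(1)) auto
  qed
qed

text \<open>A class of functions on the line closed under differentiation and smooth when composed
  with smooth functions, so that all derivatives of the cutoff stay available. \<open>ident\<close>
  supplies the linear factors that arise when the scale of a profile is varied.\<close>

inductive_set flat_algebra :: "(real \<Rightarrow> real) set" where
  const: "(\<lambda>z. c) \<in> flat_algebra"
| ident: "(\<lambda>z. z) \<in> flat_algebra"
| left: "flat m \<in> flat_algebra"
| right: "(\<lambda>z. flat m (1 - z)) \<in> flat_algebra"
| add: "f \<in> flat_algebra \<Longrightarrow> g \<in> flat_algebra \<Longrightarrow> (\<lambda>z. f z + g z) \<in> flat_algebra"
| mult: "f \<in> flat_algebra \<Longrightarrow> g \<in> flat_algebra \<Longrightarrow> (\<lambda>z. f z * g z) \<in> flat_algebra"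

lemma flat_algebra_diff:
  assumes "f \<in> flat_algebra" "g \<in> flat_algebra"
  shows "(\<lambda>z. f z - g z) \<in> flat_algebra"
  using flat_algebra.add[OF assms(1) flat_algebra.mult[OF flat_algebra.const[of "-1"] assms(2)]] by simp

lemma flat_algebra_DERIV:
  "h \<in> flat_algebra \<Longrightarrow> \<exists>h'\<in>flat_algebra. \<forall>z. (h has_real_derivative h' z) (at z)"
proof (induction rule: flat_algebra.induct)
  case (const c)
  then show ?case by (intro bexI[of _ "\<lambda>z. 0"] flat_algebra.const) auto
next
  case ident
  then show ?case by (intro bexI[of _ "\<lambda>z. 1"] flat_algebra.const) auto
next
  case (left m)
  have "(\<lambda>z. flat (m + 2) z - real m * flat (m + 1) z) \<in> flat_algebra"
    by (intro flat_algebra_diff flat_algebra.mult flat_algebra.const flat_algebra.left)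
  then show ?case using DERIV_flat[of m] by (intro bexI[of _ "\<lambda>z. flat (m + 2) z - real m * flat (m + 1) z"]) auto
next
  case (right m)
  have "(\<lambda>z. (flat (m + 2) (1 - z) - real m * flat (m + 1) (1 - z)) * (- 1)) \<in> flat_algebra"
    by (intro flat_algebra_diff flat_algebra.mult flat_algebra.const flat_algebra.right)
  moreover have "((\<lambda>z. flat m (1 - z)) has_real_derivative
      (flat (m + 2) (1 - z) - real m * flat (m + 1) (1 - z)) * (- 1)) (at z)" for z
    by (rule DERIV_chain2[OF DERIV_flat]) (auto intro!: derivative_eq_intros)
  ultimately show ?case
    by (intro bexI[of _ "\<lambda>z. (flat (m + 2) (1 - z) - real m * flat (m + 1) (1 - z)) * (- 1)"]) auto
next
  case (add f g)
  then obtain f' g' where f': "f' \<in> flat_algebra" "g' \<in> flat_algebra"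
    "\<And>z. (f has_real_derivative f' z) (at z)" "\<And>z. (g has_real_derivative g' z) (at z)" by blast
  then show ?case
    by (intro bexI[of _ "\<lambda>z. f' z + g' z"] flat_algebra.add) (auto intro: DERIV_add)
next
  case (mult f g)
  then obtain f' g' where f': "f' \<in> flat_algebra" "g' \<in> flat_algebra"
    "\<And>z. (f has_real_derivative f' z) (at z)" "\<And>z. (g has_real_derivative g' z) (at z)" by blast
  then show ?case using mult(1,2)
    by (intro bexI[of _ "\<lambda>z. f' z * g z + g' z * f z"] flat_algebra.add flat_algebra.mult) (auto intro: DERIV_mult)
qed

lemma flat_algebra_smooth:
  assumes "h \<in> flat_algebra" "open S" "smooth_on S g"
  shows "smooth_on S (\<lambda>x. h (g x))"
  using assms(1)
proof (induction rule: flat_algebra.induct)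
  case (right m)
  have "smooth_on S (\<lambda>x. 1 - g x)" using assms by auto
  then show ?case using Ck_on_flat[OF assms(2)] unfolding smooth_on_def by blast
qed (use assms Ck_on_flat[OF assms(2)] in \<open>auto simp: smooth_on_def Ck_on_const Ck_on_add Ck_on_mult\<close>)

definition bump :: "(real \<Rightarrow> real) \<Rightarrow> bool" where
  "bump h \<longleftrightarrow> h \<in> flat_algebra \<and> (\<forall>z. z < 0 \<or> z > 1 \<longrightarrow> h z = 0)"

lemma bump_mult: "bump h \<Longrightarrow> k \<in> flat_algebra \<Longrightarrow> bump (\<lambda>z. h z * k z)"
  unfolding bump_def by (auto intro: flat_algebra.mult)

lemma bump_DERIV:
  assumes "bump h"
  obtains h' where "bump h'" "\<And>z. (h has_real_derivative h' z) (at z)"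
proof -
  obtain h' where h': "h' \<in> flat_algebra" "\<And>z. (h has_real_derivative h' z) (at z)"
    using flat_algebra_DERIV assms unfolding bump_def by blast
  have "h' z = 0" if "z \<in> {..<0} \<union> {1<..}" for z
  proof -
    have "((\<lambda>z. 0) has_real_derivative 0) (at z)" by simp
    then have "(h has_real_derivative 0) (at z)"
      by (rule has_field_derivative_transform_within_open[OF _ _ that]) (use assms in \<open>auto simp: bump_def\<close>)
    then show ?thesis using h'(2) DERIV_unique by blast
  qed
  then have "bump h'" using h'(1) unfolding bump_def by auto
  then show thesis using h'(2) that by blast
qed

lemma bump_continuous:
  assumes "bump h"
  shows "continuous_on UNIV h"
proof -
  obtain h' where "\<And>z. (h has_real_derivative h' z) (at z)" using bump_DERIV[OF assms] by blast
  then show ?thesis by (intro DERIV_continuous_on) blast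
qed

section \<open>Logarithmic profiles\<close>

text \<open>The value at \<open>0\<close> is set explicitly because \<open>ln 0 = 0\<close>.\<close>

definition profile :: "(real \<Rightarrow> real) \<Rightarrow> real \<Rightarrow> real \<Rightarrow> real ^ 'n \<Rightarrow> real" where
  "profile h A a x = (if x = 0 then 0 else h ((ln (norm x) + A) / a))"

lemma profile_near: "bump h \<Longrightarrow> a > 0 \<Longrightarrow> norm x < exp (- A) \<Longrightarrow> profile h A a x = 0"
proof (cases "x = 0")
  case False
  assume *: "bump h" "a > 0" "norm x < exp (- A)"
  then have "ln (norm x) < - A" using False by (metis ln_exp ln_less_cancel_iff exp_gt_zero zero_less_norm_iff)
  then have "(ln (norm x) + A) / a < 0" using * by (simp add: divide_neg_pos)
  then show ?thesis using * by (simp add: profile_def bump_def)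
qed (simp add: profile_def)

lemma profile_far: "bump h \<Longrightarrow> a > 0 \<Longrightarrow> norm x > exp (a - A) \<Longrightarrow> profile h A a x = 0"
proof (cases "x = 0")
  case False
  assume *: "bump h" "a > 0" "norm x > exp (a - A)"
  then have "ln (norm x) > a - A" using False by (metis ln_exp ln_less_cancel_iff exp_gt_zero zero_less_norm_iff)
  then have "(ln (norm x) + A) / a > 1" using * by simp
  then show ?thesis using * by (simp add: profile_def bump_def)
qed (simp add: profile_def)

lemma profile_test:
  assumes h: "bump h" and a: "a > 0"
  shows "profile h A a \<in> test_functions 0"
  unfolding test_functions_iff
proof (intro conjI)
  have "smooth_on (- {0}) (\<lambda>x :: real ^ 'n. (ln (norm x) + A) / a)"
    using a by (intro smooth_on_divide smooth_on_add smooth_on_ln smooth_on_norm smooth_on_const) auto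
  then have "smooth_on (- {0}) (\<lambda>x :: real ^ 'n. h ((ln (norm x) + A) / a))"
    using h by (intro flat_algebra_smooth[where h = h]) (auto simp: bump_def)
  then have 1: "smooth_on (- {0}) (profile h A a :: real ^ 'n \<Rightarrow> real)"
    by (subst smooth_on_cong[of "- {0}" _ "\<lambda>x. h ((ln (norm x) + A) / a)"]) (simp_all add: profile_def open_Compl)
  have 2: "smooth_on (ball 0 (exp (- A))) (profile h A a :: real ^ 'n \<Rightarrow> real)"
    by (subst smooth_on_cong[of "ball 0 (exp (- A))" _ "\<lambda>x. 0"]) (simp_all add: profile_near[OF h a] smooth_on_const)
  have "smooth_on (- {0} \<union> ball 0 (exp (- A))) (profile h A a :: real ^ 'n \<Rightarrow> real)"
    by (rule smooth_on_glue[OF _ open_ball 1 2]) (simp add: open_Compl)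
  moreover have "- {0} \<union> ball (0 :: real ^ 'n) (exp (- A)) = UNIV" by auto
  ultimately show "smooth_on UNIV (profile h A a :: real ^ 'n \<Rightarrow> real)" by metis
  show "bounded_supp (profile h A a :: real ^ 'n \<Rightarrow> real)"
    unfolding bounded_supp_def using profile_far[OF h a] by blast
  show "\<exists>e>0. \<forall>x :: real ^ 'n. dist x 0 < e \<longrightarrow> profile h A a x = 0"
    using profile_near[OF h a] by (intro exI[of _ "exp (- A)"]) auto
qed

text \<open>In the variable \<open>ln (norm x)\<close> the Euler field is plain differentiation, and
  the chain rule contributes \<open>1 / a\<close>.\<close>

lemma D_profile:
  fixes x :: "real ^ 'n"
  assumes h: "bump h" and h': "\<And>z. (h has_real_derivative h' z) (at z)" and a: "a > 0"
  shows "D (profile h A a) x x = 1 / a * profile h' A a x"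
proof (cases "x = 0")
  case True
  have "D (profile h A a) x 0 = 0"
    by (rule linear_0[OF linear_frechet_derivative[OF test_functions_differentiable[OF profile_test[OF h a]]]])
  then show ?thesis using True by (simp add: profile_def)
next
  case False
  have "(norm has_derivative (\<lambda>v. v \<bullet> sgn x)) (at x)"
    by (rule has_derivative_norm[OF False])
  then have "((\<lambda>x. (ln (norm x) + A) / a) has_derivative (\<lambda>v. (v \<bullet> sgn x) * (inverse (norm x) / a))) (at x)"
    by (rule DERIV_compose_FDERIV[rotated]) (use False a in \<open>auto intro!: derivative_eq_intros simp: field_simps\<close>)
  from DERIV_compose_FDERIV[OF h' this]
  have "((\<lambda>x. h ((ln (norm x) + A) / a)) has_derivative
      (\<lambda>v. (v \<bullet> sgn x) * (inverse (norm x) / a) * h' ((ln (norm x) + A) / a))) (at x)" .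
  then have "(profile h A a has_derivative
      (\<lambda>v. (v \<bullet> sgn x) * (inverse (norm x) / a) * h' ((ln (norm x) + A) / a))) (at x)"
    by (rule has_derivative_transform_within_open[of _ _ _ _ "- {0}"]) (use False in \<open>auto simp: profile_def\<close>)
  from frechet_derivative_at[OF this, symmetric]
  have "D (profile h A a) x x = (x \<bullet> sgn x) * (inverse (norm x) / a) * h' ((ln (norm x) + A) / a)"
    by simp
  also have "x \<bullet> sgn x = norm x"
    using False by (simp add: sgn_div_norm power2_eq_square flip: power2_norm_eq_inner)
  also have "norm x * (inverse (norm x) / a) * h' ((ln (norm x) + A) / a) = 1 / a * profile h' A a x"
    using False by (simp add: profile_def)
  finally show ?thesis .
qed

definition J :: "(real ^ 'n \<Rightarrow> real) \<Rightarrow> real" where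
  "J f = (\<integral>x. inverse (norm x ^ CARD('n)) * f x \<partial>lborel)"

lemma smooth_on_inverse_norm: "smooth_on (- {0}) (\<lambda>x :: real ^ 'n. inverse (norm x ^ k))"
  using smooth_on_const_div_norm_power[of "- {0}" 1 k] by (simp add: inverse_eq_divide open_Compl)

lemma J_integrable: "f \<in> test_functions 0 \<Longrightarrow> integrable lborel (\<lambda>x. inverse (norm x ^ k) * f x)"
  by (intro test_functions_integrable[of _ 0] test_functions_weight smooth_on_inverse_norm)

lemma J_linear:
  assumes "f \<in> test_functions 0" "g \<in> test_functions 0" "h \<in> test_functions 0"
  shows "J (\<lambda>x. a * f x + b * g x + c * h x) = a * J f + b * J g + c * J h"
proof -
  have "J (\<lambda>x. a * f x + b * g x + c * h x) = (\<integral>x. a * (inverse (norm x ^ CARD('a)) * f x)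
      + b * (inverse (norm x ^ CARD('a)) * g x) + c * (inverse (norm x ^ CARD('a)) * h x) \<partial>lborel)"
    unfolding J_def by (intro Bochner_Integration.integral_cong refl) (simp add: algebra_simps)
  also have "\<dots> = a * J f + b * J g + c * J h"
    unfolding J_def using J_integrable[OF assms(1)] J_integrable[OF assms(2)] J_integrable[OF assms(3)]
    by (simp only: Bochner_Integration.integral_add Bochner_Integration.integrable_add
        integrable_mult_right integral_mult_right_zero)
  finally show ?thesis .
qed

text \<open>The Euler field is divergence free for the measure \<open>dx / |x|^N\<close>: the power
  contributes \<open>- N\<close>, which cancels the divergence of \<open>x\<close>.\<close>

lemma J_euler:
  fixes f :: "real ^ 'n \<Rightarrow> real"
  assumes f: "f \<in> test_functions 0"
  shows "J (\<lambda>x. D f x x) = 0"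
proof -
  define N where "N = CARD('n)"
  define g where "g x = inverse (norm x ^ N) * f x" for x :: "real ^ 'n"
  have g: "g \<in> test_functions 0"
    unfolding g_def by (intro test_functions_weight smooth_on_inverse_norm f)
  have "inverse (norm x ^ N) * D f x x = D g x x + real N * g x" for x
  proof (cases "x = 0")
    case True
    then show ?thesis
      using linear_0[OF linear_frechet_derivative[OF test_functions_differentiable[OF f]]]
        linear_0[OF linear_frechet_derivative[OF test_functions_differentiable[OF g]]] test_functions_eq_0_at_pole[OF g]
      by simp
  next
    case False
    have "(norm has_derivative (\<lambda>v. v \<bullet> sgn x)) (at x)"
      by (rule has_derivative_norm[OF False])
    then have i: "((\<lambda>x. inverse (norm x ^ N)) has_derivative (\<lambda>v. (v \<bullet> sgn x) * (- real N * inverse (norm x ^ N) / norm x))) (at x)"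
    proof (rule DERIV_compose_FDERIV[rotated])
      show "((\<lambda>s. inverse (s ^ N)) has_real_derivative - real N * inverse (norm x ^ N) / norm x) (at (norm x))"
      proof -
        have "((\<lambda>s. s ^ N) has_real_derivative real N * (1 * norm x ^ (N - Suc 0))) (at (norm x))"
          by (rule DERIV_power) simp
        then show ?thesis
          by (rule DERIV_cong[OF DERIV_inverse_fun]) (use False in \<open>cases N; simp add: field_simps\<close>)+
      qed
    qed
    have "x \<bullet> sgn x = norm x"
      using False by (simp add: sgn_div_norm power2_eq_square flip: power2_norm_eq_inner)
    then have Di: "D (\<lambda>x. inverse (norm x ^ N)) x x = - real N * inverse (norm x ^ N)"
      unfolding frechet_derivative_at[OF i, symmetric] using False by simp
    have "(\<lambda>x :: real ^ 'n. inverse (norm x ^ N)) differentiable (at x)"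
      using i differentiable_def by blast
    then have "D g x x = inverse (norm x ^ N) * D f x x + D (\<lambda>x. inverse (norm x ^ N)) x x * f x"
      using test_functions_differentiable[OF f] unfolding g_def by (intro D_mult)
    then show ?thesis unfolding Di g_def by simp
  qed
  then show ?thesis
    unfolding J_def N_def[symmetric] using integral_euler[OF g] by (simp add: N_def)
qed

text \<open>
  In the variable \<open>\<tau> = ln (norm x)\<close> the measure \<open>dx / norm x ^ CARD('n)\<close> is translation invariant,
  so it is a multiple of \<open>d\<tau>\<close> and scales accordingly.
\<close>

lemma J_profile_scale:
  assumes h: "bump h" and a: "a > 0"
  shows "J (profile h A a :: real ^ 'n \<Rightarrow> real) = a * J (profile h 0 1 :: real ^ 'n \<Rightarrow> real)"
proof -
  obtain h' where h': "bump h'" "\<And>z. (h has_real_derivative h' z) (at z)" using bump_DERIV[OF h] by blast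
  \<comment> \<open>A segment in parameter space from scale 1 and shift 0 to scale \<open>a\<close>
    and shift \<open>A\<close>; the scale stays positive along it.\<close>
  define \<alpha> \<beta> where "\<alpha> \<theta> = 1 + \<theta> * (a - 1)" and "\<beta> \<theta> = \<theta> * A" for \<theta> :: real
  have \<alpha>: "\<alpha> \<theta> > 0" "\<alpha> \<theta> \<le> 1 + a" if "\<theta> \<in> {0..1}" for \<theta>
  proof -
    have "\<alpha> \<theta> = (1 - \<theta>) * 1 + \<theta> * a" by (simp add: \<alpha>_def algebra_simps)
    moreover have "(1 - \<theta>) * 1 + \<theta> * a > 0"
      using that a by (cases "\<theta> = 0") (auto intro!: add_nonneg_pos)
    moreover have "\<theta> * a \<le> 1 * a" using that a by (intro mult_right_mono) auto
    ultimately show "\<alpha> \<theta> > 0" "\<alpha> \<theta> \<le> 1 + a" using that by auto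
  qed
  have \<beta>: "\<bar>\<beta> \<theta>\<bar> \<le> \<bar>A\<bar>" if "\<theta> \<in> {0..1}" for \<theta>
    using that by (simp add: \<beta>_def abs_mult mult_left_le_one_le)
  \<comment> \<open>Below the radius \<open>\<epsilon>\<close>, and above \<open>b\<close> defined
    later, all profiles of the family vanish, uniformly in \<open>\<theta>\<close>.\<close>
  define \<epsilon> where "\<epsilon> = exp (- \<bar>A\<bar> - 1)"
  have \<epsilon>: "\<epsilon> > 0" "ln \<epsilon> = - \<bar>A\<bar> - 1" by (simp_all add: \<epsilon>_def)
  define z where "z \<theta> s = (ln s + \<beta> \<theta>) / \<alpha> \<theta>" for \<theta> s
  \<comment> \<open>Dividing by the scale makes the integral independent of \<open>\<theta>\<close>;
    the claim compares the two ends.\<close>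
  define F where "F \<theta> x = inverse (norm x ^ CARD('n)) * (1 / \<alpha> \<theta> * profile h (\<beta> \<theta>) (\<alpha> \<theta>) x)" for \<theta> and x :: "real ^ 'n"
  define d where "d \<theta> s = (h' (z \<theta> s) * (A - (a - 1) * z \<theta> s) - h (z \<theta> s) * (a - 1)) / (\<alpha> \<theta>)\<^sup>2" for \<theta> s
  define F' where "F' \<theta> x = inverse (norm x ^ CARD('n)) * (if x = 0 then 0 else d \<theta> (norm x))" for \<theta> and x :: "real ^ 'n"
  have small: "d \<theta> s = 0" if "\<theta> \<in> {0..1}" "0 < s" "s \<le> \<epsilon>" for \<theta> s
  proof -
    have "ln s \<le> ln \<epsilon>" using that \<epsilon>(1) by simp
    then have "ln s + \<beta> \<theta> < 0" using \<beta>[OF that(1)] \<epsilon>(2) by linarith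
    then have "z \<theta> s < 0" using \<alpha>[OF that(1)] by (simp add: z_def divide_neg_pos)
    then show ?thesis using h h'(1) by (simp add: d_def bump_def)
  qed
  define b where "b = exp (1 + a + \<bar>A\<bar>)"
  have large: "z \<theta> s > 1" if "\<theta> \<in> {0..1}" "s > b" for \<theta> s
  proof -
    have "s > 0" using that(2) unfolding b_def by (meson exp_gt_zero less_trans)
    then have "ln s > 1 + a + \<bar>A\<bar>" using that(2) unfolding b_def by (metis ln_exp ln_less_cancel_iff exp_gt_zero)
    then have "ln s + \<beta> \<theta> > \<alpha> \<theta>" using \<alpha>[OF that(1)] \<beta>[OF that(1)] by linarith
    then show ?thesis using \<alpha>[OF that(1)] by (simp add: z_def)
  qed
  have bpos: "b > 0" by (simp add: b_def)
  have "(\<integral>x. F 1 x \<partial>lborel) = (\<integral>x. F 0 x \<partial>lborel)"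
  proof (rule integral_parameter_constant[where F' = F' and b = b])
    fix \<theta> :: real and x :: "real ^ 'n" assume \<theta>: "\<theta> \<in> {0..1}"
    show "((\<lambda>\<theta>. F \<theta> x) has_real_derivative F' \<theta> x) (at \<theta> within {0..1})"
    proof (cases "x = 0")
      case False
      have z: "((\<lambda>\<theta>. z \<theta> (norm x)) has_real_derivative (A - (a - 1) * z \<theta> (norm x)) / \<alpha> \<theta>) (at \<theta>)"
        using \<alpha>[OF \<theta>] unfolding z_def \<alpha>_def \<beta>_def
        by (auto intro!: derivative_eq_intros simp: field_simps power2_eq_square)
      have "((\<lambda>\<theta>. 1 / \<alpha> \<theta>) has_real_derivative - (a - 1) / (\<alpha> \<theta>)\<^sup>2) (at \<theta>)"
        using \<alpha>[OF \<theta>] unfolding \<alpha>_def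
        by (auto intro!: derivative_eq_intros simp: field_simps power2_eq_square)
      from DERIV_cmult[OF DERIV_mult[OF this DERIV_chain2[OF h'(2) z]], of "inverse (norm x ^ CARD('n))"]
      have "((\<lambda>\<theta>. inverse (norm x ^ CARD('n)) * (1 / \<alpha> \<theta> * h (z \<theta> (norm x)))) has_real_derivative F' \<theta> x) (at \<theta>)"
        by (rule DERIV_cong) (use False \<alpha>[OF \<theta>] in \<open>simp add: F'_def d_def power2_eq_square field_simps\<close>)
      then show ?thesis
        using False by (simp add: F_def profile_def z_def has_field_derivative_at_within)
    qed (simp add: F_def F'_def profile_def)
  next
    show "continuous_on UNIV (F \<theta>)" if "\<theta> \<in> {0..1}" for \<theta>
    proof -
      have "(\<lambda>x :: real ^ 'n. inverse (norm x ^ CARD('n)) * (1 / \<alpha> \<theta> * profile h (\<beta> \<theta>) (\<alpha> \<theta>) x)) \<in> test_functions 0"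
        by (intro test_functions_weight smooth_on_inverse_norm test_functions_cmult profile_test h \<alpha> that)
      then show ?thesis unfolding F_def [abs_def] by (intro smooth_on_continuous test_functions_smooth)
    qed
    \<comment> \<open>Clamping the norm at \<open>\<epsilon>\<close> changes nothing, since
      \<open>d\<close> vanishes up to there, and it removes the singularity, which gives joint
      continuity.\<close>
    have eq: "F' \<theta> x = inverse (max \<epsilon> (norm x) ^ CARD('n)) * d \<theta> (max \<epsilon> (norm x))" if "\<theta> \<in> {0..1}" for \<theta> x
    proof (cases "norm x \<le> \<epsilon>")
      case True
      then show ?thesis
        using small[OF that, of "norm x"] small[OF that \<epsilon>(1) order_refl] by (auto simp: F'_def max_def)
    next
      case False
      then show ?thesis using \<epsilon>(1) by (auto simp: F'_def max_def)
    qed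
    have \<alpha>nz: "1 + \<theta> * (a - 1) \<noteq> 0" if "0 \<le> \<theta>" "\<theta> \<le> 1" for \<theta>
      using \<alpha>(1)[of \<theta>] that by (simp add: \<alpha>_def)
    have cz: "continuous_on ({0..1} \<times> UNIV) (\<lambda>p :: real \<times> (real ^ 'n). z (fst p) (max \<epsilon> (norm (snd p))))"
      unfolding z_def \<alpha>_def \<beta>_def using \<epsilon>(1) \<alpha>nz
      by (intro continuous_intros) (auto simp: max_def)
    have "continuous_on ({0..1} \<times> UNIV) (\<lambda>p :: real \<times> (real ^ 'n). inverse (max \<epsilon> (norm (snd p)) ^ CARD('n)) * d (fst p) (max \<epsilon> (norm (snd p))))"
      unfolding d_def \<alpha>_def
      by (intro continuous_intros cz continuous_on_compose2[OF bump_continuous[OF h] cz]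
          continuous_on_compose2[OF bump_continuous[OF h'(1)] cz])
        (use \<epsilon>(1) \<alpha>nz in \<open>auto simp: max_def\<close>)
    then show "continuous_on ({0..1} \<times> UNIV) (\<lambda>(\<theta>, x). F' \<theta> x)"
      by (rule continuous_on_eq) (auto simp: eq)
    show "F \<theta> x = 0" if "\<theta> \<in> {0..1}" "norm x > b" for \<theta> and x :: "real ^ 'n"
      using large[OF that] h by (auto simp: F_def profile_def z_def bump_def)
    show "F' \<theta> x = 0" if "\<theta> \<in> {0..1}" "norm x > b" for \<theta> and x :: "real ^ 'n"
      using large[OF that] h h'(1) by (auto simp: F'_def d_def bump_def)
  next
    fix \<theta> :: real assume \<theta>: "\<theta> \<in> {0..1}"
    \<comment> \<open>\<open>k\<close> is \<open>h\<close> times the velocity of \<open>z\<close> in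
      \<open>\<theta>\<close>. Since \<open>1 / \<alpha> \<theta>\<close> is the derivative of
      \<open>z\<close> in \<open>ln s\<close>, exchanging the two derivatives turns the
      \<open>\<theta>\<close>-derivative of the integrand into the Euler derivative of the profile
      of \<open>k\<close>.\<close>
    define k where "k z = h z * (1 / \<alpha> \<theta> * (A - (a - 1) * z))" for z
    have k: "bump k"
      unfolding k_def [abs_def]
      by (intro bump_mult h flat_algebra.mult flat_algebra_diff flat_algebra.const flat_algebra.ident)
    have k': "(k has_real_derivative (h' z * (A - (a - 1) * z) - h z * (a - 1)) / \<alpha> \<theta>) (at z)" for z
      unfolding k_def using \<alpha>(1)[OF \<theta>]
      by (auto intro!: derivative_eq_intros h'(2) simp: field_simps)
    have "F' \<theta> x = inverse (norm x ^ CARD('n)) * D (profile k (\<beta> \<theta>) (\<alpha> \<theta>)) x x" for x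
      unfolding D_profile[OF k k' \<alpha>(1)[OF \<theta>]]
      by (simp add: F'_def d_def profile_def z_def power2_eq_square)
    then show "(\<integral>x. F' \<theta> x \<partial>lborel) = 0"
      using J_euler[OF profile_test[OF k \<alpha>(1)[OF \<theta>]], of "\<beta> \<theta>"] unfolding J_def by simp
  qed
  moreover have "(\<integral>x. F 1 x \<partial>lborel) = 1 / a * J (profile h A a :: real ^ 'n \<Rightarrow> real)"
    unfolding F_def J_def \<alpha>_def \<beta>_def by (simp add: mult.left_commute[of "inverse _"])
  moreover have "(\<integral>x. F 0 x \<partial>lborel) = J (profile h 0 1 :: real ^ 'n \<Rightarrow> real)"
    unfolding F_def J_def \<alpha>_def \<beta>_def by simp
  ultimately show ?thesis using a by (simp add: field_simps)
qed

text \<open>A continuous nonnegative function with zero integral vanishes almost everywhere, so the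
  open set where it is positive would be negligible and hence empty.\<close>

lemma J_profile_square_pos:
  assumes h: "bump h" and z: "h z \<noteq> 0"
  shows "J (profile (\<lambda>z. h z * h z) 0 1 :: real ^ 'n \<Rightarrow> real) > 0"
proof -
  have hh: "bump (\<lambda>z. h z * h z)" using h by (intro bump_mult) (auto simp: bump_def)
  define f where "f x = inverse (norm x ^ CARD('n)) * profile (\<lambda>z. h z * h z) 0 1 x" for x :: "real ^ 'n"
  have f: "f \<in> test_functions 0"
    unfolding f_def by (intro test_functions_weight smooth_on_inverse_norm profile_test hh) auto
  have nonneg: "f x \<ge> 0" for x by (simp add: f_def profile_def)
  fix i :: 'n
  \<comment> \<open>At a point of norm \<open>exp z\<close> the profile with shift 0 and scale 1
    takes its value from the argument \<open>z\<close>.\<close>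
  have "norm (exp z *\<^sub>R axis i (1 :: real)) = exp z" by (simp add: norm_axis_1)
  then have x: "f (exp z *\<^sub>R axis i 1) > 0"
    using z by (simp add: f_def profile_def flip: power2_eq_square)
  have open_pos: "open {x. f x > 0}"
    by (intro open_Collect_less continuous_on_const smooth_on_continuous test_functions_smooth[OF f])
  have "(\<integral>x. f x \<partial>lborel) \<noteq> 0"
  proof
    assume "(\<integral>x. f x \<partial>lborel) = 0"
    then have "AE x in lborel. f x = 0"
      using integral_nonneg_eq_0_iff_AE[OF test_functions_integrable[OF f]] nonneg by simp
    then have "AE x in lborel. x \<notin> {x. f x > 0}" by (rule AE_mp) auto
    then have "{x. f x > 0} \<in> null_sets lborel"
      using open_pos by (intro AE_iff_null_sets[THEN iffD2]) auto
    then have "negligible {x. f x > 0}"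
      using negligible_iff_null_sets null_sets_completionI by blast
    then show False using open_not_negligible[OF open_pos] x by blast
  qed
  moreover have "(\<integral>x. f x \<partial>lborel) \<ge> 0" using nonneg by simp
  ultimately show ?thesis unfolding J_def f_def by simp
qed

section \<open>Sharpness of the constant\<close>

lemma D_cmult: "f differentiable (at x) \<Longrightarrow> D (\<lambda>y. c * f y) x v = c * D f x v"
  by (simp add: D_mult)

lemma D_norm_powr_mult:
  assumes f: "f \<in> test_functions 0"
  shows "D (\<lambda>x. norm x powr \<kappa> * f x) x x = norm x powr \<kappa> * (\<kappa> * f x + D f x x)"
    "(\<lambda>x. norm x powr \<kappa> * f x) \<in> test_functions 0"
proof -
  have "smooth_on (- {0}) (\<lambda>x :: real ^ 'a. norm x powr \<kappa>)"
    by (intro smooth_on_powr smooth_on_norm) (auto simp: open_Compl)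
  then show t: "(\<lambda>x. norm x powr \<kappa> * f x) \<in> test_functions 0"
    by (rule test_functions_weight[OF _ f])
  show "D (\<lambda>x. norm x powr \<kappa> * f x) x x = norm x powr \<kappa> * (\<kappa> * f x + D f x x)"
  proof (cases "x = 0")
    case True
    then show ?thesis
      using linear_0[OF linear_frechet_derivative[OF test_functions_differentiable[OF t]]] by simp
  next
    case False
    have "(norm has_derivative (\<lambda>v. v \<bullet> sgn x)) (at x)"
      by (rule has_derivative_norm[OF False])
    from DERIV_compose_FDERIV[OF has_real_derivative_powr this, of \<kappa>]
    have i: "((\<lambda>x. norm x powr \<kappa>) has_derivative (\<lambda>v. (v \<bullet> sgn x) * (\<kappa> * norm x powr (\<kappa> - 1)))) (at x)"
      using False by simp
    have "x \<bullet> sgn x = norm x"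
      using False by (simp add: sgn_div_norm power2_eq_square flip: power2_norm_eq_inner)
    then have Di: "D (\<lambda>x. norm x powr \<kappa>) x x = \<kappa> * norm x powr \<kappa>"
      unfolding frechet_derivative_at[OF i, symmetric] using False by (simp add: powr_diff)
    have "(\<lambda>x :: real ^ 'a. norm x powr \<kappa>) differentiable (at x)"
      using i differentiable_def by blast
    then have "D (\<lambda>x. norm x powr \<kappa> * f x) x x = norm x powr \<kappa> * D f x x + D (\<lambda>x. norm x powr \<kappa>) x x * f x"
      using test_functions_differentiable[OF f] by (intro D_mult)
    then show ?thesis unfolding Di by (simp add: algebra_simps)
  qed
qed

text \<open>Since \<open>coth^2 r = 1 / |x|^2 + 1\<close>, writing \<open>rd\<close> as
  \<open>coth r\<close> times the Euler field splits the radial Laplacian into its Euclidean form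
  and a correction smaller by the factor \<open>|x|^2\<close> near the pole.\<close>

lemma radial_laplacian_euler:
  fixes v :: "real ^ 'n \<Rightarrow> real"
  assumes v: "v \<in> test_functions 0" and x: "x \<noteq> 0"
  shows "radial_laplacian 0 v x =
    1 / (norm x)\<^sup>2 * (D (\<lambda>x. D v x x) x x + (real CARD('n) - 2) * D v x x)
    + (D (\<lambda>x. D v x x) x x + (real CARD('n) - 1) * D v x x)"
proof -
  define E where "E x = D v x x" for x
  define X where "X = coth (hyp_dist 0 x)"
  have E: "E \<in> test_functions 0"
    unfolding E_def [abs_def] by (intro test_functions_D v) auto
  have rdv: "rd v = (\<lambda>x. coth (hyp_dist 0 x) * E x)"
    using radial_deriv_eq[OF test_functions_differentiable[OF v]] by (auto simp: coth_hyp_dist_0 E_def)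
  have "rd E x = X * D E x x"
    using radial_deriv_eq[OF test_functions_differentiable[OF E]] by (simp add: coth_hyp_dist_0 X_def)
  with DERIV_mult[OF radial_weight_DERIV[OF x has_derivative_coth[OF hyp_dist_0_pos[OF x]]]
      radial_deriv_DERIV[OF x test_functions_differentiable[OF E]]]
  have "rd (rd v) x = (1 - X\<^sup>2) * E x + X * D E x x * X"
    unfolding rdv by (intro radial_deriv_eqI) (simp add: X_def hyp_geodesic_hyp_dist[OF x])
  then have "radial_laplacian 0 v x = (1 - X\<^sup>2) * E x + X\<^sup>2 * (D E x x + (real CARD('n) - 1) * E x)"
    unfolding radial_laplacian_0 by (simp add: rdv X_def[symmetric] power2_eq_square algebra_simps)
  also have "X\<^sup>2 = 1 / (norm x)\<^sup>2 + 1"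
  proof -
    have "X\<^sup>2 = (1 + x \<bullet> x) / (norm x)\<^sup>2" unfolding X_def coth_hyp_dist_0 power_divide ht_square ..
    then show ?thesis using x by (simp add: add_divide_distrib power2_norm_eq_inner)
  qed
  also have "(1 - (1 / (norm x)\<^sup>2 + 1)) * E x + (1 / (norm x)\<^sup>2 + 1) * (D E x x + (real CARD('n) - 1) * E x) =
      1 / (norm x)\<^sup>2 * (D E x x + (real CARD('n) - 2) * E x) + (D E x x + (real CARD('n) - 1) * E x)"
    by (simp add: algebra_simps)
  finally show ?thesis unfolding E_def .
qed

text \<open>Up to a common power of the norm, \<open>\<alpha>\<close> will be the Euclidean part of
  the radial Laplacian, and \<open>t = |x|^2\<close> the size of the hyperbolic correction.\<close>

lemma square_perturbation:
  fixes \<alpha> g \<delta> t :: real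
  assumes t: "0 \<le> t" "t \<le> \<delta>" and \<delta>: "\<delta> \<le> 1"
  shows "(\<alpha> + t * (\<alpha> + g))\<^sup>2 \<le> (1 + 5 * \<delta>) * \<alpha>\<^sup>2 + 3 * \<delta> * g\<^sup>2"
proof -
  have "(\<alpha> + t * (\<alpha> + g))\<^sup>2 = \<alpha>\<^sup>2 + t * (2 * \<alpha>\<^sup>2 + 2 * \<alpha> * g) + t * (t * (\<alpha> + g)\<^sup>2)"
    by (simp add: power2_eq_square algebra_simps)
  also have "2 * \<alpha> * g \<le> \<alpha>\<^sup>2 + g\<^sup>2" by (rule sum_squares_bound)
  then have "t * (2 * \<alpha>\<^sup>2 + 2 * \<alpha> * g) \<le> t * (3 * \<alpha>\<^sup>2 + g\<^sup>2)"
    using t by (intro mult_left_mono) auto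
  also have "t * (t * (\<alpha> + g)\<^sup>2) \<le> t * (2 * \<alpha>\<^sup>2 + 2 * g\<^sup>2)"
  proof (intro mult_left_mono t)
    have "t * (\<alpha> + g)\<^sup>2 \<le> 1 * (\<alpha> + g)\<^sup>2" using t \<delta> by (intro mult_right_mono) auto
    also have "\<dots> \<le> 2 * \<alpha>\<^sup>2 + 2 * g\<^sup>2" using sum_squares_bound[of \<alpha> g] by (simp add: power2_sum)
    finally show "t * (\<alpha> + g)\<^sup>2 \<le> 2 * \<alpha>\<^sup>2 + 2 * g\<^sup>2" .
  qed
  finally have "(\<alpha> + t * (\<alpha> + g))\<^sup>2 \<le> \<alpha>\<^sup>2 + t * (3 * \<alpha>\<^sup>2 + g\<^sup>2) + t * (2 * \<alpha>\<^sup>2 + 2 * g\<^sup>2)" by simp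
  also have "\<dots> = \<alpha>\<^sup>2 + t * (5 * \<alpha>\<^sup>2 + 3 * g\<^sup>2)" by (simp add: algebra_simps)
  also have "\<dots> \<le> \<alpha>\<^sup>2 + \<delta> * (5 * \<alpha>\<^sup>2 + 3 * g\<^sup>2)" using t by (intro add_left_mono mult_right_mono) auto
  finally show ?thesis by (simp add: algebra_simps)
qed

lemma bump_exists:
  obtains h h' h'' where "bump h" "bump h'" "bump h''"
    "\<And>z. (h has_real_derivative h' z) (at z)" "\<And>z. (h' has_real_derivative h'' z) (at z)"
    "\<exists>z. h z \<noteq> 0" "\<exists>z. h' z \<noteq> 0"
proof -
  define h where "h z = flat 0 z * flat 0 (1 - z)" for z
  have h: "bump h"
    unfolding bump_def
  proof
    show "h \<in> flat_algebra"
      unfolding h_def [abs_def] by (intro flat_algebra.mult flat_algebra.left flat_algebra.right)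
  qed (simp add: h_def flat_def)
  obtain h' where h': "bump h'" "\<And>z. (h has_real_derivative h' z) (at z)" using bump_DERIV[OF h] by blast
  obtain h'' where h'': "bump h''" "\<And>z. (h' has_real_derivative h'' z) (at z)" using bump_DERIV[OF h'(1)] by blast
  have 0: "h 0 = 0" and 1: "h (1 / 2) > 0" by (simp_all add: h_def flat_def)
  \<comment> \<open>\<open>h\<close> rises from 0 to a positive value at \<open>1 / 2\<close>, so
    its derivative cannot vanish throughout.\<close>
  obtain z where "h (1 / 2) - h 0 = (1 / 2 - 0) * h' z"
    using MVT2[of 0 "1 / 2" h h'] h'(2) by auto
  then have "h' z \<noteq> 0" using 0 1 by auto
  then show thesis using that h h' h'' 1 by (metis less_irrefl)
qed

lemma hyp_dist_0_le: "hyp_dist 0 x \<le> norm x"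
proof (cases "x = 0")
  case False
  have "(\<lambda>r :: real. sinh r - r) 0 \<le> (\<lambda>r. sinh r - r) (hyp_dist 0 x)"
  proof (rule DERIV_nonneg_imp_nondecreasing[where f = "\<lambda>r. sinh r - r"])
    show "\<exists>y. ((\<lambda>r :: real. sinh r - r) has_real_derivative y) (at t) \<and> 0 \<le> y" for t
      by (rule exI[of _ "cosh t - 1"]) (auto intro!: derivative_eq_intros simp: cosh_real_ge_1)
  qed (use hyp_dist_0_pos[OF False] in auto)
  then show ?thesis by (simp add: hyp_dist_0(2))
qed (simp add: hyp_dist_0(3))

text \<open>
  Trial functions \<open>norm x powr (2 - N / 2) * h ((ln (norm x) + A) / a)\<close>: the exponent makes the
  Euclidean Hardy quotient scale invariant, \<open>a \<longlonglongrightarrow> \<infinity>\<close> removes the cost of the cutoff, and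
  \<open>A \<longlonglongrightarrow> \<infinity>\<close> moves the support to the pole, where the geometry becomes Euclidean.
\<close>

lemma radial_constant_le:
  assumes ineq: "\<And>v :: real ^ 'n \<Rightarrow> real. v \<in> test_functions 0 \<Longrightarrow> radial v \<Longrightarrow>
    C * (\<integral>x. 1 / (hyp_dist 0 x)\<^sup>2 * (rd v x)\<^sup>2 \<partial>hyp_volume) \<le> (\<integral>x. (radial_laplacian 0 v x)\<^sup>2 \<partial>hyp_volume)"
  shows "C \<le> (real CARD('n) / 2)\<^sup>2"
proof (cases "C \<ge> 0")
  \<comment> \<open>For \<open>C \<ge> 0\<close> the lower estimate of the gradient integral may be
    multiplied by \<open>C\<close>; a negative \<open>C\<close> is below any square.\<close>
  case C: True
  define N where "N = real CARD('n)"
  define \<kappa> where "\<kappa> = 2 - N / 2"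
  obtain h h' h'' where h: "bump h" "bump h'" "bump h''"
    and dh: "\<And>z. (h has_real_derivative h' z) (at z)" "\<And>z. (h' has_real_derivative h'' z) (at z)"
    and nz: "\<exists>z. h z \<noteq> 0" "\<exists>z. h' z \<noteq> 0" using bump_exists by blast
  have sq: "bump (\<lambda>z. f z * f z)" if "bump f" for f
    using that by (intro bump_mult) (auto simp: bump_def)
  define j where "j f = J (profile (\<lambda>z. f z * f z) 0 1 :: real ^ 'n \<Rightarrow> real)" for f
  have j0: "j h > 0" and j1: "j h' > 0"
    using J_profile_square_pos[OF h(1)] J_profile_square_pos[OF h(2)] nz unfolding j_def by blast+
  \<comment> \<open>Bounds the energies of \<open>h'\<close> and \<open>h''\<close> each by that of
    the function before it, so that one factor serves both parts of \<open>g\<close>.\<close>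
  define K where "K = max (j h' / j h) (j h'' / j h')"
  have K: "j h' \<le> K * j h" "j h'' \<le> K * j h'"
    using j0 j1 by (simp_all add: K_def pos_divide_le_eq[symmetric])
  have bound: "C \<le> (1 + 5 * \<delta>) * (K * \<delta>\<^sup>2 + (N / 2)\<^sup>2) + 3 * \<delta>" if \<delta>: "0 < \<delta>" "\<delta> < 1" for \<delta>
  proof -
    \<comment> \<open>The scale \<open>1 / \<delta>\<close> makes the cutoff slow, and the shift
      puts the outer radius of the support at exactly \<open>\<delta>\<close>.\<close>
    define a A where "a = 1 / \<delta>" and "A = a - ln \<delta>"
    have a: "a > 0" using \<delta> by (simp add: a_def)
    have aA: "exp (a - A) = \<delta>" using \<delta> by (simp add: A_def)
    define w where "w f = (profile f A a :: real ^ 'n \<Rightarrow> real)" for f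
    have w: "w f \<in> test_functions 0" if "bump f" for f unfolding w_def by (rule profile_test[OF that a])
    have Dw: "D (w h) x x = 1 / a * w h' x" "D (w h') x x = 1 / a * w h'' x" for x
      unfolding w_def by (rule D_profile[OF h(1) dh(1) a], rule D_profile[OF h(2) dh(2) a])
    \<comment> \<open>For the trial function \<open>v\<close> below, \<open>D v x x\<close> is
      \<open>norm x powr \<kappa>\<close> times \<open>g\<close>, the Euler derivative of
      \<open>g\<close> is \<open>g'\<close>, and the Euclidean radial Laplacian is
      \<open>norm x powr (\<kappa> - 2)\<close> times \<open>\<alpha>\<close>; the coefficient
      \<open>N / 2\<close> in it is \<open>\<kappa> + N - 2\<close>.\<close>
    define g where "g x = \<kappa> * w h x + 1 / a * w h' x" for x
    define g' where "g' x = \<kappa> / a * w h' x + 1 / a\<^sup>2 * w h'' x" for x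
    define \<alpha> where "\<alpha> x = g' x + N / 2 * g x" for x
    have g: "g \<in> test_functions 0" "g' \<in> test_functions 0" "\<alpha> \<in> test_functions 0"
      unfolding g_def g'_def \<alpha>_def by (intro test_functions_add test_functions_cmult w h)+
    note diff = test_functions_differentiable
    have Dg: "D g x x = g' x" for x
    proof -
      have "D g x x = \<kappa> * D (w h) x x + 1 / a * D (w h') x x"
        unfolding g_def [abs_def]
          D_add[OF diff[OF test_functions_cmult[OF w[OF h(1)]]] diff[OF test_functions_cmult[OF w[OF h(2)]]]]
          D_cmult[OF diff[OF w[OF h(1)]]] D_cmult[OF diff[OF w[OF h(2)]]] ..
      then show ?thesis unfolding Dw g'_def by (simp add: power2_eq_square)
    qed
    have D_square: "D (\<lambda>x. f x * f x) x x = 2 * (f x * D f x x)" if "f \<in> test_functions 0" for f :: "real ^ 'n \<Rightarrow> real" and x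
      using diff[OF that] by (simp add: D_mult)
    \<comment> \<open>A function times its Euler derivative is half the Euler derivative of its
      square.\<close>
    have J_cross: "J (\<lambda>x. f x * D f x x) = 0" if "f \<in> test_functions 0" for f :: "real ^ 'n \<Rightarrow> real"
      using J_euler[OF test_functions_mult[OF that that]] unfolding D_square[OF that] J_def
      by (simp add: mult.left_commute[of _ 2])
    have Jw: "J (\<lambda>x. w f x * w f x) = a * j f" if "bump f" for f
    proof -
      have "(\<lambda>x. w f x * w f x) = profile (\<lambda>z. f z * f z) A a"
        by (auto simp: w_def profile_def)
      then show ?thesis using J_profile_scale[OF sq[OF that] a] unfolding j_def by simp
    qed
    have J0: "J (\<lambda>x. w h x * w h' x) = 0" "J (\<lambda>x. w h' x * w h'' x) = 0"
      using J_cross[OF w[OF h(1)]] J_cross[OF w[OF h(2)]] a unfolding Dw J_def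
      by (simp_all add: mult.left_commute[of _ "1 / a"] mult.left_commute[of _ "inverse a"] divide_inverse)
    have tw: "(\<lambda>x. w f x * w k x) \<in> test_functions 0" if "bump f" "bump k" for f k
      by (intro test_functions_mult w that)
    have Jg: "J (\<lambda>x. g x * g x) = \<kappa>\<^sup>2 * (a * j h) + 1 / a\<^sup>2 * (a * j h')"
    proof -
      have *: "(\<lambda>x. g x * g x) = (\<lambda>x. \<kappa>\<^sup>2 * (w h x * w h x) + 2 * \<kappa> / a * (w h x * w h' x) + 1 / a\<^sup>2 * (w h' x * w h' x))"
        using a by (auto simp: g_def power2_eq_square field_simps)
      show ?thesis
        unfolding * J_linear[OF tw[OF h(1,1)] tw[OF h(1,2)] tw[OF h(2,2)]] J0 Jw[OF h(1)] Jw[OF h(2)] by simp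
    qed
    have Jg': "J (\<lambda>x. g' x * g' x) = (\<kappa> / a)\<^sup>2 * (a * j h') + 1 / a ^ 4 * (a * j h'')"
    proof -
      have *: "(\<lambda>x. g' x * g' x) = (\<lambda>x. (\<kappa> / a)\<^sup>2 * (w h' x * w h' x) + 2 * \<kappa> / a ^ 3 * (w h' x * w h'' x) + 1 / a ^ 4 * (w h'' x * w h'' x))"
        using a by (auto simp: g'_def power2_eq_square power3_eq_cube power4_eq_xxxx field_simps)
      show ?thesis
        unfolding * J_linear[OF tw[OF h(2,2)] tw[OF h(2,3)] tw[OF h(3,3)]] J0 Jw[OF h(2)] Jw[OF h(3)] by simp
    qed
    have Jgpos: "J (\<lambda>x. g x * g x) > 0"
      unfolding Jg using a j0 j1 by (intro add_nonneg_pos mult_nonneg_nonneg mult_pos_pos) auto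
    have Jg'_le: "J (\<lambda>x. g' x * g' x) \<le> K / a\<^sup>2 * J (\<lambda>x. g x * g x)"
    proof -
      have "J (\<lambda>x. g' x * g' x) \<le> (\<kappa> / a)\<^sup>2 * (a * (K * j h)) + 1 / a ^ 4 * (a * (K * j h'))"
        unfolding Jg' using K a by (intro add_mono mult_left_mono) auto
      also have "\<dots> = K / a\<^sup>2 * J (\<lambda>x. g x * g x)"
        unfolding Jg using a by (simp add: power2_eq_square power4_eq_xxxx field_simps)
      finally show ?thesis .
    qed
    \<comment> \<open>The cross term integrates to zero; the sharp constant remains, and the
      integral of \<open>g'\<close> squared is an error of order \<open>1 / a^2\<close>.\<close>
    have J\<alpha>: "J (\<lambda>x. \<alpha> x * \<alpha> x) = J (\<lambda>x. g' x * g' x) + (N / 2)\<^sup>2 * J (\<lambda>x. g x * g x)"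
    proof -
      have "(\<lambda>x. \<alpha> x * \<alpha> x) = (\<lambda>x. 1 * (g' x * g' x) + N * (g x * g' x) + (N / 2)\<^sup>2 * (g x * g x))"
        by (auto simp: \<alpha>_def power2_eq_square algebra_simps)
      moreover have "J (\<lambda>x. g x * g' x) = 0" using J_cross[OF g(1)] by (simp add: Dg)
      ultimately show ?thesis
        using J_linear[OF test_functions_mult[OF g(2,2)] test_functions_mult[OF g(1,2)] test_functions_mult[OF g(1,1)], of 1 N "(N / 2)\<^sup>2"]
        by simp
    qed
    define v where "v x = norm x powr \<kappa> * w h x" for x
    have v: "v \<in> test_functions 0" unfolding v_def by (rule D_norm_powr_mult(2)[OF w[OF h(1)]])
    have rad: "radial v"
      unfolding radial_def
    proof (intro allI impI)
      fix x y :: "real ^ 'n" assume "norm x = norm y"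
      moreover from this have "x = 0 \<longleftrightarrow> y = 0" by (metis norm_eq_zero)
      ultimately show "v x = v y" by (simp add: v_def w_def profile_def)
    qed
    have Dv: "D v x x = norm x powr \<kappa> * g x" for x
      using D_norm_powr_mult(1)[OF w[OF h(1)], where x = x and \<kappa> = \<kappa>] unfolding v_def [abs_def] Dw g_def .
    have DDv: "D (\<lambda>x. D v x x) x x = norm x powr \<kappa> * (\<kappa> * g x + g' x)" for x
      using D_norm_powr_mult(1)[OF g(1), where x = x and \<kappa> = \<kappa>] unfolding Dv Dg .
    have zero: "g x = 0 \<and> g' x = 0" if "norm x > \<delta>" for x
      using profile_far[OF _ a, where x = x and A = A] that h unfolding g_def g'_def w_def aA by simp
    have lapl: "radial_laplacian 0 v x = norm x powr (\<kappa> - 2) * (\<alpha> x + (norm x)\<^sup>2 * (\<alpha> x + g x))" if x: "x \<noteq> 0" for x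
    proof -
      have p: "norm x powr \<kappa> = norm x powr (\<kappa> - 2) * (norm x)\<^sup>2"
        using x by (simp add: powr_diff)
      have "radial_laplacian 0 v x = norm x powr (\<kappa> - 2) * ((norm x)\<^sup>2 * (1 / (norm x)\<^sup>2) * ((\<kappa> * g x + g' x) + (N - 2) * g x)
          + (norm x)\<^sup>2 * ((\<kappa> * g x + g' x) + (N - 1) * g x))"
        unfolding radial_laplacian_euler[OF v x] unfolding DDv unfolding Dv N_def[symmetric] p by (simp only: algebra_simps)
      also have "\<dots> = norm x powr (\<kappa> - 2) * (\<alpha> x + (norm x)\<^sup>2 * (\<alpha> x + g x))"
        using x by (simp add: \<alpha>_def \<kappa>_def algebra_simps)
      finally show ?thesis .
    qed
    have pw: "(norm x powr (\<kappa> - 2))\<^sup>2 = inverse (norm x ^ CARD('n))" if "x \<noteq> 0" for x :: "real ^ 'n"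
    proof -
      have "(norm x powr (\<kappa> - 2))\<^sup>2 = norm x powr (- N)"
        by (simp add: power2_eq_square \<kappa>_def flip: powr_add)
      then show ?thesis using that by (simp add: powr_minus powr_realpow N_def)
    qed
    have up: "(\<integral>x. (radial_laplacian 0 v x)\<^sup>2 \<partial>hyp_volume) \<le> (1 + 5 * \<delta>) * J (\<lambda>x. \<alpha> x * \<alpha> x) + 3 * \<delta> * J (\<lambda>x. g x * g x)"
    proof -
      have t: "(\<lambda>x. (radial_laplacian 0 v x)\<^sup>2) \<in> test_functions 0"
        by (intro test_functions_power2 test_functions_radial_laplacian v)
      have t2: "(\<lambda>x. (1 + 5 * \<delta>) * (\<alpha> x * \<alpha> x) + 3 * \<delta> * (g x * g x) + 0 * (g x * g x)) \<in> test_functions 0"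
        by (intro test_functions_add test_functions_cmult test_functions_mult g)
      have "(\<integral>x. (radial_laplacian 0 v x)\<^sup>2 \<partial>hyp_volume) = (\<integral>x. (radial_laplacian 0 v x)\<^sup>2 / ht x \<partial>lborel)"
        by (rule hyp_integral_test[OF t])
      also have "\<dots> \<le> J (\<lambda>x. (1 + 5 * \<delta>) * (\<alpha> x * \<alpha> x) + 3 * \<delta> * (g x * g x) + 0 * (g x * g x))"
        unfolding J_def
      proof (rule integral_mono[OF test_functions_integrable[OF test_functions_div_ht[OF t]] J_integrable[OF t2]])
        fix x :: "real ^ 'n"
        show "(radial_laplacian 0 v x)\<^sup>2 / ht x \<le> inverse (norm x ^ CARD('n)) *
            ((1 + 5 * \<delta>) * (\<alpha> x * \<alpha> x) + 3 * \<delta> * (g x * g x) + 0 * (g x * g x))"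
        proof (cases "x = 0")
          case True
          then show ?thesis using test_functions_eq_0_at_pole[OF t] by (simp add: zero_power)
        next
          case False
          have "(radial_laplacian 0 v x)\<^sup>2 / ht x \<le> (radial_laplacian 0 v x)\<^sup>2 / 1"
            using ht_ge_1[of x] by (intro divide_left_mono) (auto simp: add_pos_nonneg)
          also have "\<dots> = inverse (norm x ^ CARD('n)) * (\<alpha> x + (norm x)\<^sup>2 * (\<alpha> x + g x))\<^sup>2"
            unfolding lapl[OF False] power_mult_distrib pw[OF False] by simp
          also have "\<dots> \<le> inverse (norm x ^ CARD('n)) * ((1 + 5 * \<delta>) * (\<alpha> x)\<^sup>2 + 3 * \<delta> * (g x)\<^sup>2)"
          proof (cases "norm x \<le> \<delta>")
            case True
            have "(norm x)\<^sup>2 \<le> \<delta> * 1"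
              unfolding power2_eq_square using True \<delta> by (intro mult_mono) auto
            then show ?thesis using \<delta> by (intro mult_left_mono square_perturbation) auto
          next
            case False
            then show ?thesis using zero[of x] by (simp add: \<alpha>_def)
          qed
          finally show ?thesis by (simp add: power2_eq_square)
        qed
      qed
      also have "\<dots> = (1 + 5 * \<delta>) * J (\<lambda>x. \<alpha> x * \<alpha> x) + 3 * \<delta> * J (\<lambda>x. g x * g x)"
        using J_linear[OF test_functions_mult[OF g(3,3)] test_functions_mult[OF g(1,1)] test_functions_mult[OF g(1,1)], of "1 + 5 * \<delta>" "3 * \<delta>" 0]
        by simp
      finally show ?thesis .
    qed
    have low: "J (\<lambda>x. g x * g x) \<le> (\<integral>x. 1 / (hyp_dist 0 x)\<^sup>2 * (rd v x)\<^sup>2 \<partial>hyp_volume)"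
    proof -
      have t: "(\<lambda>x. 1 / (hyp_dist 0 x)\<^sup>2 * (rd v x)\<^sup>2) \<in> test_functions 0"
        by (intro test_functions_weight smooth_on_div_hyp_dist test_functions_power2 test_functions_rd v)
      have "J (\<lambda>x. g x * g x) \<le> (\<integral>x. 1 / (hyp_dist 0 x)\<^sup>2 * (rd v x)\<^sup>2 / ht x \<partial>lborel)"
        unfolding J_def
      proof (rule integral_mono[OF J_integrable[OF test_functions_mult[OF g(1,1)]] test_functions_integrable[OF test_functions_div_ht[OF t]]])
        fix x :: "real ^ 'n"
        show "inverse (norm x ^ CARD('n)) * (g x * g x) \<le> 1 / (hyp_dist 0 x)\<^sup>2 * (rd v x)\<^sup>2 / ht x"
        proof (cases "x = 0")
          case True
          then show ?thesis by (simp add: radial_deriv_at_0 zero_power)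
        next
          case False
          have r: "hyp_dist 0 x > 0" "hyp_dist 0 x \<le> norm x" using hyp_dist_0_pos[OF False] hyp_dist_0_le by auto
          \<comment> \<open>Replacing \<open>norm x\<close> by the smaller distance gains
            \<open>q \<ge> 1\<close>, and the two factors \<open>ht\<close> in the squared radial
            derivative outweigh the one in the density.\<close>
          define q where "q = norm x / hyp_dist 0 x"
          have q: "q \<ge> 1" using r by (simp add: q_def)
          have p: "norm x powr \<kappa> = norm x powr (\<kappa> - 2) * (norm x)\<^sup>2"
            using False by (simp add: powr_diff)
          have "1 / (hyp_dist 0 x)\<^sup>2 * (rd v x)\<^sup>2 / ht x = (norm x powr (\<kappa> - 2))\<^sup>2 * (g x)\<^sup>2 * (q\<^sup>2 * ht x)"
            unfolding radial_deriv_eq[OF diff[OF v]] Dv p q_def using False r ht_nz[of x]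
            by (simp add: power_mult_distrib power_divide power2_eq_square field_simps del: real_sqrt_mult_self)
          moreover have "1 \<le> q\<^sup>2 * ht x"
            using mult_mono[of 1 "q\<^sup>2" 1 "ht x"] q ht_ge_1[of x] by simp
          ultimately have "(norm x powr (\<kappa> - 2))\<^sup>2 * (g x)\<^sup>2 * 1 \<le> 1 / (hyp_dist 0 x)\<^sup>2 * (rd v x)\<^sup>2 / ht x"
            by (metis mult_left_mono zero_le_power2 mult_nonneg_nonneg)
          then show ?thesis unfolding pw[OF False] by (simp add: power2_eq_square)
        qed
      qed
      then show ?thesis unfolding hyp_integral_test[OF t] .
    qed
    have "C * J (\<lambda>x. g x * g x) \<le> (1 + 5 * \<delta>) * J (\<lambda>x. \<alpha> x * \<alpha> x) + 3 * \<delta> * J (\<lambda>x. g x * g x)"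
      using mult_left_mono[OF low C] ineq[OF v rad] up by linarith
    also have "\<dots> \<le> (1 + 5 * \<delta>) * (K / a\<^sup>2 * J (\<lambda>x. g x * g x) + (N / 2)\<^sup>2 * J (\<lambda>x. g x * g x)) + 3 * \<delta> * J (\<lambda>x. g x * g x)"
      unfolding J\<alpha> using Jg'_le \<delta> by (intro add_mono mult_left_mono) auto
    also have "\<dots> = ((1 + 5 * \<delta>) * (K * \<delta>\<^sup>2 + (N / 2)\<^sup>2) + 3 * \<delta>) * J (\<lambda>x. g x * g x)"
      using \<delta> by (simp add: a_def algebra_simps power_divide)
    finally show ?thesis using Jgpos by simp
  qed
  \<comment> \<open>Letting \<open>\<delta>\<close> tend to 0 sends the scale to infinity and
    shrinks the support into the pole.\<close>
  have "((\<lambda>\<delta>. (1 + 5 * \<delta>) * (K * \<delta>\<^sup>2 + (N / 2)\<^sup>2) + 3 * \<delta>) \<longlongrightarrow> (1 + 5 * 0) * (K * 0\<^sup>2 + (N / 2)\<^sup>2) + 3 * 0) (at_right 0)"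
    by (intro tendsto_intros)
  moreover have "\<forall>\<^sub>F \<delta> in at_right 0. C \<le> (1 + 5 * \<delta>) * (K * \<delta>\<^sup>2 + (N / 2)\<^sup>2) + 3 * \<delta>"
    unfolding eventually_at_right_field by (intro exI[of _ 1] conjI allI impI bound) auto
  ultimately have "C \<le> (1 + 5 * 0) * (K * 0\<^sup>2 + (N / 2)\<^sup>2) + 3 * 0"
    by (rule tendsto_lowerbound) simp
  then show ?thesis by (simp add: N_def)
next
  case False
  then show ?thesis using zero_le_power2[of "real CARD('n) / 2"] by linarith
qed

section \<open>Signs of the remainder terms and radial functions\<close>

lemma hyp_dist_nonneg: "hyp_dist p x \<ge> 0"
proof -
  have "hyp_dist 0 z \<ge> 0" for z :: "real ^ 'a"
  proof (cases "z = 0")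
    case False
    then show ?thesis using hyp_dist_0_pos[OF False] by simp
  qed (simp add: hyp_dist_0(3))
  then show ?thesis
    using hyp_dist_boost[of p "boost (- p) x"] by (metis boost_boost_minus)
qed

lemma coth_weight_nonneg: "(hyp_dist p x * coth (hyp_dist p x) - 1) / (hyp_dist p x)\<^sup>2 \<ge> 0"
proof (cases "hyp_dist p x = 0")
  case False
  then have "hyp_dist p x > 0" using hyp_dist_nonneg[of p x] by simp
  then show ?thesis using coth_gt_inverse(1)[of "hyp_dist p x"] by (simp add: field_simps)
qed simp

lemma hyp_grad_sq_nonneg: "hyp_grad_sq u x \<ge> 0"
proof -
  define w where "w = hyp_grad u x"
  have "(x \<bullet> w)\<^sup>2 \<le> (x \<bullet> x) * (w \<bullet> w)" by (rule Cauchy_Schwarz_ineq)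
  also have "\<dots> \<le> (ht x)\<^sup>2 * (w \<bullet> w)" unfolding ht_square by (intro mult_right_mono) auto
  finally have "(x \<bullet> w)\<^sup>2 / (ht x)\<^sup>2 \<le> w \<bullet> w"
    using ht_pos[of x] by (subst pos_divide_le_eq) (auto simp: mult.commute simp del: real_sqrt_pow2)
  then show ?thesis by (simp add: hyp_grad_sq_def hyp_metric_eq w_def power2_eq_square)
qed

lemma sinh_hyp_dist_nonneg: "sinh (hyp_dist p x) \<ge> 0"
  using hyp_dist_nonneg by simp

lemma Ang_radial:
  assumes "v \<in> test_functions 0" "radial v"
  shows "Ang v x = 0" "Gam v v x = 0"
proof -
  have R: "Rot i j v = (\<lambda>x. 0)" for i j
    using Rot_radial[OF assms(2) test_functions_differentiable[OF assms(1)]] by auto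
  show "Ang v x = 0" "Gam v v x = 0"
    unfolding Ang_def Gam_def R by (simp_all add: Rot_def)
qed

theorem corollary2p1:
  fixes x0 :: "real ^ 'n" and N :: nat and r :: "real ^ 'n \<Rightarrow> real"
  assumes N: "N = CARD('n)" "N \<ge> 2"
    and r: "r = (\<lambda>x. hyp_dist x0 x)"
  shows
    "(\<forall>u\<in>test_functions x0.
        (\<integral>x. (radial_laplacian x0 u x)\<^sup>2 \<partial>hyp_volume) =
          (real N / 2)\<^sup>2 * (\<integral>x. radial_grad_sq x0 u x / (r x)\<^sup>2 \<partial>hyp_volume)
          + real N * (real N - 1) / 2 *
              (\<integral>x. (r x * coth (r x) - 1) / (r x)\<^sup>2 * radial_grad_sq x0 u x \<partial>hyp_volume)
          + (\<integral>x. r x ^ N / sinh (r x) ^ (2 * (N - 1)) *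
                radial_grad_sq x0
                  (\<lambda>y. sinh (r y) ^ (N - 1) * radial_deriv x0 u y / r y powr (real N / 2)) x
              \<partial>hyp_volume))
     \<and> is_largest ((real N / 2)\<^sup>2) (\<lambda>C. \<forall>u\<in>test_functions x0.
              (\<integral>x. (radial_laplacian x0 u x)\<^sup>2 \<partial>hyp_volume) \<ge>
                C * (\<integral>x. radial_grad_sq x0 u x / (r x)\<^sup>2 \<partial>hyp_volume))
     \<and> (N \<ge> 5 \<longrightarrow>
         (\<forall>u\<in>test_functions x0.
            (\<integral>x. (hyp_laplacian u x)\<^sup>2 \<partial>hyp_volume) \<ge>
              (real N / 2)\<^sup>2 * (\<integral>x. hyp_grad_sq u x / (r x)\<^sup>2 \<partial>hyp_volume)
              + real N * (real N - 1) / 2 *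
                  (\<integral>x. (r x * coth (r x) - 1) / (r x)\<^sup>2 * hyp_grad_sq u x \<partial>hyp_volume)
              + (\<integral>x. r x ^ N / sinh (r x) ^ (2 * (N - 1)) *
                    hyp_grad_sq
                      (\<lambda>y. sinh (r y) ^ (N - 1) * radial_deriv x0 u y / r y powr (real N / 2)) x
                  \<partial>hyp_volume))
         \<and> is_largest ((real N / 2)\<^sup>2) (\<lambda>C. \<forall>u\<in>test_functions x0.
                  (\<integral>x. (hyp_laplacian u x)\<^sup>2 \<partial>hyp_volume) \<ge>
                    C * (\<integral>x. hyp_grad_sq u x / (r x)\<^sup>2 \<partial>hyp_volume)))"
proof -
  note identity = radial_identity_pole[OF _ refl N(1)]
  note inequality = hyp_inequality_pole[OF _ refl N(1)]
  have c: "real N * (real N - 1) / 2 \<ge> 0" using N(2) by simp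
  have weight: "hyp_dist x0 x ^ N / sinh (hyp_dist x0 x) ^ (2 * (N - 1)) \<ge> 0" for x
    by (intro divide_nonneg_nonneg zero_le_power hyp_dist_nonneg sinh_hyp_dist_nonneg)
  \<comment> \<open>Trial functions at the pole \<open>0\<close> are carried to \<open>x0\<close> by
    the inverse boost, so sharpness has to be shown at \<open>0\<close> only.\<close>
  have pulled: "(\<lambda>x. v (boost (- x0) x)) \<in> test_functions x0" "(\<lambda>y. v (boost (- x0) (boost x0 y))) = v"
    if "v \<in> test_functions 0" for v
    using hyp_integral_boost(2)[OF that, of "\<lambda>x. v (boost (- x0) x)" x0] by (simp_all add: boost_minus_boost)
  have "is_largest ((real N / 2)\<^sup>2) (\<lambda>C. \<forall>u\<in>test_functions x0.
      (\<integral>x. (radial_laplacian x0 u x)\<^sup>2 \<partial>hyp_volume) \<ge> C * (\<integral>x. radial_grad_sq x0 u x / (hyp_dist x0 x)\<^sup>2 \<partial>hyp_volume))"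
    unfolding is_largest_def
  proof (intro conjI ballI allI impI)
    fix u assume u: "u \<in> test_functions x0"
    \<comment> \<open>The second and third integrals of the identity are nonnegative and may be
      dropped.\<close>
    have *: "(\<integral>x. (hyp_dist x0 x * coth (hyp_dist x0 x) - 1) / (hyp_dist x0 x)\<^sup>2 * radial_grad_sq x0 u x \<partial>hyp_volume) \<ge> 0"
      by (intro Bochner_Integration.integral_nonneg mult_nonneg_nonneg coth_weight_nonneg) (simp add: radial_grad_sq_def)
    moreover have "(\<integral>x. hyp_dist x0 x ^ N / sinh (hyp_dist x0 x) ^ (2 * (N - 1)) * radial_grad_sq x0
        (\<lambda>y. sinh (hyp_dist x0 y) ^ (N - 1) * radial_deriv x0 u y / hyp_dist x0 y powr (real N / 2)) x \<partial>hyp_volume) \<ge> 0"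
      by (intro Bochner_Integration.integral_nonneg mult_nonneg_nonneg weight) (simp add: radial_grad_sq_def)
    ultimately show "(\<integral>x. (radial_laplacian x0 u x)\<^sup>2 \<partial>hyp_volume) \<ge>
        (real N / 2)\<^sup>2 * (\<integral>x. radial_grad_sq x0 u x / (hyp_dist x0 x)\<^sup>2 \<partial>hyp_volume)"
      using identity[OF u] mult_nonneg_nonneg[OF c *] by linarith
  next
    fix C assume C: "\<forall>u\<in>test_functions x0.
      (\<integral>x. (radial_laplacian x0 u x)\<^sup>2 \<partial>hyp_volume) \<ge> C * (\<integral>x. radial_grad_sq x0 u x / (hyp_dist x0 x)\<^sup>2 \<partial>hyp_volume)"
    show "C \<le> (real N / 2)\<^sup>2"
      unfolding N(1)
    proof (rule radial_constant_le)
      fix v :: "real ^ 'n \<Rightarrow> real" assume v: "v \<in> test_functions 0"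
      show "C * (\<integral>x. 1 / (hyp_dist 0 x)\<^sup>2 * (rd v x)\<^sup>2 \<partial>hyp_volume) \<le> (\<integral>x. (radial_laplacian 0 v x)\<^sup>2 \<partial>hyp_volume)"
        using C[rule_format, OF pulled(1)[OF v]]
        unfolding radial_integrals(1,2)[OF pulled(1)[OF v] pulled(2)[OF v, symmetric] N(1)] .
    qed
  qed
  moreover have "is_largest ((real N / 2)\<^sup>2) (\<lambda>C. \<forall>u\<in>test_functions x0.
      (\<integral>x. (hyp_laplacian u x)\<^sup>2 \<partial>hyp_volume) \<ge> C * (\<integral>x. hyp_grad_sq u x / (hyp_dist x0 x)\<^sup>2 \<partial>hyp_volume))" if "N \<ge> 5"
    unfolding is_largest_def
  proof (intro conjI ballI allI impI)
    fix u assume u: "u \<in> test_functions x0"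
    have *: "(\<integral>x. (hyp_dist x0 x * coth (hyp_dist x0 x) - 1) / (hyp_dist x0 x)\<^sup>2 * hyp_grad_sq u x \<partial>hyp_volume) \<ge> 0"
      by (intro Bochner_Integration.integral_nonneg mult_nonneg_nonneg coth_weight_nonneg hyp_grad_sq_nonneg)
    moreover have "(\<integral>x. hyp_dist x0 x ^ N / sinh (hyp_dist x0 x) ^ (2 * (N - 1)) * hyp_grad_sq
        (\<lambda>y. sinh (hyp_dist x0 y) ^ (N - 1) * radial_deriv x0 u y / hyp_dist x0 y powr (real N / 2)) x \<partial>hyp_volume) \<ge> 0"
      by (intro Bochner_Integration.integral_nonneg mult_nonneg_nonneg weight hyp_grad_sq_nonneg)
    ultimately show "(\<integral>x. (hyp_laplacian u x)\<^sup>2 \<partial>hyp_volume) \<ge>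
        (real N / 2)\<^sup>2 * (\<integral>x. hyp_grad_sq u x / (hyp_dist x0 x)\<^sup>2 \<partial>hyp_volume)"
      using inequality[OF u that] mult_nonneg_nonneg[OF c *] by linarith
  next
    fix C assume C: "\<forall>u\<in>test_functions x0.
      (\<integral>x. (hyp_laplacian u x)\<^sup>2 \<partial>hyp_volume) \<ge> C * (\<integral>x. hyp_grad_sq u x / (hyp_dist x0 x)\<^sup>2 \<partial>hyp_volume)"
    show "C \<le> (real N / 2)\<^sup>2"
      unfolding N(1)
    proof (rule radial_constant_le)
      \<comment> \<open>For radial \<open>v\<close> the spherical terms vanish, so the full
        inequality with constant \<open>C\<close> becomes the radial one and the same trial
        functions apply.\<close>
      fix v :: "real ^ 'n \<Rightarrow> real" assume v: "v \<in> test_functions 0" "radial v"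
      show "C * (\<integral>x. 1 / (hyp_dist 0 x)\<^sup>2 * (rd v x)\<^sup>2 \<partial>hyp_volume) \<le> (\<integral>x. (radial_laplacian 0 v x)\<^sup>2 \<partial>hyp_volume)"
        using C[rule_format, OF pulled(1)[OF v(1)]]
        unfolding hyp_laplacian_square[OF pulled(1)[OF v(1)]] pulled(2)[OF v(1)]
          hyp_integrals(1)[OF pulled(1)[OF v(1)] pulled(2)[OF v(1), symmetric] N(1)] Ang_radial[OF v] by simp
    qed
  qed
  ultimately show ?thesis
    unfolding r using identity inequality by blast
qed

end
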